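(* Let $r\in(1,2)$. Let $\mu$ be a probability measure on $\mathbb{R}^d$ which satisfies the Latała–Oleszkiewicz inequality with parameter $r$ and constant $C_{LO}$. Then there exists a constant $C>0$, depending only on $C_{LO}$ and $r$, such that for any positive integer $n$ the following holds: if $L_2,L_{r,2}>0$ and $f\colon\mathbb{R}^{dn}\to\mathbb{R}$ satisfies $$|f(x)-f(y)|\le L_2|x-y|,\qquad |f(x)-f(y)|\le L_{r,2}\|x-y\|_{r,2}$$ for all $x,y\in(\mathbb{R}^d)^n$, then for all $t>0$ $$\mu^{\otimes n}\left(\left|f-\int_{\mathbb{R}^{dn}}f\,d\mu^{\otimes n}\right|\ge t\right)\le2\exp\left(-\frac12\min\left\{\frac{t^2}{CL_2^2},\ \frac{t^r}{C^{r-1}L_{r,2}^r}\right\}\right).$$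
   Context: $|\cdot|$ is the Euclidean norm. A probability measure $\mu$ on $\mathbb{R}^d$ satisfies the Latała–Oleszkiewicz inequality with parameter $r\in[1,2]$ and constant $C_{LO}<\infty$ if for every smooth $f\colon\mathbb{R}^d\to\mathbb{R}$, $$\sup_{\theta\in(1,2)}\frac{\int_{\mathbb{R}^d} f^2\,d\mu-\left(\int_{\mathbb{R}^d}|f|^\theta d\mu\right)^{2/\theta}}{(2-\theta)^{2(1-1/r)}}\le C_{LO}\int_{\mathbb{R}^d}|\nabla f|^2d\mu.$$ For $x=(x_1,\dots,x_n)\in(\mathbb{R}^d)^n$ and $p\in(1,\infty)$, $\|x\|_{p,2}=\left(\sum_{i=1}^n|x_i|^p\right)^{1/p}$, where $|x_i|$ is the Euclidean norm of $x_i\in\mathbb{R}^d$; $\mathbb{R}^{dn}$ is identified with $(\mathbb{R}^d)^n$. *)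

theory Defs
  imports "HOL-Probability.Probability"
begin

text \<open>
  The constant in the theorem must not depend on the dimension, so the dimension has to be an
  ordinary natural number rather than a type.  Points of the space of dimension \<open>d\<close> are the
  extensional functions on \<open>{..<d}\<close>; the product sigma-algebra below is its Borel
  sigma-algebra.  Points of its \<open>n\<close>-fold power are functions \<open>x\<close> such that \<open>x i\<close> is the
  \<open>i\<close>-th block and \<open>x i j\<close> the \<open>j\<close>-th coordinate of that block.
\<close>

definition Rdim :: "nat \<Rightarrow> (nat \<Rightarrow> real) measure" where
  "Rdim d = (\<Pi>\<^sub>M j\<in>{..<d}. borel)"

definition partial_deriv :: "nat \<Rightarrow> ((nat \<Rightarrow> real) \<Rightarrow> real) \<Rightarrow> (nat \<Rightarrow> real) \<Rightarrow> real" where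
  "partial_deriv j f x = deriv (\<lambda>s. f (x(j := s))) (x j)"

text \<open>
  Infinitely differentiable: the iterated partial derivatives of all orders exist and are
  continuous.  Continuity refers to the product topology on \<open>nat \<Rightarrow> real\<close>, which induces the
  Euclidean topology on \<open>space (Rdim d)\<close> since the coordinates outside \<open>{..<d}\<close> are fixed there.
\<close>

definition smooth :: "nat \<Rightarrow> ((nat \<Rightarrow> real) \<Rightarrow> real) \<Rightarrow> bool" where
  "smooth d f \<longleftrightarrow> (\<forall>js. set js \<subseteq> {..<d} \<longrightarrow>
     continuous_on (space (Rdim d)) (foldr partial_deriv js f) \<and>
     (\<forall>j<d. \<forall>x\<in>space (Rdim d).
        (\<lambda>s. foldr partial_deriv js f (x(j := s))) field_differentiable at (x j)))"

definition grad_norm :: "nat \<Rightarrow> ((nat \<Rightarrow> real) \<Rightarrow> real) \<Rightarrow> (nat \<Rightarrow> real) \<Rightarrow> real" where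
  "grad_norm d f x = L2_set (\<lambda>j. partial_deriv j f x) {..<d}"

text \<open>
  The test functions are the smooth functions for which both sides are finite.  If the energy is
  infinite, the inequality is void; if the second moment is infinite, the difference on the left
  may have the form \<open>\<infinity> - \<infinity>\<close>.  The supremum is taken in the extended reals, as the supremum
  of an unbounded set of reals is unspecified.
\<close>

definition latala_oleszkiewicz :: "nat \<Rightarrow> (nat \<Rightarrow> real) measure \<Rightarrow> real \<Rightarrow> real \<Rightarrow> bool" where
  "latala_oleszkiewicz d \<mu> r K \<longleftrightarrow>
     (\<forall>f. smooth d f \<longrightarrow> integrable \<mu> (\<lambda>x. (f x)\<^sup>2) \<longrightarrow> integrable \<mu> (\<lambda>x. (grad_norm d f x)\<^sup>2) \<longrightarrow>
       (SUP \<theta>\<in>{1<..<2}. ereal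
          (((\<integral>x. (f x)\<^sup>2 \<partial>\<mu>) - (\<integral>x. \<bar>f x\<bar> powr \<theta> \<partial>\<mu>) powr (2 / \<theta>))
             / (2 - \<theta>) powr (2 * (1 - 1 / r))))
       \<le> ereal (K * (\<integral>x. (grad_norm d f x)\<^sup>2 \<partial>\<mu>)))"

definition euclid_norm :: "nat \<Rightarrow> nat \<Rightarrow> (nat \<Rightarrow> nat \<Rightarrow> real) \<Rightarrow> real" where
  "euclid_norm d n x = L2_set (\<lambda>(i, j). x i j) ({..<n} \<times> {..<d})"

definition mixed_norm :: "nat \<Rightarrow> nat \<Rightarrow> real \<Rightarrow> (nat \<Rightarrow> nat \<Rightarrow> real) \<Rightarrow> real" where
  "mixed_norm d n p x = (\<Sum>i<n. L2_set (x i) {..<d} powr p) powr (1 / p)"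

definition power_measure :: "nat \<Rightarrow> (nat \<Rightarrow> real) measure \<Rightarrow> (nat \<Rightarrow> nat \<Rightarrow> real) measure" where
  "power_measure n \<mu> = (\<Pi>\<^sub>M i\<in>{..<n}. \<mu>)"

end

theory Submission
  imports Defs
begin

text \<open>
  Put \<open>b = 2 (1 - 1 / r)\<close>, so that \<open>0 < b < 1\<close>, and let \<open>q = r / (r - 1) = 2 / b\<close> be the exponent
  conjugate to \<open>r\<close>.  The heart of the proof is a modified logarithmic Sobolev inequality on one
  block,
    \<open>Ent (exp g) \<le> A \<integral> (|\<nabla>g|\<^sup>2 + |\<nabla>g| powr q) exp g\<close>,
  where \<open>A\<close> depends only on \<open>r\<close> and the constant of the Latala-Oleszkiewicz inequality
  (lemma \<open>modified_log_sobolev\<close>).  Entropy is subadditive over product measures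
  (\<open>entropy_PiM_le\<close>), and the right-hand side becomes a sum over the blocks.  As \<open>q\<close> is conjugate
  to \<open>r\<close>, the two Lipschitz conditions say by duality that the block gradients of \<open>f\<close> satisfy
  \<open>\<Sum>\<^sub>i |\<nabla>\<^sub>i f|\<^sup>2 \<le> L2\<^sup>2\<close> and \<open>\<Sum>\<^sub>i |\<nabla>\<^sub>i f| powr q \<le> Lr2 powr q\<close>.  Hence
  \<open>Ent (exp (l f)) \<le> A (l\<^sup>2 L2\<^sup>2 + l powr q * Lr2 powr q) \<integral> exp (l f)\<close> for every \<open>l > 0\<close>, without any
  loss in the number of blocks.  Herbst's argument (\<open>herbst\<close>) turns this into the bound
  \<open>exp (A (l\<^sup>2 L2\<^sup>2 + l powr q * Lr2 powr q))\<close> for the Laplace transform of \<open>f - \<integral> f\<close>, and Chernoff's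
  bound with a suitable \<open>l\<close> gives the two regimes of the tail, with \<open>C = 4 A\<close>.

  The one-block inequality is proved by slicing.  Normalise \<open>\<integral> exp g = 1\<close>.  If \<open>u\<close> vanishes outside
  a set of measure \<open>m\<close>, then Hoelder's inequality gives
  \<open>(\<integral> |u| powr \<theta>) powr (2 / \<theta>) \<le> m powr (2 / \<theta> - 1) * \<integral> u\<^sup>2\<close>, so the Latala-Oleszkiewicz inequality
  with \<open>2 - \<theta>\<close> of the order of \<open>1 / ln (1 / m)\<close> bounds \<open>\<integral> u\<^sup>2\<close> by a multiple of
  \<open>(ln (1 / m)) powr (-b) * \<integral> |\<nabla>u|\<^sup>2\<close>.  By Markov's inequality the level set \<open>g \<ge> k\<close> has measure at most
  \<open>exp (-k)\<close>; taking for \<open>u\<close> cutoffs of \<open>exp (g / 2)\<close> at the levels \<open>k = 2, 3, ...\<close> and summing over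
  \<open>k\<close> bounds \<open>\<integral> g exp g\<close> over the set \<open>g \<ge> 8\<close> by a multiple of
  \<open>\<integral> |\<nabla>g|\<^sup>2 g powr (1 - b) * exp g\<close>.  Young's inequality splits the integrand into a small multiple
  of \<open>g\<close>, which is absorbed, and a multiple of \<open>|\<nabla>g| powr (2 / b)\<close>.  Where \<open>g < 8\<close>, the integrand
  \<open>g exp g - exp g + 1\<close> of the entropy is dominated by \<open>(exp (g / 2) - 1)\<^sup>2\<close>, which the
  Latala-Oleszkiewicz inequality for \<open>exp (g / 2)\<close> at \<open>\<theta> = 3 / 2\<close> controls.

  Two approximations connect this with the hypotheses, which concern smooth test functions and
  functions \<open>f\<close> that are only Lipschitz.  The function \<open>f\<close> is truncated and convolved with a
  product of logistic densities; this preserves both Lipschitz conditions and produces smooth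
  functions.  The cutoffs of \<open>exp (g / 2)\<close> are continuously differentiable functions of \<open>g\<close>; they
  are replaced by polynomials in \<open>g\<close>, by Weierstrass' theorem.  The bounds on the Laplace transform
  survive both limits by Fatou's lemma.
\<close>

section \<open>Cutoffs and elementary inequalities\<close>

lemma DERIV_positive_part_square:
  "((\<lambda>t. (max 0 t)\<^sup>2) has_real_derivative 2 * max 0 t) (at (t::real))"
proof -
  consider "t < 0" | "t > 0" | "t = 0" by linarith
  then show ?thesis
  proof cases
    case 1
    have "((\<lambda>t. 0) has_real_derivative 2 * max 0 t) (at t)" using 1 by simp
    then show ?thesis
      by (rule has_field_derivative_transform_within_open[where S="{..<0}"]) (use 1 in auto)
  next
    case 2
    have "((\<lambda>t. t\<^sup>2) has_real_derivative 2 * max 0 t) (at t)"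
      using 2 by (auto intro!: derivative_eq_intros)
    then show ?thesis
      by (rule has_field_derivative_transform_within_open[where S="{0<..}"]) (use 2 in auto)
  next
    case 3
    have "((\<lambda>h. ((max 0 h)\<^sup>2) / h) \<longlongrightarrow> 0) (at (0::real))"
    proof (rule Lim_null_comparison)
      show "\<forall>\<^sub>F h in at 0. norm ((max 0 h)\<^sup>2 / h) \<le> \<bar>h\<bar>"
        by (rule always_eventually) (auto simp: max_def power2_eq_square)
      show "((\<lambda>h::real. \<bar>h\<bar>) \<longlongrightarrow> 0) (at 0)"
        by (auto intro!: tendsto_eq_intros)
    qed
    then show ?thesis using 3 by (simp add: DERIV_def del: max.absorb1)
  qed
qed

text \<open>
  A cutoff of \<open>exp (s / 2)\<close> that vanishes for \<open>s \<le> k\<close> and is comparable to \<open>exp (s / 2)\<close> for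
  \<open>s \<ge> k + 2\<close>.  Squaring the positive part makes it continuously differentiable.
\<close>

definition cutoff :: "real \<Rightarrow> real \<Rightarrow> real" where
  "cutoff k s = exp (s / 2) * (max 0 (1 - exp ((k - s) / 2)))\<^sup>2"

definition cutoff' :: "real \<Rightarrow> real \<Rightarrow> real" where
  "cutoff' k s = exp (s / 2) * (max 0 (1 - exp ((k - s) / 2)) - (max 0 (1 - exp ((k - s) / 2)))\<^sup>2 / 2)"

lemma DERIV_cutoff: "(cutoff k has_real_derivative cutoff' k s) (at s)"
proof -
  define t where "t = max 0 (1 - exp ((k - s) / 2))"
  have tt: "t * exp ((k - s) / 2) = t * (1 - t)"
    unfolding t_def by (auto simp: max_def)
  have "((\<lambda>s. (max 0 (1 - exp ((k - s) / 2)))\<^sup>2) has_real_derivative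
      2 * t * (exp ((k - s) / 2) / 2)) (at s)"
    unfolding t_def
    by (rule DERIV_chain2[OF DERIV_positive_part_square]) (auto intro!: derivative_eq_intros)
  then have "(cutoff k has_real_derivative
      exp (s / 2) / 2 * t\<^sup>2 + exp (s / 2) * (2 * t * (exp ((k - s) / 2) / 2))) (at s)"
    unfolding cutoff_def[abs_def] t_def
    by (rule DERIV_mult[THEN DERIV_cong, rotated]) (auto intro!: derivative_eq_intros)
  also have "exp (s / 2) / 2 * t\<^sup>2 + exp (s / 2) * (2 * t * (exp ((k - s) / 2) / 2)) =
     exp (s / 2) * (t\<^sup>2 / 2 + t * exp ((k - s) / 2))" by (simp add: algebra_simps)
  also have "\<dots> = cutoff' k s"
    unfolding tt unfolding cutoff'_def t_def[symmetric] by (simp add: algebra_simps power2_eq_square)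
  finally show ?thesis .
qed

lemma continuous_cutoff': "continuous_on UNIV (cutoff' k)"
  unfolding cutoff'_def[abs_def] by (intro continuous_intros) auto

lemma cutoff_nonneg: "cutoff k s \<ge> 0" by (simp add: cutoff_def)

lemma cutoff_below: "s \<le> k \<Longrightarrow> cutoff k s = 0" "s \<le> k \<Longrightarrow> cutoff' k s = 0"
  by (auto simp: cutoff_def cutoff'_def max_def)

text \<open>
  With \<open>t\<close> the positive part in the definition, the derivative is
  \<open>exp (s / 2) * (t - t\<^sup>2 / 2)\<close>, and \<open>t - t\<^sup>2 / 2 \<le> 1 / 2\<close>: cutting off does not increase the
  derivative of \<open>exp (s / 2)\<close>.
\<close>

lemma cutoff'_sq_le: "(cutoff' k s)\<^sup>2 \<le> exp s / 4"
proof -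
  define t where "t = max 0 (1 - exp ((k - s) / 2))"
  have t: "0 \<le> t" "t \<le> 1" by (auto simp: t_def)
  have a: "0 \<le> t - t\<^sup>2 / 2"
    using t mult_left_le[of t t] by (simp add: power2_eq_square)
  have "(1 - t)\<^sup>2 \<ge> 0" by simp
  then have b: "t - t\<^sup>2 / 2 \<le> 1 / 2" by (simp add: power2_eq_square algebra_simps)
  have "(cutoff' k s)\<^sup>2 = exp s * (t - t\<^sup>2 / 2)\<^sup>2"
    unfolding cutoff'_def t_def[symmetric] by (simp add: power_mult_distrib exp_double[symmetric])
  also have "(t - t\<^sup>2 / 2)\<^sup>2 \<le> (1/2)\<^sup>2" using a b by (intro power_mono) auto
  finally show ?thesis by (simp add: power2_eq_square)
qed

lemma exp_minus_one_le_half: "exp (-1::real) \<le> 1/2"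
  using exp_ge_add_one_self[of 1] by (simp add: exp_minus field_simps)

lemma cutoff_sq_ge:
  assumes "s \<ge> k + 2"
  shows "exp s / 16 \<le> (cutoff k s)\<^sup>2"
proof -
  have "exp ((k - s) / 2) \<le> exp (-1)" using assms by simp
  then have "max 0 (1 - exp ((k - s) / 2)) \<ge> 1/2" using exp_minus_one_le_half by linarith
  then have "(max 0 (1 - exp ((k - s) / 2)))^4 \<ge> (1/2)^4" by (intro power_mono) auto
  moreover have "(cutoff k s)\<^sup>2 = exp s * (max 0 (1 - exp ((k - s) / 2)))^4"
    by (simp add: cutoff_def power_mult_distrib exp_double[symmetric] power_mult[symmetric])
  ultimately show ?thesis by (simp add: power4_eq_xxxx field_simps)
qed

text \<open>
  Convexity of \<open>exp\<close>.  Integrated over a set that carries \<open>u\<close>, with the best \<open>c\<close>, this is the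
  case of Hoelder's inequality that compares the \<open>th\<close>-th and the second moment of \<open>u\<close>.
\<close>

lemma young_theta:
  fixes u c th :: real
  assumes "u > 0" "c > 0" "0 < th" "th < 2"
  shows "u powr th \<le> th / 2 * c powr (th - 2) * u\<^sup>2 + (1 - th / 2) * c powr th"
proof -
  define a where "a = c powr (th - 2) * u\<^sup>2"
  define b where "b = c powr th"
  have pos: "a > 0" "b > 0" using assms by (auto simp: a_def b_def)
  have "u powr th = exp (th/2 * ln a + (1 - th/2) * ln b)"
    using assms unfolding a_def b_def powr_def
    by (simp add: ln_mult ln_powr ln_realpow exp_add[symmetric] powr_def algebra_simps)
  also have "\<dots> \<le> th/2 * exp (ln a) + (1 - th/2) * exp (ln b)"
    using convex_onD[OF exp_convex, of "1 - th/2" "ln a" "ln b"] assms by simp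
  also have "\<dots> = th/2 * a + (1 - th/2) * b" using pos by simp
  finally show ?thesis by (simp only: a_def b_def mult.assoc)
qed

lemma sum_powr_le:
  fixes b :: real
  assumes b: "0 < b" "b < 1" and "N \<ge> 1"
  shows "(\<Sum>k=2..N. real k powr (-b)) \<le> (real N powr (1 - b)) / (1 - b)"
  using \<open>N \<ge> 1\<close>
proof (induction N rule: dec_induct)
  case base then show ?case using b by simp
next
  case (step N)
  have "\<exists>z. real N < z \<and> z < real (Suc N) \<and>
     (real (Suc N) powr (1 - b)) / (1 - b) - (real N powr (1 - b)) / (1 - b) =
      (real (Suc N) - real N) * (z powr (- b))"
  proof (rule MVT2)
    fix x assume "real N \<le> x" "x \<le> real (Suc N)"
    then show "((\<lambda>x. x powr (1 - b) / (1 - b)) has_real_derivative x powr - b) (at x)"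
      using step b by (auto intro!: derivative_eq_intros)
  qed simp
  then obtain z where z: "real N < z" "z < real (Suc N)"
    "(real (Suc N) powr (1 - b)) / (1 - b) - (real N powr (1 - b)) / (1 - b) = z powr (- b)" by auto
  have "real (Suc N) powr (-b) \<le> z powr (- b)"
    using z step b by (intro powr_mono2') auto
  then show ?case using step z(3) by (simp del: of_nat_Suc add: sum.atLeast_Suc_atMost Suc_le_eq)
qed

text \<open>
  Young's inequality with exponents \<open>1 / (1 - b)\<close> and \<open>1 / b\<close>: if the first summand alone does not
  suffice, then \<open>x\<close> is below \<open>(D / d) powr (1 / b)\<close>.
\<close>

lemma young_absorb:
  fixes D x d b :: real
  assumes "0 \<le> D" "0 < x" "0 < d" "0 < b" "b < 1"
  shows "D * x powr (1 - b) \<le> d * x + d powr (- (1 - b) / b) * D powr (1 / b)"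
proof (cases "D * x powr (1 - b) \<le> d * x")
  case True
  then show ?thesis using assms by (smt (verit) mult_nonneg_nonneg powr_ge_zero)
next
  case False
  then have "d * (x powr b * x powr (1 - b)) < D * x powr (1 - b)"
    using assms by (simp add: powr_add[symmetric])
  then have "d * x powr b < D" using assms by (simp add: mult.assoc[symmetric])
  then have Dp: "D > 0" and "x powr b < D / d" using assms by
      (auto simp: field_simps intro: le_less_trans[rotated])
  then have "(x powr b) powr (1/b) \<le> (D/d) powr (1/b)" using assms by (intro powr_mono2) auto
  then have "x \<le> (D/d) powr (1/b)" using assms by (simp add: powr_powr)
  then have "x powr (1 - b) \<le> ((D/d) powr (1/b)) powr (1 - b)" using assms by (intro powr_mono2) auto
  also have "\<dots> = D powr ((1 - b) / b) * d powr (- (1 - b) / b)"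
    using assms Dp by (simp add: powr_powr powr_divide powr_minus_divide minus_divide_left[symmetric]
        del: minus_diff_eq)
  finally have "D * x powr (1 - b) \<le> D * (D powr ((1 - b) / b) * d powr (- (1 - b) / b))"
    using Dp by simp
  also have "\<dots> = d powr (- (1 - b) / b) * (D powr 1 * D powr ((1 - b) / b))" using Dp by simp
  also have "D powr 1 * D powr ((1 - b) / b) = D powr (1 / b)"
  proof -
    have "1 + (1 - b) / b = 1 / b" using assms by (simp add: field_simps)
    then show ?thesis unfolding powr_add[symmetric] by simp
  qed
  finally show ?thesis using assms by (smt (verit) mult_pos_pos)
qed

section \<open>From Latala-Oleszkiewicz to a modified logarithmic Sobolev inequality\<close>

lemma (in prob_space) integrable_bounded:
  fixes f :: "'a \<Rightarrow> real"
  assumes "f \<in> borel_measurable M" "\<And>x. x \<in> space M \<Longrightarrow> \<bar>f x\<bar> \<le> c"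
  shows "integrable M f"
  using assms by (intro integrable_const_bound[of _ c]) auto

definition entropy_of :: "'a measure \<Rightarrow> ('a \<Rightarrow> real) \<Rightarrow> real" where
  "entropy_of M F = (\<integral>x. F x * ln (F x) \<partial>M) - (\<integral>x. F x \<partial>M) * ln (\<integral>x. F x \<partial>M)"

text \<open>
  The constant in front of \<open>\<integral> D g powr (1 - b) * exp g\<close> before Young's inequality is applied; the
  added 1 keeps it positive.
\<close>

definition absorb_const :: "real \<Rightarrow> real \<Rightarrow> real" where
  "absorb_const b K = 24 * K / (1 - b) + 1"

definition mls_const :: "real \<Rightarrow> real \<Rightarrow> real" where
  "mls_const b K = ((exp 4 + 1)\<^sup>2 + 32) * K
     + 2 * absorb_const b K * (2 * absorb_const b K) powr ((1 - b) / b)"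

text \<open>
  The one-block argument uses the Latala-Oleszkiewicz inequality only for functions \<open>\<phi> \<circ> g\<close> of one
  fixed function \<open>g\<close>.  The chain rule then leaves a single trace of the geometry, the function
  \<open>D = |\<nabla>g|\<^sup>2\<close>, and the argument makes sense on every probability space.
\<close>

locale LO_chain = prob_space M for M :: "'a measure" +
  fixes g D :: "'a \<Rightarrow> real" and B b K :: real
  assumes g_meas [measurable]: "g \<in> borel_measurable M"
    and D_meas [measurable]: "D \<in> borel_measurable M"
    and g_bound: "\<And>x. x \<in> space M \<Longrightarrow> \<bar>g x\<bar> \<le> B"
    and D_nonneg: "\<And>x. x \<in> space M \<Longrightarrow> 0 \<le> D x"
    and D_bound: "\<And>x. x \<in> space M \<Longrightarrow> D x \<le> B"
    and K_nonneg: "0 \<le> K" and b: "0 < b" "b < 1"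
    and LO: "\<And>\<phi> \<phi>' \<theta>. (\<And>s. (\<phi> has_real_derivative \<phi>' s) (at s)) \<Longrightarrow>
       continuous_on UNIV \<phi>' \<Longrightarrow> 1 < \<theta> \<Longrightarrow> \<theta> < 2 \<Longrightarrow>
       (\<integral>x. (\<phi> (g x))\<^sup>2 \<partial>M) - (\<integral>x. \<bar>\<phi> (g x)\<bar> powr \<theta> \<partial>M) powr (2 / \<theta>)
         \<le> K * (2 - \<theta>) powr b * (\<integral>x. (\<phi>' (g x))\<^sup>2 * D x \<partial>M)"
begin

lemma B_nonneg: "0 \<le> B"
  using D_nonneg D_bound not_empty by fastforce

lemma integrable_of_g:
  assumes "h \<in> borel_measurable borel" "\<And>s. \<bar>s\<bar> \<le> B \<Longrightarrow> \<bar>h s\<bar> \<le> c"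
  shows "integrable M (\<lambda>x. h (g x))" "integrable M (\<lambda>x. h (g x) * D x)"
    "integrable M (\<lambda>x. h (g x) * D x powr (1 / b))"
proof -
  note [measurable] = assms(1)
  have *: "\<bar>h (g x)\<bar> \<le> c" if "x \<in> space M" for x using assms(2) g_bound that by auto
  have c: "0 \<le> c" using * not_empty by fastforce
  show "integrable M (\<lambda>x. h (g x))" by (rule integrable_bounded[of _ c]) (use * in auto)
  show "integrable M (\<lambda>x. h (g x) * D x)"
    by (rule integrable_bounded[of _ "c * B"])
      (use * D_nonneg D_bound c in \<open>auto simp: abs_mult intro!: mult_mono\<close>)
  show "integrable M (\<lambda>x. h (g x) * D x powr (1 / b))"
    by (rule integrable_bounded[of _ "c * B powr (1 / b)"])
      (use * D_nonneg D_bound c b in \<open>auto simp: abs_mult intro!: mult_mono powr_mono2\<close>)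
qed

lemma exp_le_expB: "\<bar>s\<bar> \<le> B \<Longrightarrow> exp s \<le> exp B" by auto

text \<open>
  For \<open>u = exp (g / 2)\<close>, so that \<open>\<integral> u\<^sup>2 = 1\<close>, the left-hand side of the hypothesis at \<open>\<theta> = 3 / 2\<close>
  is at least \<open>1 - \<integral> u powr (3 / 2)\<close>.  With \<open>v = u powr (1 / 2)\<close> the inequality
  \<open>(v\<^sup>2 - 1)\<^sup>2 \<le> 3 v ^ 4 - 4 v ^ 3 + 1\<close> shows that this controls \<open>\<integral> (u - 1)\<^sup>2\<close>.
\<close>

lemma variance_bound:
  assumes norm: "(\<integral>x. exp (g x) \<partial>M) = 1"
  shows "(\<integral>x. (exp (g x / 2) - 1)\<^sup>2 \<partial>M) \<le> K * (\<integral>x. exp (g x) * D x \<partial>M)"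
proof -
  define m where "m = (\<integral>x. exp (3 * g x / 4) \<partial>M)"
  note i1 = integrable_of_g[of exp "exp B"]
  have i2: "integrable M (\<lambda>x. exp (3 * g x / 4))"
    by (rule integrable_of_g(1)[of "\<lambda>s. exp (3 * s / 4)" "exp (3 * B / 4)"]) auto
  have i3: "integrable M (\<lambda>x. exp (g x / 2))"
    by (rule integrable_of_g(1)[of "\<lambda>s. exp (s / 2)" "exp (B / 2)"]) auto
  have key: "(exp (s / 2) - 1)\<^sup>2 \<le> 3 * exp s + 1 - 4 * exp (3 * s / 4)" for s :: real
  proof -
    define v where "v = exp (s / 4)"
    have v: "v > 0" by (simp add: v_def)
    have e: "exp (s/2) = v^2" "exp (3 * s / 4) = v^3" "exp s = v^4"
      by (simp_all add: v_def exp_of_nat_mult[symmetric])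
    have "3 * v^4 + 1 - 4 * v^3 - (v^2 - 1)\<^sup>2 = (v - 1)\<^sup>2 * (2 * v\<^sup>2)"
      by (simp add: algebra_simps power2_eq_square power3_eq_cube power4_eq_xxxx)
    also have "\<dots> \<ge> 0" by simp
    finally show ?thesis unfolding e by simp
  qed
  have "exp (3 * s / 4) \<le> 3/4 * exp s + 1/4" for s :: real
    using key[of s] zero_le_power2[of "exp (s/2) - 1"] by linarith
  then have "m \<le> (\<integral>x. 3/4 * exp (g x) + 1/4 \<partial>M)" unfolding m_def
    using i1(1) i2 by (intro integral_mono) auto
  also have "\<dots> = 1" using i1(1) norm by (simp add: prob_space)
  finally have m1: "m \<le> 1" .
  have m0: "0 \<le> m" unfolding m_def by simp
  have "m powr (4/3) \<le> m powr 1" if "m > 0" using that m1 by (intro powr_mono') auto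
  then have mp: "m powr (4/3) \<le> m" using m0 by (cases "m = 0") auto
  have "(\<integral>x. (exp (g x / 2))\<^sup>2 \<partial>M) - (\<integral>x. \<bar>exp (g x / 2)\<bar> powr (3/2) \<partial>M) powr (2 / (3/2))
         \<le> K * (2 - 3/2) powr b * (\<integral>x. (exp (g x / 2) / 2)\<^sup>2 * D x \<partial>M)"
    by (rule LO[of "\<lambda>s. exp (s / 2)"]) (auto intro!: derivative_eq_intros continuous_intros)
  also have "(\<integral>x. (exp (g x / 2))\<^sup>2 \<partial>M) = 1" using norm by (simp add: exp_double[symmetric])
  also have "(\<integral>x. \<bar>exp (g x / 2)\<bar> powr (3/2) \<partial>M) = m" unfolding m_def by (simp add: powr_def)
  also have "(\<integral>x. (exp (g x / 2) / 2)\<^sup>2 * D x \<partial>M) = (\<integral>x. exp (g x) * D x / 4 \<partial>M)"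
    by (intro Bochner_Integration.integral_cong) (auto simp: power_divide exp_double[symmetric])
  finally have "1 - m powr (4/3) \<le> K * (2 - 3/2) powr b * ((\<integral>x. exp (g x) * D x \<partial>M) / 4)" by simp
  also have "\<dots> \<le> K * 1 * ((\<integral>x. exp (g x) * D x \<partial>M) / 4)"
    using K_nonneg b D_nonneg by (intro mult_right_mono mult_left_mono)
        (auto intro!: Bochner_Integration.integral_nonneg powr_le1)
  finally have L: "4 * (1 - m) \<le> K * (\<integral>x. exp (g x) * D x \<partial>M)" using mp by simp
  have "(\<integral>x. (exp (g x / 2) - 1)\<^sup>2 \<partial>M) \<le> (\<integral>x. 3 * exp (g x) + 1 - 4 * exp (3 * g x / 4) \<partial>M)"
    using i1(1) i2 i3 key by (intro integral_mono) (auto simp: power2_diff exp_double[symmetric])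
  also have "\<dots> = 4 * (1 - m)" using i1(1) i2 norm by (simp add: m_def prob_space)
  finally show ?thesis using L by simp
qed

text \<open>
  The cutoff of \<open>exp (g / 2)\<close> at level \<open>k\<close> is carried by the set \<open>g \<ge> k\<close>, whose measure is at most
  \<open>exp (- k)\<close>.  The choice \<open>\<theta> = 2 - 1 / k\<close> makes the factor \<open>exp (- k) powr (2 / \<theta> - 1)\<close> from
  Hoelder's inequality at most \<open>2 / 3\<close>, so that a third of \<open>\<integral> u\<^sup>2\<close> remains on the left.
\<close>

lemma tail_bound:
  assumes norm: "(\<integral>x. exp (g x) \<partial>M) = 1" and k: "k \<ge> 2"
  shows "(\<integral>x. exp (g x) * indicator {k + 2..} (g x) \<partial>M)
     \<le> 12 * K * k powr (-b) * (\<integral>x. exp (g x) * indicator {k..} (g x) * D x \<partial>M)"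
proof -
  define u where "u x = cutoff k (g x)" for x
  define U where "U = (\<integral>x. (u x)\<^sup>2 \<partial>M)"
  define th where "th = 2 - 1 / k"
  have th: "1 < th" "th < 2" using k by (auto simp: th_def field_simps)
  have cmeas[measurable]: "cutoff k \<in> borel_measurable borel" "cutoff' k \<in> borel_measurable borel"
    unfolding cutoff_def[abs_def] cutoff'_def[abs_def] by measurable
  have c_le: "cutoff k s \<le> exp (s / 2)" for s
    unfolding cutoff_def by (auto simp: max_def intro!: power_le_one mult_left_le)
  have c_le2: "(cutoff k s)\<^sup>2 \<le> exp s" for s
    using power_mono[OF c_le[of s] cutoff_nonneg, of 2] by (simp add: exp_double[symmetric])
  have iu2: "integrable M (\<lambda>x. (u x)\<^sup>2)" unfolding u_def
    by (rule integrable_of_g(1)[of "\<lambda>s. (cutoff k s)\<^sup>2" "exp B"])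
        (auto intro!: order_trans[OF c_le2] exp_le_expB)
  have iD: "integrable M (\<lambda>x. exp (g x) * indicator {k..} (g x) * D x)"
    by (rule integrable_of_g(2)[of "\<lambda>s. exp s * indicator {k..} s" "exp B"]) (auto simp: indicator_def)
  have iI: "integrable M (\<lambda>x. exp (g x) * indicator {k + 2..} (g x))"
    by (rule integrable_of_g(1)[of "\<lambda>s. exp s * indicator {k + 2..} s" "exp B"])
        (auto simp: indicator_def)
  have iind: "integrable M (\<lambda>x. indicator {k..} (g x) :: real)"
    by (rule integrable_of_g(1)[of "indicator {k..}" "1"]) (auto simp: indicator_def)
  have ie: "integrable M (\<lambda>x. exp (g x))"
    by (rule integrable_of_g(1)[of exp "exp B"]) auto
  have U0: "0 \<le> U" unfolding U_def by simp
  have "(\<integral>x. exp (g x) * indicator {k + 2..} (g x) \<partial>M) \<le> (\<integral>x. 16 * (u x)\<^sup>2 \<partial>M)"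
    using iu2 iI cutoff_sq_ge[of k] by (intro integral_mono)
        (auto simp: u_def indicator_def field_simps)
  then have A: "(\<integral>x. exp (g x) * indicator {k + 2..} (g x) \<partial>M) \<le> 16 * U" by (simp add: U_def)
  have Ith: "(\<integral>x. \<bar>u x\<bar> powr th \<partial>M) powr (2 / th) \<le> U * (2/3)"
  proof (cases "U = 0")
    case True
    then have "AE x in M. (u x)\<^sup>2 = 0" using iu2 unfolding U_def
      by (subst (asm) integral_nonneg_eq_0_iff_AE) auto
    then have "(\<integral>x. \<bar>u x\<bar> powr th \<partial>M) = (\<integral>x. 0 \<partial>M)" unfolding u_def
      by (intro integral_cong_AE) auto
    then show ?thesis using True by simp
  next
    case False
    define p where "p = exp (- k)"
    \<comment> \<open>chosen so that \<open>c powr (th - 2) * U = c powr th * p\<close>: the two terms of the pointwise bound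
        then recombine after integration\<close>
    define c where "c = sqrt (U / p)"
    have c: "c > 0" "c\<^sup>2 = U / p" using False U0 by (auto simp: c_def p_def)
    have P: "(\<integral>x. indicator {k..} (g x) \<partial>M) \<le> p"
    proof -
      have "(\<integral>x. indicator {k..} (g x) \<partial>M) \<le> (\<integral>x. exp (g x) * p \<partial>M)"
        by (rule integral_mono[OF iind integrable_mult_left[OF ie]])
            (auto simp: indicator_def p_def exp_add[symmetric])
      then show ?thesis using norm by simp
    qed
    have pt: "\<bar>u x\<bar> powr th \<le> th / 2 * c powr (th - 2) * (u x)\<^sup>2 + (1
        - th / 2) * c powr th * indicator {k..} (g x)" for x
    proof (cases "u x = 0")
      case True then show ?thesis using th by (auto simp: indicator_def)
    next
      case False
      then have "g x \<ge> k" using cutoff_below(1)[of "g x" k] by (force simp: u_def)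
      moreover have "u x > 0" using False cutoff_nonneg[of k "g x"] by (simp add: u_def)
      ultimately show ?thesis using young_theta[of "u x" c th] c th by simp
    qed
    have Uc: "c powr (th - 2) * U = c powr th * p"
    proof -
      have "U = c powr 2 * p" using c unfolding p_def by (simp only: powr_numeral) simp
      then have "c powr (th - 2) * U = (c powr (th - 2) * c powr 2) * p" by (metis mult.assoc)
      also have "c powr (th - 2) * c powr 2 = c powr th" by (simp only: powr_add[symmetric]) simp
      finally show ?thesis .
    qed
    have "(\<integral>x. \<bar>u x\<bar> powr th \<partial>M) \<le> (\<integral>x. th / 2 * c powr (th - 2) * (u x)\<^sup>2 + (1
        - th / 2) * c powr th * indicator {k..} (g x) \<partial>M)"
    proof (rule integral_mono[OF _ _ pt])
      show R: "integrable M (\<lambda>x. th / 2 * c powr (th - 2) * (u x)\<^sup>2 + (1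
          - th / 2) * c powr th * indicator {k..} (g x))"
        using iu2 iind by auto
      show "integrable M (\<lambda>x. \<bar>u x\<bar> powr th)"
        by (rule Bochner_Integration.integrable_bound[OF R]) (use pt in \<open>auto simp: u_def intro!:
            order_trans[OF _ abs_ge_self]\<close>)
    qed
    also have "\<dots> = th / 2 * c powr (th - 2) * U + (1
        - th / 2) * c powr th * (\<integral>x. indicator {k..} (g x) \<partial>M)"
      using iu2 iind by (simp add: U_def)
    also have "\<dots> \<le> th / 2 * c powr (th - 2) * U + (1 - th / 2) * c powr th * p"
      using P th by (intro add_left_mono mult_left_mono) auto
    also have "th / 2 * c powr (th - 2) * U + (1 - th / 2) * c powr th * p = c powr th * p"
      unfolding mult.assoc Uc by (simp add: algebra_simps)
    finally have "(\<integral>x. \<bar>u x\<bar> powr th \<partial>M) powr (2 / th) \<le> (c powr th * p) powr (2 / th)"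
      using th by (intro powr_mono2) auto
    also have "\<dots> = c powr 2 * p powr (2 / th)"
      using c th by (simp add: powr_mult powr_powr p_def)
    also have "\<dots> = U * p powr (2 / th - 1)" using c by (simp add: powr_diff p_def)
    also have "p powr (2 / th - 1) = exp (- (1 / th))"
      using k th by (simp add: p_def powr_def th_def field_simps)
    also have "\<dots> \<le> exp (- (1/2))" using th by (simp add: field_simps)
    also have "exp (- (1/2)) \<le> (2/3::real)"
      using exp_ge_add_one_self[of "1/2"] by (simp add: exp_minus field_simps)
    finally show ?thesis using U0 by (simp add: mult_left_mono)
  qed
  have "U - (\<integral>x. \<bar>u x\<bar> powr th \<partial>M) powr (2 / th) \<le>
      K * (2 - th) powr b * (\<integral>x. (cutoff' k (g x))\<^sup>2 * D x \<partial>M)"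
    unfolding U_def u_def
    by (rule LO) (use DERIV_cutoff continuous_cutoff' th in auto)
  also have "(2 - th) powr b = k powr (-b)" using k by (simp add: th_def powr_divide powr_minus_divide)
  also have "(\<integral>x. (cutoff' k (g x))\<^sup>2 * D x \<partial>M) \<le> (\<integral>x. (exp (g x) * indicator {k..} (g x) * D x) / 4 \<partial>M)"
  proof (rule integral_mono)
    show "integrable M (\<lambda>x. (cutoff' k (g x))\<^sup>2 * D x)"
      by (rule integrable_of_g(2)[of "\<lambda>s. (cutoff' k s)\<^sup>2" "exp B"])
        (auto intro!: order_trans[OF cutoff'_sq_le] order_trans[OF _ exp_le_expB])
    show "integrable M (\<lambda>x. (exp (g x) * indicator {k..} (g x) * D x) / 4)" using iD by auto
    fix x assume "x \<in> space M"
    then have "0 \<le> D x" by (rule D_nonneg)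
    then show "(cutoff' k (g x))\<^sup>2 * D x \<le> (exp (g x) * indicator {k..} (g x) * D x) / 4"
      using mult_right_mono[OF cutoff'_sq_le[of k "g x"], of "D x"] cutoff_below(2)[of "g x" k]
      by (auto simp: indicator_def)
  qed
  finally have "U - (\<integral>x. \<bar>u x\<bar> powr th \<partial>M) powr (2 / th) \<le>
     K * k powr - b * ((\<integral>x. exp (g x) * indicator {k..} (g x) * D x \<partial>M) / 4)"
    using K_nonneg by (simp add: mult_left_mono)
  with A Ith show ?thesis by simp
qed

text \<open>
  Summing the tail bounds over the integers \<open>k \<ge> 2\<close> recovers the missing factor \<open>g\<close>, since \<open>k + 2 \<le> s\<close>
  holds for about \<open>s - 3\<close> of them; from \<open>s = 8\<close> on this is at least \<open>s / 2\<close>.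
\<close>

lemma count_levels_ge:
  assumes "8 \<le> s" "s \<le> real N"
  shows "s / 2 \<le> (\<Sum>k=2..N. indicator {real k + 2..} s :: real)"
proof -
  define m where "m = nat \<lfloor>s\<rfloor> - 2"
  have m: "real m \<le> s - 2" "real m \<ge> s - 3" "m \<le> N" using assms unfolding m_def by linarith+
  have "s / 2 \<le> real (card {2..m})" using m assms by simp
  also have "\<dots> = (\<Sum>k=2..m. indicator {real k + 2..} s)"
    using m by (simp add: indicator_def)
  also have "\<dots> \<le> (\<Sum>k=2..N. indicator {real k + 2..} s)"
    using m by (intro sum_mono2) auto
  finally show ?thesis .
qed

lemma weighted_levels_le:
  shows "(\<Sum>k=2..N. real k powr (-b) * indicator {real k..} s)
      \<le> s powr (1 - b) / (1 - b) * indicator {2..} s"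
proof (cases "s \<ge> 2")
  case False
  then have "(\<Sum>k=2..N. real k powr (-b) * indicator {real k..} s) = (\<Sum>k=2..N. 0)"
    by (intro sum.cong) (auto simp: indicator_def)
  then show ?thesis using False by simp
next
  case True
  define m where "m = nat \<lfloor>s\<rfloor>"
  have m: "1 \<le> m" "real m \<le> s" using True unfolding m_def by linarith+
  have km: "k \<le> m" if "real k \<le> s" for k using that unfolding m_def by linarith
  have "(\<Sum>k=2..N. real k powr (-b) * indicator {real k..} s) = (\<Sum>k\<in>{k\<in>{2..N}. real k
      \<le> s}. real k powr (-b))"
    by (auto simp: indicator_def sum.If_cases intro!: sum.mono_neutral_cong_right)
  also have "\<dots> \<le> (\<Sum>k=2..m. real k powr (-b))"
    using km by (intro sum_mono2) auto
  also have "\<dots> \<le> real m powr (1 - b) / (1 - b)" by (rule sum_powr_le) (use b m in auto)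
  also have "\<dots> \<le> s powr (1 - b) / (1 - b)" using b m by (intro divide_right_mono powr_mono2) auto
  finally show ?thesis using True by simp
qed

text \<open>
  Summation over the levels leaves \<open>D * g powr (1 - b)\<close>, and Young's inequality splits off \<open>g\<close> with a
  coefficient that amounts to one half in the end.  Half of the integral over \<open>g \<ge> 8\<close> moves to the left;
  the integral over \<open>2 \<le> g < 8\<close> stays on the right.
\<close>

lemma large_values_bound:
  assumes norm: "(\<integral>x. exp (g x) \<partial>M) = 1"
  shows "(\<integral>x. exp (g x) * g x * indicator {8..} (g x) \<partial>M)
     \<le> (\<integral>x. exp (g x) * g x * indicator {2..<8} (g x) \<partial>M)
       + 2 * absorb_const b K * (2 * absorb_const b K) powr ((1
           - b) / b) * (\<integral>x. exp (g x) * D x powr (1 / b) \<partial>M)"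
proof -
  define N where "N = nat \<lceil>B\<rceil>"
  define c where "c = absorb_const b K"
  have "24 * K / (1 - b) \<ge> 0" using K_nonneg b by simp
  then have c1: "c \<ge> 24 * K / (1 - b)" "c > 0" unfolding c_def absorb_const_def by linarith+
  have gN: "g x \<le> real N" if "x \<in> space M" for x
    using g_bound[OF that] unfolding N_def by linarith
  define T where "T k x = exp (g x) * indicator {real k..} (g x) * D x" for k x
  define e where "e = (2 * c) powr ((1 - b) / b)"
  have ii: "integrable M (\<lambda>x. exp (g x) * g x * indicator S (g x))" if "S \<in> sets borel" for S ::
      "real set"
    by (rule integrable_of_g(1)[of "\<lambda>s. exp s * s * indicator S s" "exp B * B"])
      (use that in \<open>auto simp: indicator_def abs_mult intro!: mult_mono\<close>)
  have iI: "integrable M (\<lambda>x. exp (g x) * indicator {k..} (g x))" for k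
    by (rule integrable_of_g(1)[of "\<lambda>s. exp s * indicator {k..} s" "exp B"]) (auto simp: indicator_def)
  have iD: "integrable M (T k)" for k
    unfolding T_def by (rule integrable_of_g(2)[of "\<lambda>s. exp s * indicator {real k..} s" "exp B"])
        (auto simp: indicator_def)
  have ieD: "integrable M (\<lambda>x. exp (g x) * D x powr (1 / b))"
    by (rule integrable_of_g(3)[of exp "exp B"]) auto
  have i1: "integrable M (\<lambda>x. 2 * (\<Sum>k=2..N. exp (g x) * indicator {real k + 2..} (g x)))"
    by (intro integrable_mult_right Bochner_Integration.integrable_sum iI)
  have "(\<integral>x. exp (g x) * g x * indicator {8..} (g x) \<partial>M) \<le>
      (\<integral>x. 2 * (\<Sum>k=2..N. exp (g x) * indicator {real k + 2..} (g x)) \<partial>M)"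
  proof (rule integral_mono[OF ii i1])
    fix x assume x: "x \<in> space M"
    show "exp (g x) * g x * indicator {8..} (g x)
        \<le> 2 * (\<Sum>k=2..N. exp (g x) * indicator {real k + 2..} (g x))"
    proof (cases "g x \<ge> 8")
      case True
      then show ?thesis using count_levels_ge[OF True gN[OF x]] by
          (simp add: sum_distrib_left[symmetric])
    next
      case False
      then show ?thesis by (auto intro!: sum_nonneg)
    qed
  qed auto
  also have "\<dots> = 2 * (\<Sum>k=2..N. (\<integral>x. exp (g x) * indicator {real k + 2..} (g x) \<partial>M))"
    unfolding integral_mult_right_zero by (subst Bochner_Integration.integral_sum) (auto intro: iI)
  also have "\<dots> \<le> 2 * (\<Sum>k=2..N. 12 * K * real k powr (-b) * (\<integral>x. T k x \<partial>M))"
    unfolding T_def by (intro mult_left_mono sum_mono tail_bound[OF norm]) auto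
  also have "\<dots> = 24 * K * (\<Sum>k=2..N. (\<integral>x. real k powr (-b) * T k x \<partial>M))"
    by (simp add: sum_distrib_left mult.assoc)
  also have "\<dots> = 24 * K * (\<integral>x. (\<Sum>k=2..N. real k powr (-b) * T k x) \<partial>M)"
    using iD by (subst Bochner_Integration.integral_sum) auto
  also have "\<dots> = (\<integral>x. 24 * K * ((\<Sum>k=2..N. real k powr (-b) * T k x)) \<partial>M)"
    by simp
  also have "\<dots> \<le> (\<integral>x. 1/2 * (exp (g x) * g x * indicator {2..} (g x))
      + c * e * (exp (g x) * D x powr (1 / b)) \<partial>M)"
  proof (rule integral_mono)
    show "integrable M (\<lambda>x. 24 * K * ((\<Sum>k=2..N. real k powr (-b) * T k x)))"
      using iD by auto
    show "integrable M (\<lambda>x. 1/2 * (exp (g x) * g x * indicator {2..} (g x))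
        + c * e * (exp (g x) * D x powr (1 / b)))"
      using ii[of "{2..}"] ieD by auto
    fix x assume x: "x \<in> space M"
    have D: "0 \<le> D x" by (rule D_nonneg[OF x])
    have "(\<Sum>k=2..N. real k powr (-b) * T k x) =
        exp (g x) * D x * (\<Sum>k=2..N. real k powr (-b) * indicator {real k..} (g x))"
      unfolding sum_distrib_left T_def by (intro sum.cong refl) (simp only: mult_ac)
    also have "\<dots> \<le> exp (g x) * D x * (g x powr (1 - b) / (1 - b) * indicator {2..} (g x))"
      using D by (intro mult_left_mono weighted_levels_le) auto
    finally have "24 * K * (\<Sum>k=2..N. real k powr (-b) * T k x)
       \<le> 24 * K * (exp (g x) * D x * (g x powr (1 - b) / (1 - b) * indicator {2..} (g x)))"
      using K_nonneg by (intro mult_left_mono) auto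
    also have "\<dots> = (24 * K / (1 - b)) * (exp (g x) * (D x * g x powr (1 - b)) * indicator {2..} (g x))"
      by (simp add: field_simps)
    also have "\<dots> \<le> c * (exp (g x) * (D x * g x powr (1 - b)) * indicator {2..} (g x))"
      using c1 D by (intro mult_right_mono) auto
    also have "\<dots> \<le> c * (exp (g x) * (1 / (2 * c) * g x + e * D x powr (1 / b)) * indicator {2..} (g x))"
    proof (cases "g x \<ge> 2")
      case True
      have "D x * g x powr (1 - b) \<le> 1 / (2 * c) * g x + (1 / (2 * c)) powr (- (1
          - b) / b) * D x powr (1 / b)"
        by (rule young_absorb) (use True D b c1 in auto)
      also have "(1 / (2 * c)) powr (- (1 - b) / b) = e"
        using c1 by (simp add: e_def powr_divide powr_minus_divide minus_divide_left[symmetric] del: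
            minus_diff_eq)
      finally show ?thesis using True c1 by simp
    qed simp
    also have "\<dots> = 1/2 * (exp (g x) * g x * indicator {2..} (g x))
        + c * e * (exp (g x) * D x powr (1 / b)) * indicator {2..} (g x)"
      using c1 by (simp add: field_simps)
    also have "\<dots> \<le> 1/2 * (exp (g x) * g x * indicator {2..} (g x))
        + c * e * (exp (g x) * D x powr (1 / b))"
      using c1 by (intro add_left_mono) (auto simp: indicator_def e_def)
    finally show "24 * K * ((\<Sum>k=2..N. real k powr (-b) * T k x))
       \<le> 1/2 * (exp (g x) * g x * indicator {2..} (g x)) + c * e * (exp (g x) * D x powr (1 / b))" .
  qed
  also have "\<dots> = 1/2 * (\<integral>x. exp (g x) * g x * indicator {2..} (g x) \<partial>M)
      + c * e * (\<integral>x. exp (g x) * D x powr (1 / b) \<partial>M)"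
    using ii[of "{2..}"] ieD by simp
  also have "(\<integral>x. exp (g x) * g x * indicator {2..} (g x) \<partial>M)
      = (\<integral>x. exp (g x) * g x * indicator {2..<8} (g x) + exp (g x) * g x * indicator {8..} (g x) \<partial>M)"
    by (intro Bochner_Integration.integral_cong) (auto simp: indicator_def)
  also have "\<dots> = (\<integral>x. exp (g x) * g x * indicator {2..<8} (g x) \<partial>M)
      + (\<integral>x. exp (g x) * g x * indicator {8..} (g x) \<partial>M)"
    using ii by simp
  finally show ?thesis unfolding c_def[symmetric] e_def[symmetric] by (simp add: field_simps)
qed

text \<open>
  As \<open>\<integral> exp g = 1\<close>, the entropy is the integral of \<open>exp g * g - exp g + 1\<close>.  On \<open>g < 8\<close> this function, and
  \<open>exp g * g\<close> on \<open>2 \<le> g < 8\<close>, are dominated by \<open>(exp (g / 2) - 1)\<^sup>2\<close>: near \<open>g = 0\<close> both sides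
  vanish to second order.
\<close>

lemma normalized_entropy_bound:
  assumes norm: "(\<integral>x. exp (g x) \<partial>M) = 1"
  shows "(\<integral>x. exp (g x) * g x \<partial>M)
     \<le> ((exp 4 + 1)\<^sup>2 + 32) * K * (\<integral>x. exp (g x) * D x \<partial>M)
       + 2 * absorb_const b K * (2 * absorb_const b K) powr ((1
           - b) / b) * (\<integral>x. exp (g x) * D x powr (1 / b) \<partial>M)"
proof -
  define C :: real where "C = (exp 4 + 1)\<^sup>2"
  have ii: "integrable M (\<lambda>x. exp (g x) * g x * indicator S (g x))" if "S \<in> sets borel" for S ::
      "real set"
    by (rule integrable_of_g(1)[of "\<lambda>s. exp s * s * indicator S s" "exp B * B"])
      (use that in \<open>auto simp: indicator_def abs_mult intro!: mult_mono\<close>)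
  have i1: "integrable M (\<lambda>x. exp (g x) * g x)" using ii[of UNIV] by simp
  have ie: "integrable M (\<lambda>x. exp (g x))" using integrable_of_g(1)[of exp "exp B"] by auto
  have ih: "integrable M (\<lambda>x. exp (g x / 2))"
      using integrable_of_g(1)[of "\<lambda>s. exp (s / 2)" "exp (B / 2)"] by auto
  have i2: "integrable M (\<lambda>x. (exp (g x / 2) - 1)\<^sup>2)"
    using ie ih by (simp add: power2_diff exp_double[symmetric])
  have pt: "exp s * s - exp s + 1 + exp s * s * indicator {2..<8} s
      \<le> (C + 32) * (exp (s / 2) - 1)\<^sup>2 + exp s * s * indicator {8..} s" for s :: real
  proof (cases "s \<ge> 8")
    case True
    have "1 \<le> exp s" using True by simp
    moreover have "0 \<le> (C + 32) * (exp (s / 2) - 1)\<^sup>2" by (simp add: C_def)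
    ultimately have "1 - exp s \<le> (C + 32) * (exp (s / 2) - 1)\<^sup>2" by linarith
    then show ?thesis using True by simp
  next
    case False
    define v where "v = exp (s / 2)"
    have e: "exp s = v\<^sup>2" by (simp add: v_def exp_double[symmetric])
    have v: "0 < v" "v \<le> exp 4" using False by (auto simp: v_def)
    have "s \<le> v\<^sup>2 - 1" using exp_ge_add_one_self[of s] unfolding e by simp
    then have "v\<^sup>2 * s \<le> v\<^sup>2 * (v\<^sup>2 - 1)" by (rule mult_left_mono) simp
    then have "exp s * s - exp s + 1 \<le> (v\<^sup>2 - 1)\<^sup>2" unfolding e by
        (simp add: power2_eq_square algebra_simps)
    also have "\<dots> = (v + 1)\<^sup>2 * (v - 1)\<^sup>2" by (simp add: power2_eq_square algebra_simps)
    also have "\<dots> \<le> C * (v - 1)\<^sup>2" unfolding C_def using v by (intro mult_right_mono power_mono) auto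
    finally have a: "exp s * s - exp s + 1 \<le> C * (v - 1)\<^sup>2" .
    have b: "exp s * s * indicator {2..<8} s \<le> 32 * (v - 1)\<^sup>2"
    proof (cases "s \<ge> 2")
      case True
      have "v \<ge> 2" using True exp_ge_add_one_self[of "s/2"] unfolding v_def by linarith
      then have "v\<^sup>2 \<le> (2 * (v - 1))\<^sup>2" by (intro power_mono) auto
      moreover have "v\<^sup>2 * s \<le> v\<^sup>2 * 8" using False by (intro mult_left_mono) auto
      ultimately have "v\<^sup>2 * s \<le> 32 * (v - 1)\<^sup>2" unfolding power_mult_distrib by simp
      then show ?thesis using True False unfolding e by simp
    qed simp
    show ?thesis using a b False unfolding v_def by (simp add: algebra_simps)
  qed
  have "(\<integral>x. exp (g x) * g x \<partial>M) + (\<integral>x. exp (g x) * g x * indicator {2..<8} (g x) \<partial>M)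
     = (\<integral>x. exp (g x) * g x - exp (g x) + 1 + exp (g x) * g x * indicator {2..<8} (g x) \<partial>M)"
    using i1 ie ii norm by (simp add: prob_space)
  also have "\<dots> \<le> (\<integral>x. (C + 32) * (exp (g x / 2) - 1)\<^sup>2 + exp (g x) * g x * indicator {8..} (g x) \<partial>M)"
    using i1 ie ii i2 pt by (intro integral_mono) auto
  also have "\<dots> = (C + 32) * (\<integral>x. (exp (g x / 2) - 1)\<^sup>2 \<partial>M)
      + (\<integral>x. exp (g x) * g x * indicator {8..} (g x) \<partial>M)"
    using i2 ii by simp
  also have "(C + 32) * (\<integral>x. (exp (g x / 2) - 1)\<^sup>2 \<partial>M) \<le> (C + 32) * (K * (\<integral>x. exp (g x) * D x \<partial>M))"
    by (intro mult_left_mono variance_bound norm) (simp add: C_def)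
  finally show ?thesis using large_values_bound[OF norm] unfolding C_def by (simp add: mult.assoc)
qed

end

text \<open>
  Both sides are homogeneous in \<open>exp g\<close>, so subtracting a constant from \<open>g\<close> reduces the claim to the
  normalised case.
\<close>

theorem (in LO_chain) modified_log_sobolev:
  "entropy_of M (\<lambda>x. exp (g x)) \<le> mls_const b K * (\<integral>x. exp (g x) * (D x + D x powr (1 / b)) \<partial>M)"
proof -
  define m where "m = (\<integral>x. exp (g x) \<partial>M)"
  have ie: "integrable M (\<lambda>x. exp (g x))" using integrable_of_g(1)[of exp "exp B"] by auto
  have "exp (-B) \<le> exp (g x)" if "x \<in> space M" for x using g_bound[OF that] by auto
  then have "exp (-B) \<le> m" unfolding m_def using ie by (intro integral_ge_const) auto
  then have m0: "m > 0" by (smt (verit) exp_gt_zero)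
  define h where "h x = g x - ln m" for x
  have eh: "exp (h x) = exp (g x) / m" for x using m0 by (simp add: h_def exp_diff)
  interpret H: LO_chain M h D "B + \<bar>ln m\<bar>" b K
  proof
    show "h \<in> borel_measurable M" "D \<in> borel_measurable M" unfolding h_def[abs_def] by auto
    show "0 \<le> K" "0 < b" "b < 1" using K_nonneg b by auto
    fix x assume x: "x \<in> space M"
    show "\<bar>h x\<bar> \<le> B + \<bar>ln m\<bar>" using g_bound[OF x] by (auto simp: h_def)
    show "0 \<le> D x" "D x \<le> B + \<bar>ln m\<bar>" using D_nonneg[OF x] D_bound[OF x] by auto
  next
    fix \<phi> \<phi>' :: "real \<Rightarrow> real" and \<theta> :: real
    assume *: "\<And>s. (\<phi> has_real_derivative \<phi>' s) (at s)" "continuous_on UNIV \<phi>'" "1 < \<theta>" "\<theta> < 2"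
    have "(\<integral>x. (\<phi> (g x - ln m))\<^sup>2 \<partial>M) - (\<integral>x. \<bar>\<phi> (g x - ln m)\<bar> powr \<theta> \<partial>M) powr (2 / \<theta>)
         \<le> K * (2 - \<theta>) powr b * (\<integral>x. (\<phi>' (g x - ln m))\<^sup>2 * D x \<partial>M)"
    proof (rule LO)
      show "((\<lambda>s. \<phi> (s - ln m)) has_real_derivative \<phi>' (s - ln m)) (at s)" for s
        by (rule DERIV_chain2[OF *(1), THEN DERIV_cong]) (auto intro!: derivative_eq_intros)
      show "continuous_on UNIV (\<lambda>s. \<phi>' (s - ln m))"
        by (intro continuous_on_compose2[OF *(2)] continuous_intros) auto
    qed (use * in auto)
    then show "(\<integral>x. (\<phi> (h x))\<^sup>2 \<partial>M) - (\<integral>x. \<bar>\<phi> (h x)\<bar> powr \<theta> \<partial>M) powr (2 / \<theta>)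
         \<le> K * (2 - \<theta>) powr b * (\<integral>x. (\<phi>' (h x))\<^sup>2 * D x \<partial>M)" unfolding h_def .
  qed
  define C where "C = 2 * absorb_const b K * (2 * absorb_const b K) powr ((1 - b) / b)"
  define C' where "C' = ((exp 4 + 1)\<^sup>2 + 32) * K"
  have C: "0 \<le> C" "0 \<le> C'" using K_nonneg b unfolding C_def C'_def absorb_const_def by auto
  define d1 where "d1 = (\<integral>x. exp (g x) * D x \<partial>M)"
  define d2 where "d2 = (\<integral>x. exp (g x) * D x powr (1 / b) \<partial>M)"
  have d: "0 \<le> d1" "0 \<le> d2" unfolding d1_def d2_def using D_nonneg by
      (auto intro!: Bochner_Integration.integral_nonneg)
  have ii: "integrable M (\<lambda>x. exp (g x) * g x)"
    by (rule integrable_of_g(1)[of "\<lambda>s. exp s * s" "exp B * B"]) (auto simp: abs_mult intro!: mult_mono)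
  have "(\<integral>x. exp (h x) * h x \<partial>M) \<le> C' * (\<integral>x. exp (h x) * D x \<partial>M)
      + C * (\<integral>x. exp (h x) * D x powr (1 / b) \<partial>M)"
    unfolding C_def C'_def
    by (rule H.normalized_entropy_bound) (use m0 in \<open>simp add: eh m_def\<close>)
  also have "\<dots> = (C' * d1 + C * d2) / m" unfolding eh d1_def d2_def by (simp add: add_divide_distrib)
  also have "\<dots> \<le> (mls_const b K * (d1 + d2)) / m"
    unfolding mls_const_def C_def[symmetric] C'_def[symmetric] using m0 C d
    by (intro divide_right_mono) (auto simp: algebra_simps)
  finally have "(\<integral>x. exp (h x) * h x \<partial>M) \<le> (mls_const b K * (d1 + d2)) / m" .
  moreover have "(\<integral>x. exp (h x) * h x \<partial>M) = (\<integral>x. (exp (g x) * g x - ln m * exp (g x)) / m \<partial>M)"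
    by (intro Bochner_Integration.integral_cong refl)
      (simp only: eh, simp add: h_def diff_divide_distrib algebra_simps)
  moreover have "\<dots> = ((\<integral>x. exp (g x) * g x \<partial>M) - ln m * m) / m"
    using ii ie by (simp add: m_def)
  ultimately have "(\<integral>x. exp (g x) * g x \<partial>M) - ln m * m \<le> mls_const b K * (d1 + d2)"
    using m0 by (simp add: divide_le_cancel)
  moreover have "d1 + d2 = (\<integral>x. exp (g x) * (D x + D x powr (1 / b)) \<partial>M)"
    using integrable_of_g(2)[of exp "exp B"] integrable_of_g(3)[of exp "exp B"]
    by (simp add: d1_def d2_def distrib_left)
  ultimately show ?thesis unfolding entropy_of_def by (simp add: m_def mult.commute)
qed

section \<open>Smooth functions and the Latala-Oleszkiewicz inequality along them\<close>

lemma update_in_space_Rdim: "x \<in> space (Rdim d) \<Longrightarrow> j < d \<Longrightarrow> x(j := s) \<in> space (Rdim d)"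
  by (auto simp: Rdim_def space_PiM PiE_iff extensional_def)

lemma partial_deriv_cong:
  assumes "\<And>x. x \<in> space (Rdim d) \<Longrightarrow> f x = h x" "x \<in> space (Rdim d)" "j < d"
  shows "partial_deriv j f x = partial_deriv j h x"
proof -
  have "(\<lambda>s. f (x(j := s))) = (\<lambda>s. h (x(j := s)))" using assms update_in_space_Rdim by auto
  then show ?thesis by (simp add: partial_deriv_def)
qed

lemma smooth_partial_deriv: "smooth d f \<Longrightarrow> j < d \<Longrightarrow> smooth d (partial_deriv j f)"
  unfolding smooth_def
proof (intro allI impI)
  fix js assume H: "\<forall>js. set js \<subseteq> {..<d} \<longrightarrow>
     continuous_on (space (Rdim d)) (foldr partial_deriv js f) \<and>
     (\<forall>j<d. \<forall>x\<in>space (Rdim d). (\<lambda>s. foldr partial_deriv js f (x(j := s))) field_differentiable at (x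
         j))"
   and j: "j < d" and js: "set js \<subseteq> {..<d}"
  show "continuous_on (space (Rdim d)) (foldr partial_deriv js (partial_deriv j f)) \<and>
     (\<forall>j'<d. \<forall>x\<in>space (Rdim d). (\<lambda>s. foldr partial_deriv js (partial_deriv j f) (x(j' := s)))
         field_differentiable at (x j'))"
    using H[rule_format, of "js @ [j]"] j js by simp
qed

lemma smoothD:
  assumes "smooth d f"
  shows "continuous_on (space (Rdim d)) f"
    "j < d \<Longrightarrow> x \<in> space (Rdim d) \<Longrightarrow> (\<lambda>s. f (x(j := s))) field_differentiable at (x j)"
  using assms[unfolded smooth_def, rule_format, of "[]"] by auto

text \<open>
  The algebra generated by the smooth functions, used to show that the smooth functions are closed
  under sums and products.  It is closed under partial derivatives by the product rule, so induction over
  its rules replaces Leibniz' formula for iterated derivatives.  The rule \<open>cong\<close> is there because the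
  sum and product rules hold only on \<open>space (Rdim d)\<close>.
\<close>

inductive smooth_generated :: "nat \<Rightarrow> ((nat \<Rightarrow> real) \<Rightarrow> real) \<Rightarrow> bool" for d where
  base: "smooth d f \<Longrightarrow> smooth_generated d f"
| add: "smooth_generated d f \<Longrightarrow> smooth_generated d h \<Longrightarrow> smooth_generated d (\<lambda>x. f x + h x)"
| mult: "smooth_generated d f \<Longrightarrow> smooth_generated d h \<Longrightarrow> smooth_generated d (\<lambda>x. f x * h x)"
| cong: "smooth_generated d f \<Longrightarrow> (\<And>x. x \<in> space (Rdim d) \<Longrightarrow> f x = h x) \<Longrightarrow> smooth_generated d h"

lemma smooth_generatedD:
  assumes "smooth_generated d f"
  shows "continuous_on (space (Rdim d)) f \<and>
    (\<forall>j<d. \<forall>x\<in>space (Rdim d). (\<lambda>s. f (x(j := s))) field_differentiable at (x j)) \<and>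
    (\<forall>j<d. smooth_generated d (partial_deriv j f))"
  using assms
proof induction
  case (base f)
  then show ?case using smoothD[of d f] smooth_partial_deriv smooth_generated.base by blast
next
  case (add f h)
  have "smooth_generated d (partial_deriv j (\<lambda>x. f x + h x))" if j: "j < d" for j
  proof (rule smooth_generated.cong)
    show "smooth_generated d (\<lambda>x. partial_deriv j f x + partial_deriv j h x)"
      using add j by (intro smooth_generated.add) auto
    fix x assume x: "x \<in> space (Rdim d)"
    have df: "(\<lambda>s. f (x(j := s))) field_differentiable at (x j)"
      and dh: "(\<lambda>s. h (x(j := s))) field_differentiable at (x j)"
      using add.IH j x by blast+
    show "partial_deriv j f x + partial_deriv j h x = partial_deriv j (\<lambda>x. f x + h x) x"
      unfolding partial_deriv_def deriv_add[OF df dh] by simp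
  qed
  then show ?case using add by (auto intro!: continuous_intros field_differentiable_add)
next
  case (mult f h)
  have "smooth_generated d (partial_deriv j (\<lambda>x. f x * h x))" if j: "j < d" for j
  proof (rule smooth_generated.cong)
    show "smooth_generated d (\<lambda>x. f x * partial_deriv j h x + partial_deriv j f x * h x)"
      using mult j by (intro smooth_generated.add smooth_generated.mult) auto
    fix x assume x: "x \<in> space (Rdim d)"
    have df: "(\<lambda>s. f (x(j := s))) field_differentiable at (x j)"
      and dh: "(\<lambda>s. h (x(j := s))) field_differentiable at (x j)"
      using mult.IH j x by blast+
    show "f x * partial_deriv j h x + partial_deriv j f x * h x = partial_deriv j (\<lambda>x. f x * h x) x"
      unfolding partial_deriv_def deriv_mult[OF df dh] by simp
  qed
  then show ?case using mult by (auto intro!: continuous_intros field_differentiable_mult)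
next
  case (cong f h)
  have "smooth_generated d (partial_deriv j h)" if j: "j < d" for j
  proof (rule smooth_generated.cong)
    show "smooth_generated d (partial_deriv j f)" using cong.IH j by blast
    show "partial_deriv j f x = partial_deriv j h x" if "x \<in> space (Rdim d)" for x
      by (rule partial_deriv_cong[OF cong.hyps(2) that j])
  qed
  moreover have "(\<lambda>s. h (x(j := s))) field_differentiable at (x j)" if "j < d"
      "x \<in> space (Rdim d)" for j x
  proof -
    have "(\<lambda>s. f (x(j := s))) = (\<lambda>s. h (x(j := s)))"
      using cong.hyps(2)[OF update_in_space_Rdim[OF that(2,1)]] by (intro ext)
    moreover have "(\<lambda>s. f (x(j := s))) field_differentiable at (x j)" using cong.IH that by blast
    ultimately show ?thesis by (simp only:)
  qed
  moreover have "continuous_on (space (Rdim d)) h"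
    using cong.IH continuous_on_cong[of "space (Rdim d)" "space (Rdim d)" f h, OF refl cong.hyps(2)]
        by blast
  ultimately show ?case by blast
qed

lemma smooth_iff_smooth_generated: "smooth d f \<longleftrightarrow> smooth_generated d f"
proof
  assume f: "smooth_generated d f"
  have *: "smooth_generated d (foldr partial_deriv js f)" if "set js \<subseteq> {..<d}" for js
    using that
  proof (induction js)
    case Nil then show ?case using f by simp
  next
    case (Cons j js)
    then show ?case using smooth_generatedD[of d "foldr partial_deriv js f"] by auto
  qed
  show "smooth d f" unfolding smooth_def
  proof (intro allI impI)
    fix js assume "set js \<subseteq> {..<d}"
    from smooth_generatedD[OF *[OF this]]
    show "continuous_on (space (Rdim d)) (foldr partial_deriv js f) \<and>
     (\<forall>j<d. \<forall>x\<in>space (Rdim d). (\<lambda>s. foldr partial_deriv js f (x(j := s))) field_differentiable at (x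
         j))"
      by blast
  qed
qed (rule smooth_generated.base)

lemma smooth_add: "smooth d f \<Longrightarrow> smooth d h \<Longrightarrow> smooth d (\<lambda>x. f x + h x)"
  and smooth_mult: "smooth d f \<Longrightarrow> smooth d h \<Longrightarrow> smooth d (\<lambda>x. f x * h x)"
  by (simp_all add: smooth_iff_smooth_generated smooth_generated.add smooth_generated.mult)

lemma smooth_const: "smooth d (\<lambda>x. c)"
proof -
  have ex: "\<exists>c'. foldr partial_deriv js (\<lambda>x. c) = (\<lambda>x. c')" for js
    by (induction js) (auto simp: partial_deriv_def)
  show ?thesis unfolding smooth_def
  proof (intro allI impI)
    fix js :: "nat list"
    obtain c' where c': "foldr partial_deriv js (\<lambda>x. c) = (\<lambda>x. c')"
      using ex by blast
    show "continuous_on (space (Rdim d)) (foldr partial_deriv js (\<lambda>x. c)) \<and>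
     (\<forall>j<d. \<forall>x\<in>space (Rdim d). (\<lambda>s. foldr partial_deriv js (\<lambda>x. c) (x(j := s))) field_differentiable at
         (x j))"
      unfolding c' by auto
  qed
qed

lemma smooth_power: "smooth d f \<Longrightarrow> smooth d (\<lambda>x. f x ^ m)"
  by (induction m) (auto intro: smooth_const smooth_mult)

lemma smooth_sum: "(\<And>i. i \<in> A \<Longrightarrow> smooth d (f i)) \<Longrightarrow> smooth d (\<lambda>x. \<Sum>i\<in>A. f i x)"
  by (induction A rule: infinite_finite_induct) (auto intro: smooth_const smooth_add)

text \<open>
  The product sigma-algebra over \<open>I\<close> is the trace of the Borel sigma-algebra of the full product
  space, because the coordinates outside \<open>I\<close> are constant on it.
\<close>

lemma continuous_on_imp_measurable_PiM:
  fixes I :: "'k :: countable set"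
  assumes "continuous_on (space (PiM I (\<lambda>_. borel :: real measure))) f"
  shows "f \<in> borel_measurable (PiM I (\<lambda>_. borel :: real measure))"
proof -
  let ?M = "PiM I (\<lambda>_. borel :: real measure)"
  have id: "(\<lambda>x. x) \<in> measurable ?M (restrict_space borel (space ?M))"
  proof (rule measurable_restrict_space2)
    have "(\<lambda>x j. x j) \<in> measurable ?M borel"
    proof (rule measurable_coordinatewise_then_product)
      fix j show "(\<lambda>x. x j) \<in> borel_measurable ?M"
      proof (cases "j \<in> I")
        case True then show ?thesis by (intro measurable_component_singleton)
      next
        case False
        then have "x \<in> space ?M \<Longrightarrow> x j = undefined" for x
          by (auto simp: space_PiM PiE_iff extensional_def)
        then show ?thesis by (subst measurable_cong[of _ _ "\<lambda>_. undefined"]) auto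
      qed
    qed
    then show "(\<lambda>x. x) \<in> borel_measurable ?M" by simp
  qed auto
  have "f \<in> borel_measurable (restrict_space borel (space ?M))"
    by (rule borel_measurable_continuous_on_restrict[OF assms])
  from measurable_compose[OF id this] show ?thesis .
qed

text \<open>
  Approximate the derivative by a polynomial and integrate it.
\<close>

lemma C1_polynomial_approx:
  fixes \<phi> \<phi>' :: "real \<Rightarrow> real"
  assumes d: "\<And>s. (\<phi> has_real_derivative \<phi>' s) (at s)" and c: "continuous_on UNIV \<phi>'"
    and e: "e > 0" and B: "0 \<le> B"
  obtains P P' :: "real \<Rightarrow> real" and a m where
    "\<And>s. (P has_real_derivative P' s) (at s)" "P = (\<lambda>s. \<Sum>i\<le>m. a i * s ^ i)" "continuous_on UNIV P'"
    "\<And>s. \<bar>s\<bar> \<le> B \<Longrightarrow> \<bar>P s - \<phi> s\<bar> \<le> e" "\<And>s. \<bar>s\<bar> \<le> B \<Longrightarrow> \<bar>P' s - \<phi>' s\<bar> \<le> e"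
proof -
  define \<delta> where "\<delta> = e / (B + 1)"
  have \<delta>: "0 < \<delta>" "\<delta> \<le> e" "\<delta> * B \<le> e" using e B by (auto simp: \<delta>_def field_simps)
  obtain p where p: "real_polynomial_function p" "\<And>s. s \<in> {-B..B} \<Longrightarrow> \<bar>\<phi>' s - p s\<bar> < \<delta>"
    using Stone_Weierstrass_real_polynomial_function[of "{-B..B}" \<phi>' \<delta>] c \<delta> continuous_on_subset
        by (metis compact_Icc subset_UNIV)
  obtain q n where q: "p = (\<lambda>x. \<Sum>i\<le>n. q i * x ^ i)"
    using p(1) unfolding real_polynomial_function_iff_sum by auto
  define a where "a i = (if i = 0 then \<phi> 0 else q (i - 1) / real i)" for i
  define P where "P s = (\<Sum>i\<le>Suc n. a i * s ^ i)" for s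
  have P_eq: "P = (\<lambda>s. \<phi> 0 + (\<Sum>i\<le>n. q i / real (Suc i) * s ^ Suc i))"
    unfolding P_def by (subst sum.atMost_Suc_shift) (simp add: a_def)
  have dP: "(P has_real_derivative p s) (at s)" for s
    unfolding P_eq q by (rule derivative_eq_intros refl)+
        (auto simp: divide_simps simp del: of_nat_Suc intro!: sum.cong)
  have cp: "continuous_on UNIV p" unfolding q by (intro continuous_intros)
  have close: "\<bar>P s - \<phi> s\<bar> \<le> e" if "\<bar>s\<bar> \<le> B" for s
  proof -
    have dd: "((\<lambda>s. P s - \<phi> s) has_real_derivative (p s - \<phi>' s)) (at s)" for s
      by (intro derivative_intros dP d)
    have "norm ((P s - \<phi> s) - (P 0 - \<phi> 0)) \<le> \<delta> * norm (s - 0)"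
    proof (rule field_differentiable_bound[of "{-B..B}" "\<lambda>s. P s - \<phi> s" "\<lambda>s. p s - \<phi>' s"])
      show "((\<lambda>s. P s - \<phi> s) has_real_derivative p z - \<phi>' z) (at z within {- B..B})" for z
        using dd by (rule has_field_derivative_at_within)
      show "norm (p z - \<phi>' z) \<le> \<delta>" if "z \<in> {-B..B}" for z using p(2)[OF that] by
          (auto simp: abs_minus_commute)
    qed (use that B in auto)
    moreover have "P 0 = \<phi> 0" unfolding P_eq by simp
    ultimately have "\<bar>P s - \<phi> s\<bar> \<le> \<delta> * \<bar>s\<bar>" by simp
    also have "\<dots> \<le> \<delta> * B" using \<delta> that by (intro mult_left_mono) auto
    finally show ?thesis using \<delta> by simp
  qed
  show thesis
  proof (rule that[of P p a "Suc n"])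
    show "\<bar>p s - \<phi>' s\<bar> \<le> e" if "\<bar>s\<bar> \<le> B" for s
      using p(2)[of s] that \<delta> by (force simp: abs_le_iff abs_less_iff)
  qed (use dP cp close P_def[abs_def] in auto)
qed

lemma grad_norm_measurable:
  assumes "smooth d g"
  shows "g \<in> borel_measurable (Rdim d)" "grad_norm d g \<in> borel_measurable (Rdim d)"
proof -
  have "partial_deriv j g \<in> borel_measurable (Rdim d)" if "j < d" for j
    using assms that unfolding Rdim_def
    by (intro continuous_on_imp_measurable_PiM smoothD[unfolded Rdim_def] smooth_partial_deriv)
  then show "grad_norm d g \<in> borel_measurable (Rdim d)"
    unfolding grad_norm_def[abs_def] L2_set_def
        by (intro measurable_compose[OF _ borel_measurable_sqrt] borel_measurable_sum
        borel_measurable_power) auto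
  show "g \<in> borel_measurable (Rdim d)"
    unfolding Rdim_def by (intro continuous_on_imp_measurable_PiM smoothD[unfolded Rdim_def] assms)
qed

lemma grad_norm_sq: "(grad_norm d f x)\<^sup>2 = (\<Sum>j<d. (partial_deriv j f x)\<^sup>2)"
  unfolding grad_norm_def L2_set_def by (simp add: sum_nonneg)

lemma grad_norm_chain_rule:
  assumes g: "smooth d g" and x: "x \<in> space (Rdim d)"
    and P: "\<And>s. (P has_real_derivative P' s) (at s)"
  shows "(grad_norm d (\<lambda>x. P (g x)) x)\<^sup>2 = (P' (g x))\<^sup>2 * (grad_norm d g x)\<^sup>2"
proof -
  have "partial_deriv j (\<lambda>x. P (g x)) x = P' (g x) * partial_deriv j g x" if j: "j < d" for j
  proof -
    have "((\<lambda>s. g (x(j := s))) has_real_derivative partial_deriv j g x) (at (x j))"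
      unfolding partial_deriv_def using smoothD(2)[OF g j x] by (simp add: field_differentiable_derivI)
    moreover have "(P has_real_derivative P' (g x)) (at (g (x(j := x j))))" using P[of "g x"] by simp
    ultimately have "((\<lambda>s. P (g (x(j := s)))) has_real_derivative P' (g x) * partial_deriv j g x) (at (x
        j))"
      by (rule DERIV_chain2[rotated])
    then show ?thesis unfolding partial_deriv_def by (rule DERIV_imp_deriv)
  qed
  then show ?thesis unfolding grad_norm_sq by (simp add: sum_distrib_left power_mult_distrib)
qed

text \<open>
  Replacing the constant by \<open>max 1 K\<close> makes it nonnegative, whatever the sign of \<open>K\<close>.
\<close>

lemma LO_pointwise:
  assumes LO: "latala_oleszkiewicz d \<mu> r K" and "smooth d f" "integrable \<mu> (\<lambda>x. (f x)\<^sup>2)"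
    "integrable \<mu> (\<lambda>x. (grad_norm d f x)\<^sup>2)" and th: "1 < \<theta>" "\<theta> < 2"
  shows "(\<integral>x. (f x)\<^sup>2 \<partial>\<mu>) - (\<integral>x. \<bar>f x\<bar> powr \<theta> \<partial>\<mu>) powr (2 / \<theta>)
     \<le> max 1 K * (2 - \<theta>) powr (2 * (1 - 1 / r)) * (\<integral>x. (grad_norm d f x)\<^sup>2 \<partial>\<mu>)"
proof -
  let ?L = "(\<integral>x. (f x)\<^sup>2 \<partial>\<mu>) - (\<integral>x. \<bar>f x\<bar> powr \<theta> \<partial>\<mu>) powr (2 / \<theta>)"
  let ?w = "(2 - \<theta>) powr (2 * (1 - 1 / r))"
  let ?I = "\<integral>x. (grad_norm d f x)\<^sup>2 \<partial>\<mu>"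
  have "ereal (?L / ?w) \<le> (SUP \<theta>\<in>{1<..<2}. ereal
          (((\<integral>x. (f x)\<^sup>2 \<partial>\<mu>) - (\<integral>x. \<bar>f x\<bar> powr \<theta> \<partial>\<mu>) powr (2 / \<theta>))
             / (2 - \<theta>) powr (2 * (1 - 1 / r))))"
    using th by (intro SUP_upper2[of \<theta>]) auto
  also have "\<dots> \<le> ereal (K * ?I)"
    using LO assms(2-4) unfolding latala_oleszkiewicz_def by blast
  finally have "?L / ?w \<le> K * ?I" by simp
  also have "\<dots> \<le> max 1 K * ?I" by (intro mult_right_mono) auto
  finally show ?thesis using th by (simp add: divide_le_eq mult_ac)
qed

text \<open>
  For polynomials \<open>\<phi>\<close> the function \<open>\<phi> \<circ> g\<close> is a legitimate test function.  All integrals converge along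
  polynomials that approximate \<open>\<phi>\<close> and \<open>\<phi>'\<close> uniformly on the range of \<open>g\<close>.
\<close>

lemma LO_smooth_composition:
  assumes prob: "prob_space \<mu>" and sets: "sets \<mu> = sets (Rdim d)" and LO: "latala_oleszkiewicz d \<mu> r K"
    and g: "smooth d g" and gB: "\<And>x. x \<in> space \<mu> \<Longrightarrow> \<bar>g x\<bar> \<le> B"
    and DB: "\<And>x. x \<in> space \<mu> \<Longrightarrow> (grad_norm d g x)\<^sup>2 \<le> B"
    and \<phi>: "\<And>s. (\<phi> has_real_derivative \<phi>' s) (at s)" and \<phi>': "continuous_on UNIV \<phi>'"
    and th: "1 < \<theta>" "\<theta> < 2"
  shows "(\<integral>x. (\<phi> (g x))\<^sup>2 \<partial>\<mu>) - (\<integral>x. \<bar>\<phi> (g x)\<bar> powr \<theta> \<partial>\<mu>) powr (2 / \<theta>)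
     \<le> max 1 K * (2 - \<theta>) powr (2 * (1 - 1 / r)) * (\<integral>x. (\<phi>' (g x))\<^sup>2 * (grad_norm d g x)\<^sup>2 \<partial>\<mu>)"
proof -
  interpret prob_space \<mu> by fact
  have sp: "space \<mu> = space (Rdim d)" using sets by (rule sets_eq_imp_space_eq)
  have B0: "0 \<le> B" using gB not_empty by fastforce
  have gm[measurable]: "g \<in> borel_measurable \<mu>" "grad_norm d g \<in> borel_measurable \<mu>"
    using grad_norm_measurable[OF g] measurable_cong_sets[OF sets refl] by auto
  have c\<phi>: "continuous_on UNIV \<phi>"
    using \<phi> by (auto intro!: continuous_at_imp_continuous_on DERIV_isCont)
  define approx where "approx e P P' \<longleftrightarrow> (\<forall>s. (P has_real_derivative P' s) (at s)) \<and>
      (\<exists>a m. P = (\<lambda>s. \<Sum>i\<le>m. a i * s ^ i)) \<and> continuous_on UNIV P' \<and>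
      (\<forall>s. \<bar>s\<bar> \<le> B \<longrightarrow> \<bar>P s - \<phi> s\<bar> \<le> e \<and> \<bar>P' s - \<phi>' s\<bar> \<le> e)"
    for e :: real and P P' :: "real \<Rightarrow> real"
  have "\<exists>P P'. approx e P P'" if "e > 0" for e
    unfolding approx_def by (rule C1_polynomial_approx[OF \<phi> \<phi>' that B0]) blast
  then have "\<forall>n. \<exists>P P'. approx (inverse (real (Suc n))) P P'" by simp
  then obtain P P' where H: "\<And>n. approx (inverse (real (Suc n))) (P n) (P' n)" by metis
  have P: "(P n has_real_derivative P' n s) (at s)"
    and P_eq: "\<exists>a m. P n = (\<lambda>s. \<Sum>i\<le>m. a i * s ^ i)" and P'c: "continuous_on UNIV (P' n)"
    and close: "\<bar>s\<bar> \<le> B \<Longrightarrow> \<bar>P n s - \<phi> s\<bar> \<le> inverse (real (Suc n))"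
    and close': "\<bar>s\<bar> \<le> B \<Longrightarrow> \<bar>P' n s - \<phi>' s\<bar> \<le> inverse (real (Suc n))" for n s
    using H[of n] unfolding approx_def by blast+
  have cP: "continuous_on UNIV (P n)" for n
    using P by (auto intro!: continuous_at_imp_continuous_on DERIV_isCont)
  have [measurable]: "P n \<in> borel_measurable borel" "P' n \<in> borel_measurable borel"
     "\<phi> \<in> borel_measurable borel" "\<phi>' \<in> borel_measurable borel" for n
    using cP P'c c\<phi> \<phi>' by (auto intro: borel_measurable_continuous_onI)
  obtain c where c: "\<And>s. \<bar>s\<bar> \<le> B \<Longrightarrow> \<bar>\<phi> s\<bar> \<le> c"
  proof -
    have "bounded (\<phi> ` {-B..B})"
      using c\<phi> by (intro compact_imp_bounded compact_continuous_image)
          (auto intro: continuous_on_subset)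
    then obtain c where "\<forall>s\<in>{-B..B}. \<bar>\<phi> s\<bar> \<le> c" unfolding bounded_iff by auto
    then show thesis by (intro that[of c]) (meson abs_le_D1 abs_le_D2 atLeastAtMost_iff minus_le_iff)
  qed
  obtain c' where c': "\<And>s. \<bar>s\<bar> \<le> B \<Longrightarrow> \<bar>\<phi>' s\<bar> \<le> c'"
  proof -
    have "bounded (\<phi>' ` {-B..B})"
      using \<phi>' by (intro compact_imp_bounded compact_continuous_image)
          (auto intro: continuous_on_subset)
    then obtain c where "\<forall>s\<in>{-B..B}. \<bar>\<phi>' s\<bar> \<le> c" unfolding bounded_iff by auto
    then show thesis by (intro that[of c]) (meson abs_le_D1 abs_le_D2 atLeastAtMost_iff minus_le_iff)
  qed
  have i1: "inverse (real (Suc n)) \<le> 1" for n by (simp add: inverse_le_1_iff)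
  have Pb: "\<bar>P n (g x)\<bar> \<le> c + 1" if "x \<in> space \<mu>" for n x
    using close[OF gB[OF that], of n] c[OF gB[OF that]] i1[of n] by linarith
  have P'b: "\<bar>P' n (g x)\<bar> \<le> c' + 1" if "x \<in> space \<mu>" for n x
    using close'[OF gB[OF that], of n] c'[OF gB[OF that]] i1[of n] by linarith
  have lim: "(\<lambda>n. P n (g x)) \<longlonglongrightarrow> \<phi> (g x)" "(\<lambda>n. P' n (g x)) \<longlonglongrightarrow> \<phi>' (g x)" if "x \<in> space \<mu>" for x
  proof -
    show "(\<lambda>n. P n (g x)) \<longlonglongrightarrow> \<phi> (g x)"
      by (rule LIM_zero_cancel, rule Lim_null_comparison[OF _ LIMSEQ_inverse_real_of_nat])
        (use close[OF gB[OF that]] in auto)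
    show "(\<lambda>n. P' n (g x)) \<longlonglongrightarrow> \<phi>' (g x)"
      by (rule LIM_zero_cancel, rule Lim_null_comparison[OF _ LIMSEQ_inverse_real_of_nat])
        (use close'[OF gB[OF that]] in auto)
  qed
  have P2b: "\<bar>(P n (g x))\<^sup>2\<bar> \<le> (c + 1)\<^sup>2" if "x \<in> space \<mu>" for n x
    using power_mono[OF Pb[OF that, of n], of 2] by simp
  have D2b: "\<bar>(P' n (g x))\<^sup>2 * (grad_norm d g x)\<^sup>2\<bar> \<le> (c' + 1)\<^sup>2 * B" if "x \<in> space \<mu>" for n x
    using power_mono[OF P'b[OF that, of n], of 2] DB[OF that] B0
    by (auto simp: abs_mult intro!: mult_mono)
  have lim1: "(\<lambda>n. \<integral>x. (P n (g x))\<^sup>2 \<partial>\<mu>) \<longlonglongrightarrow> (\<integral>x. (\<phi> (g x))\<^sup>2 \<partial>\<mu>)"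
    by (rule integral_dominated_convergence[where w="\<lambda>_. (c + 1)\<^sup>2"])
      (use P2b lim in \<open>auto intro!: AE_I2 tendsto_intros\<close>)
  have lim2: "(\<lambda>n. \<integral>x. \<bar>P n (g x)\<bar> powr \<theta> \<partial>\<mu>) \<longlonglongrightarrow> (\<integral>x. \<bar>\<phi> (g x)\<bar> powr \<theta> \<partial>\<mu>)"
  proof (rule integral_dominated_convergence[where w="\<lambda>_. (c + 1) powr \<theta>"])
    show "AE x in \<mu>. (\<lambda>n. \<bar>P n (g x)\<bar> powr \<theta>) \<longlonglongrightarrow> \<bar>\<phi> (g x)\<bar> powr \<theta>"
      using lim th by (intro AE_I2 tendsto_powr' tendsto_intros) auto
    show "AE x in \<mu>. norm (\<bar>P n (g x)\<bar> powr \<theta>) \<le> (c + 1) powr \<theta>" for n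
      using Pb th by (intro AE_I2) (auto intro!: powr_mono2)
  qed auto
  have lim3: "(\<lambda>n. \<integral>x. (P' n (g x))\<^sup>2 * (grad_norm d g x)\<^sup>2 \<partial>\<mu>) \<longlonglongrightarrow> (\<integral>x. (\<phi>' (g x))\<^sup>2 * (grad_norm d g x)\<^sup>2
      \<partial>\<mu>)"
    by (rule integral_dominated_convergence[where w="\<lambda>_. (c' + 1)\<^sup>2 * B"])
      (use D2b lim in \<open>auto intro!: AE_I2 tendsto_intros\<close>)
  have ineq: "(\<integral>x. (P n (g x))\<^sup>2 \<partial>\<mu>) - (\<integral>x. \<bar>P n (g x)\<bar> powr \<theta> \<partial>\<mu>) powr (2 / \<theta>)
     \<le> max 1 K * (2 - \<theta>) powr (2 * (1 - 1 / r)) * (\<integral>x. (P' n (g x))\<^sup>2 * (grad_norm d g x)\<^sup>2 \<partial>\<mu>)" for n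
  proof -
    have sm: "smooth d (\<lambda>x. P n (g x))"
    proof -
      obtain a m where "P n = (\<lambda>s. \<Sum>i\<le>m. a i * s ^ i)" using P_eq by blast
      then show ?thesis by (simp only:) (intro smooth_sum smooth_mult smooth_const smooth_power g)
    qed
    have gr: "(grad_norm d (\<lambda>x. P n (g x)) x)\<^sup>2 = (P' n (g x))\<^sup>2 * (grad_norm d g x)\<^sup>2" if
        "x \<in> space \<mu>" for x
      using grad_norm_chain_rule[OF g _ P] that sp by blast
    have "integrable \<mu> (\<lambda>x. (P n (g x))\<^sup>2)"
      by (rule integrable_const_bound[of _ "(c + 1)\<^sup>2"]) (use P2b in auto)
    moreover have "integrable \<mu> (\<lambda>x. (P' n (g x))\<^sup>2 * (grad_norm d g x)\<^sup>2)"
      by (rule integrable_const_bound[of _ "(c' + 1)\<^sup>2 * B"]) (use D2b in auto)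
    then have "integrable \<mu> (\<lambda>x. (grad_norm d (\<lambda>x. P n (g x)) x)\<^sup>2)"
      using gr by (simp cong: Bochner_Integration.integrable_cong)
    ultimately show ?thesis using LO_pointwise[OF LO sm _ _ th] gr
      by (simp cong: Bochner_Integration.integral_cong)
  qed
  have "(\<lambda>n. (\<integral>x. \<bar>P n (g x)\<bar> powr \<theta> \<partial>\<mu>) powr (2 / \<theta>)) \<longlonglongrightarrow> (\<integral>x. \<bar>\<phi> (g x)\<bar> powr \<theta> \<partial>\<mu>) powr (2 / \<theta>)"
    by (rule tendsto_powr'[OF lim2 tendsto_const]) (use th in auto)
  from LIMSEQ_le[OF tendsto_diff[OF lim1 this] tendsto_mult[OF tendsto_const lim3]] ineq
  show ?thesis by blast
qed

section \<open>Subadditivity of entropy\<close>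

text \<open>
  The easy half of the variational formula for entropy: with \<open>a = F / \<integral> F\<close> it is the integral of
  \<open>a G \<le> a ln a - a + exp G\<close>.
\<close>

lemma (in prob_space) entropy_variational:
  fixes F G :: "'a \<Rightarrow> real"
  assumes [measurable]: "F \<in> borel_measurable M" "G \<in> borel_measurable M"
    and F: "\<And>x. x \<in> space M \<Longrightarrow> c \<le> F x" "\<And>x. x \<in> space M \<Longrightarrow> F x \<le> C" and c: "0 < c"
    and G: "\<And>x. x \<in> space M \<Longrightarrow> \<bar>G x\<bar> \<le> C" and norm: "(\<integral>x. exp (G x) \<partial>M) = 1"
  shows "(\<integral>x. F x * G x \<partial>M) \<le> entropy_of M F"
proof -
  define m where "m = (\<integral>x. F x \<partial>M)"
  have C: "c \<le> C" using F not_empty by fastforce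
  have iF: "integrable M F" using F c by (intro integrable_bounded[of _ C]) fastforce+
  have iG: "integrable M (\<lambda>x. exp (G x))" using G by (intro integrable_bounded[of _ "exp C"]) fastforce+
  have iFG: "integrable M (\<lambda>x. F x * G x)"
    by (rule integrable_bounded[of _ "C * C"])
      (use F G c C in \<open>force simp: abs_mult intro!: mult_mono\<close>)+
  have lnF: "\<bar>ln (F x)\<bar> \<le> \<bar>ln c\<bar> + \<bar>ln C\<bar>" if "x \<in> space M" for x
  proof -
    have "ln c \<le> ln (F x)" "ln (F x) \<le> ln C" using F[OF that] c by auto
    then show ?thesis by linarith
  qed
  have iFl: "integrable M (\<lambda>x. F x * ln (F x))"
    by (rule integrable_bounded[of _ "C * (\<bar>ln c\<bar> + \<bar>ln C\<bar>)"])
      (use F lnF c C in \<open>force simp: abs_mult intro!: mult_mono\<close>)+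
  have "c \<le> m" unfolding m_def using iF F by (intro integral_ge_const) auto
  then have m: "m > 0" using c by simp
  have "F x * G x \<le> F x * ln (F x) - ln m * F x + m * exp (G x) - F x" if x: "x \<in> space M" for x
  proof -
    define a where "a = F x / m"
    have a: "a > 0" using F(1)[OF x] c m by (simp add: a_def)
    have "a * (1 + (G x - ln a)) \<le> a * exp (G x - ln a)"
      using a exp_ge_add_one_self[of "G x - ln a"] by (intro mult_left_mono) auto
    also have "\<dots> = exp (G x)" using a by (simp add: exp_diff)
    finally have "m * (a * (1 + (G x - ln a))) \<le> m * exp (G x)" using m by (intro mult_left_mono) auto
    moreover have "m * (a * (1 + (G x - ln a))) = F x * (1 + (G x - ln a))" using m by (simp add: a_def)
    moreover have "ln a = ln (F x) - ln m" using F(1)[OF x] c m by (simp add: a_def ln_div)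
    ultimately show ?thesis by (simp add: algebra_simps)
  qed
  then have "(\<integral>x. F x * G x \<partial>M) \<le> (\<integral>x. F x * ln (F x) - ln m * F x + m * exp (G x) - F x \<partial>M)"
    using iFG iFl iF iG by (intro integral_mono) auto
  also have "\<dots> = (\<integral>x. F x * ln (F x) \<partial>M) - ln m * m + m * 1 - m"
    using iFl iF iG norm by (simp add: m_def)
  finally show ?thesis unfolding entropy_of_def m_def by (simp add: mult.commute)
qed

lemma (in prob_space) expectation_bounds:
  fixes F :: "'a \<Rightarrow> real"
  assumes [measurable]: "F \<in> borel_measurable M"
    and F: "\<And>x. x \<in> space M \<Longrightarrow> c \<le> F x" "\<And>x. x \<in> space M \<Longrightarrow> F x \<le> C"
  shows "integrable M F" "c \<le> (\<integral>x. F x \<partial>M)" "(\<integral>x. F x \<partial>M) \<le> C"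
proof -
  show iF: "integrable M F" using F by (intro integrable_bounded[of _ "\<bar>c\<bar> + \<bar>C\<bar>"]) fastforce+
  show "c \<le> (\<integral>x. F x \<partial>M)" "(\<integral>x. F x \<partial>M) \<le> C" using iF F
      by (intro integral_ge_const integral_le_const; auto)+
qed

lemma x_ln_x_bounds:
  fixes c x C :: real
  assumes "0 < c" "c \<le> x" "x \<le> C"
  shows "\<bar>x * ln x\<bar> \<le> C * (\<bar>ln c\<bar> + \<bar>ln C\<bar>)"
proof -
  have "ln c \<le> ln x" "ln x \<le> ln C" using assms by auto
  then have "\<bar>ln x\<bar> \<le> \<bar>ln c\<bar> + \<bar>ln C\<bar>" by linarith
  then show ?thesis using assms by (auto simp: abs_mult intro!: mult_mono)
qed

lemma (in prob_space) entropy_bounded: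
  fixes F :: "'a \<Rightarrow> real"
  assumes [measurable]: "F \<in> borel_measurable M"
    and F: "\<And>x. x \<in> space M \<Longrightarrow> c \<le> F x" "\<And>x. x \<in> space M \<Longrightarrow> F x \<le> C" and c: "0 < c"
  shows "\<bar>entropy_of M F\<bar> \<le> 2 * (C * (\<bar>ln c\<bar> + \<bar>ln C\<bar>))" "integrable M (\<lambda>x. F x * ln (F x))"
proof -
  have b: "\<bar>F x * ln (F x)\<bar> \<le> C * (\<bar>ln c\<bar> + \<bar>ln C\<bar>)" if "x \<in> space M" for x
    using x_ln_x_bounds[OF c F(1)[OF that] F(2)[OF that]] .
  show i: "integrable M (\<lambda>x. F x * ln (F x))" by (rule integrable_bounded[OF _ b]) auto
  have "\<bar>\<integral>x. F x * ln (F x) \<partial>M\<bar> \<le> C * (\<bar>ln c\<bar> + \<bar>ln C\<bar>)"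
    using expectation_bounds[of "\<lambda>x. F x * ln (F x)" "- (C * (\<bar>ln c\<bar> + \<bar>ln C\<bar>))"
        "C * (\<bar>ln c\<bar> + \<bar>ln C\<bar>)"] b
    by (fastforce simp: abs_le_iff)
  moreover have "\<bar>(\<integral>x. F x \<partial>M) * ln (\<integral>x. F x \<partial>M)\<bar> \<le> C * (\<bar>ln c\<bar> + \<bar>ln C\<bar>)"
    using expectation_bounds[of F c C] F c by (intro x_ln_x_bounds) auto
  ultimately show "\<bar>entropy_of M F\<bar> \<le> 2 * (C * (\<bar>ln c\<bar> + \<bar>ln C\<bar>))" unfolding entropy_of_def by linarith
qed

text \<open>
  The chain rule expresses the left-hand side by the first summand and the entropy of the marginal
  \<open>H\<close>.  The function \<open>G = ln (H / \<integral> H)\<close> attains equality in the variational formula for \<open>H\<close>, and the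
  same \<open>G\<close> is admissible for each section \<open>F (x, _)\<close>; Fubini's theorem gives the second summand.
\<close>

lemma (in pair_prob_space) entropy_pair_le:
  fixes F :: "'a \<times> 'b \<Rightarrow> real"
  assumes [measurable]: "F \<in> borel_measurable (M1 \<Otimes>\<^sub>M M2)"
    and F: "\<And>x. x \<in> space (M1 \<Otimes>\<^sub>M M2) \<Longrightarrow> c \<le> F x" "\<And>x. x \<in> space (M1 \<Otimes>\<^sub>M M2) \<Longrightarrow> F x \<le> C" and c: "0 < c"
  shows "entropy_of (M1 \<Otimes>\<^sub>M M2) F \<le> (\<integral>y. entropy_of M1 (\<lambda>x. F (x, y)) \<partial>M2)
      + (\<integral>x. entropy_of M2 (\<lambda>y. F (x, y)) \<partial>M1)"
proof -
  define H where "H y = (\<integral>x. F (x, y) \<partial>M1)" for y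
  define m where "m = (\<integral>z. F z \<partial>(M1 \<Otimes>\<^sub>M M2))"
  have H_meas[measurable]: "H \<in> borel_measurable M2" unfolding H_def[abs_def] by measurable
  have iF: "integrable (M1 \<Otimes>\<^sub>M M2) F" and m: "c \<le> m" "m \<le> C"
    using P.expectation_bounds[of F c C] F by (auto simp: m_def)
  have iFl: "integrable (M1 \<Otimes>\<^sub>M M2) (\<lambda>z. F z * ln (F z))"
    using P.entropy_bounded(2)[of F c C] F c by auto
  have H: "c \<le> H y" "H y \<le> C" if "y \<in> space M2" for y
    using M1.expectation_bounds[of "\<lambda>x. F (x, y)" c C] F that by (auto simp: H_def space_pair_measure)
  have Hm: "(\<integral>y. H y \<partial>M2) = m" unfolding H_def m_def
    using integral_snd[of "\<lambda>x y. F (x, y)"] iF by simp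
  have l: "\<bar>ln (H y) - ln m\<bar> \<le> 2 * (\<bar>ln c\<bar> + \<bar>ln C\<bar>)" if "y \<in> space M2" for y
  proof -
    have "ln c \<le> ln (H y)" "ln (H y) \<le> ln C" "ln c \<le> ln m" "ln m \<le> ln C" using H[OF that] c m by auto
    then have "\<bar>ln (H y) - ln m\<bar> \<le> ln C - ln c" by (simp add: abs_le_iff)
    also have "\<dots> \<le> 2 * (\<bar>ln c\<bar> + \<bar>ln C\<bar>)" using abs_ge_self[of "ln C"] abs_ge_minus_self[of "ln c"]
      abs_ge_zero[of "ln C"] abs_ge_zero[of "ln c"] by argo
    finally show ?thesis .
  qed
  define L where "L = 2 * (\<bar>ln c\<bar> + \<bar>ln C\<bar>)"
  have iHl: "integrable M2 (\<lambda>y. H y * ln (H y))" using M2.entropy_bounded(2)[of H c C] H c by auto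
  have iH: "integrable M2 H" using M2.expectation_bounds[of H c C] H by auto
  have iFG: "integrable (M1 \<Otimes>\<^sub>M M2) (\<lambda>z. F z * (ln (H (snd z)) - ln m))"
    by (rule P.integrable_bounded[of _ "C * L"])
      (use F c m l in \<open>force simp: abs_mult L_def space_pair_measure intro!: mult_mono\<close>)+
  have "(\<integral>y. H y * ln (H y) \<partial>M2) - m * ln m = (\<integral>y. H y * (ln (H y) - ln m) \<partial>M2)"
    using iHl iH Hm by (simp add: right_diff_distrib)
  also have "\<dots> = (\<integral>y. (\<integral>x. F (x, y) * (ln (H y) - ln m) \<partial>M1) \<partial>M2)"
    unfolding H_def by simp
  also have "\<dots> = (\<integral>x. (\<integral>y. F (x, y) * (ln (H y) - ln m) \<partial>M2) \<partial>M1)"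
    by (rule Fubini_integral) (use iFG in \<open>simp add: split_beta'\<close>)
  also have "\<dots> \<le> (\<integral>x. entropy_of M2 (\<lambda>y. F (x, y)) \<partial>M1)"
  proof (rule integral_mono)
    show "integrable M1 (\<lambda>x. \<integral>y. F (x, y) * (ln (H y) - ln m) \<partial>M2)"
      using integrable_fst[of "\<lambda>x y. F (x, y) * (ln (H y) - ln m)"] iFG by
          (simp add: split_beta' del: fun_upd_apply)
    show "integrable M1 (\<lambda>x. entropy_of M2 (\<lambda>y. F (x, y)))"
    proof (rule M1.integrable_bounded)
      show "(\<lambda>x. entropy_of M2 (\<lambda>y. F (x, y))) \<in> borel_measurable M1" unfolding entropy_of_def
          by measurable
      show "\<bar>entropy_of M2 (\<lambda>y. F (x, y))\<bar> \<le> 2 * (C * (\<bar>ln c\<bar> + \<bar>ln C\<bar>))" if "x \<in> space M1" for x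
        using that F c by (intro M2.entropy_bounded) (auto simp: space_pair_measure)
    qed
    fix x assume x: "x \<in> space M1"
    have "(\<integral>y. exp (ln (H y) - ln m) \<partial>M2) = (\<integral>y. H y / m \<partial>M2)"
      using H c m by (intro Bochner_Integration.integral_cong)
          (auto simp: exp_diff dest: H intro!: exp_ln less_le_trans[OF c])
    also have "\<dots> = 1" using Hm m c by simp
    finally have n: "(\<integral>y. exp (ln (H y) - ln m) \<partial>M2) = 1" .
    show "(\<integral>y. F (x, y) * (ln (H y) - ln m) \<partial>M2) \<le> entropy_of M2 (\<lambda>y. F (x, y))"
      by (rule M2.entropy_variational[of _ _ c "max C L"])
       (use x F c n l in \<open>auto simp: space_pair_measure L_def le_max_iff_disj\<close>)
  qed
  finally have A: "(\<integral>y. H y * ln (H y) \<partial>M2) - m * ln m \<le> (\<integral>x. entropy_of M2 (\<lambda>y. F (x, y)) \<partial>M1)" .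
  have "(\<integral>y. entropy_of M1 (\<lambda>x. F (x, y)) \<partial>M2)
      = (\<integral>y. (\<integral>x. F (x, y) * ln (F (x, y)) \<partial>M1) - H y * ln (H y) \<partial>M2)"
    unfolding entropy_of_def H_def ..
  also have "\<dots> = (\<integral>y. (\<integral>x. F (x, y) * ln (F (x, y)) \<partial>M1) \<partial>M2) - (\<integral>y. H y * ln (H y) \<partial>M2)"
    using integrable_snd[of "\<lambda>x y. F (x, y) * ln (F (x, y))"] iFl iHl
        by (intro Bochner_Integration.integral_diff) (auto simp: split_beta')
  also have "(\<integral>y. (\<integral>x. F (x, y) * ln (F (x, y)) \<partial>M1) \<partial>M2) = (\<integral>z. F z * ln (F z) \<partial>(M1 \<Otimes>\<^sub>M M2))"
    using integral_snd[of "\<lambda>x y. F (x, y) * ln (F (x, y))"] iFl by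
        (simp add: split_beta' del: fun_upd_apply)
  finally show ?thesis using A unfolding entropy_of_def m_def by linarith
qed

text \<open>
  Subadditivity in the form in which it is iterated: a bound of the one-block entropies by integrals of
  \<open>G i\<close> is inherited by the sections of \<open>F\<close>, which makes the induction over \<open>I\<close> work.
\<close>

lemma entropy_PiM_le:
  fixes \<mu> :: "'a measure" and F :: "('i \<Rightarrow> 'a) \<Rightarrow> real" and G :: "'i \<Rightarrow> ('i \<Rightarrow> 'a) \<Rightarrow> real"
  assumes \<mu>: "prob_space \<mu>" and I: "finite I" and c: "0 < c"
    and "F \<in> borel_measurable (PiM I (\<lambda>_. \<mu>))"
    and "\<And>x. x \<in> space (PiM I (\<lambda>_. \<mu>)) \<Longrightarrow> c \<le> F x" "\<And>x. x \<in> space (PiM I (\<lambda>_. \<mu>)) \<Longrightarrow> F x \<le> C"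
    and "\<And>i. i \<in> I \<Longrightarrow> G i \<in> borel_measurable (PiM I (\<lambda>_. \<mu>))"
    and "\<And>i x. i \<in> I \<Longrightarrow> x \<in> space (PiM I (\<lambda>_. \<mu>)) \<Longrightarrow> \<bar>G i x\<bar> \<le> C"
    and "\<And>i x. i \<in> I \<Longrightarrow> x \<in> space (PiM I (\<lambda>_. \<mu>)) \<Longrightarrow>
       entropy_of \<mu> (\<lambda>y. F (x(i := y))) \<le> (\<integral>y. G i (x(i := y)) \<partial>\<mu>)"
  shows "entropy_of (PiM I (\<lambda>_. \<mu>)) F \<le> (\<Sum>i\<in>I. \<integral>x. G i x \<partial>PiM I (\<lambda>_. \<mu>))"
  using I assms(4-)
proof (induction I arbitrary: F G rule: finite_induct)
  case empty
  show ?case by (simp add: entropy_of_def PiM_empty lebesgue_integral_count_space_finite)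
next
  case (insert i I)
  interpret mu: prob_space \<mu> by fact
  let ?P = "PiM I (\<lambda>_. \<mu>)" and ?Q = "PiM (insert i I) (\<lambda>_. \<mu>)"
  interpret PI: prob_space ?P by (intro prob_space_PiM \<mu>)
  interpret pair_prob_space \<mu> ?P ..
  let ?u = "\<lambda>(y, X). X(i := y)"
  have u[measurable]: "?u \<in> measurable (\<mu> \<Otimes>\<^sub>M ?P) ?Q"
    unfolding split_beta' by (rule measurable_fun_upd[where J=I]) (use insert in auto)
  have distr: "?Q = distr (\<mu> \<Otimes>\<^sub>M ?P) ?Q ?u"
    by (rule distr_pair_PiM_eq_PiM[symmetric]) (use \<mu> in auto)
  note [measurable] = insert.prems(1)
  have [measurable]: "G j \<in> borel_measurable ?Q" if "j \<in> insert i I" for j using insert.prems(4) that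
      by auto
  have sp: "X(i := y) \<in> space ?Q" if "y \<in> space \<mu>" "X \<in> space ?P" for X y
    using that by (auto simp: space_PiM PiE_iff extensional_def)
  have int_Q: "(\<integral>x. f x \<partial>?Q) = (\<integral>z. f (?u z) \<partial>(\<mu> \<Otimes>\<^sub>M ?P))" if "f \<in> borel_measurable ?Q" for f ::
      "('i \<Rightarrow> 'a) \<Rightarrow> real"
    by (subst distr, subst integral_distr) (use that u in auto)
  have "entropy_of ?Q F = entropy_of (\<mu> \<Otimes>\<^sub>M ?P) (\<lambda>z. F (?u z))"
    unfolding entropy_of_def by (subst (1 2 3) int_Q) auto
  also have "\<dots> \<le> (\<integral>X. entropy_of \<mu> (\<lambda>y. F (?u (y, X))) \<partial>?P)
      + (\<integral>y. entropy_of ?P (\<lambda>X. F (?u (y, X))) \<partial>\<mu>)"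
    by (rule entropy_pair_le[where c=c and C=C])
      (use insert.prems(2,3) sp c in \<open>auto simp: space_pair_measure intro!: measurable_compose[OF u]\<close>)
  finally have E: "entropy_of ?Q F \<le> (\<integral>X. entropy_of \<mu> (\<lambda>y. F (X(i := y))) \<partial>?P)
      + (\<integral>y. entropy_of ?P (\<lambda>X. F (X(i := y))) \<partial>\<mu>)" by simp
  have iG: "integrable (\<mu> \<Otimes>\<^sub>M ?P) (\<lambda>z. G j (?u z))" if "j \<in> insert i I" for j
  proof (rule P.integrable_bounded)
    show "(\<lambda>z. G j (?u z)) \<in> borel_measurable (\<mu> \<Otimes>\<^sub>M ?P)"
      using that by (intro measurable_compose[OF u]) auto
    show "\<bar>G j (?u z)\<bar> \<le> C" if "z \<in> space (\<mu> \<Otimes>\<^sub>M ?P)" for z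
      using insert.prems(5)[OF \<open>j \<in> insert i I\<close> sp, of "fst z" "snd z"] that
      by (simp add: space_pair_measure split_beta' mem_Times_iff del: fun_upd_apply)
  qed
  have fX: "(\<lambda>z. f ((snd z)(i := fst z))) \<in> borel_measurable (\<mu> \<Otimes>\<^sub>M ?P)"
    and fX': "(\<lambda>z. f ((fst z)(i := snd z))) \<in> borel_measurable (?P \<Otimes>\<^sub>M \<mu>)"
    if f: "f \<in> borel_measurable ?Q" for f :: "('i \<Rightarrow> 'a) \<Rightarrow> real"
  proof -
    show *: "(\<lambda>z. f ((snd z)(i := fst z))) \<in> borel_measurable (\<mu> \<Otimes>\<^sub>M ?P)"
      using measurable_compose[OF u f] by (simp add: split_beta' del: fun_upd_apply)
    show "(\<lambda>z. f ((fst z)(i := snd z))) \<in> borel_measurable (?P \<Otimes>\<^sub>M \<mu>)"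
      using measurable_compose[OF measurable_pair_swap' *] by (simp add: split_beta' del: fun_upd_apply)
  qed
  have m1: "(\<lambda>X. \<integral>y. f (X(i := y)) \<partial>\<mu>) \<in> borel_measurable ?P"
    and m2: "(\<lambda>y. \<integral>X. f (X(i := y)) \<partial>?P) \<in> borel_measurable \<mu>"
    if f: "f \<in> borel_measurable ?Q" for f :: "('i \<Rightarrow> 'a) \<Rightarrow> real"
    using mu.borel_measurable_lebesgue_integral[of "\<lambda>X y. f (X(i := y))"] fX'[OF f]
      PI.borel_measurable_lebesgue_integral[of "\<lambda>y X. f (X(i := y))"] fX[OF f] by
          (simp_all add: split_beta' del: fun_upd_apply)
  have Fl: "(\<lambda>x. F x * ln (F x)) \<in> borel_measurable ?Q" by measurable
  note FX = fX[OF insert.prems(1)] and FX' = fX'[OF insert.prems(1)]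
  have "(\<integral>X. entropy_of \<mu> (\<lambda>y. F (X(i := y))) \<partial>?P) \<le> (\<integral>X. (\<integral>y. G i (X(i := y)) \<partial>\<mu>) \<partial>?P)"
  proof (rule integral_mono)
    show "integrable ?P (\<lambda>X. \<integral>y. G i (X(i := y)) \<partial>\<mu>)"
      using integrable_snd[of "\<lambda>y X. G i (X(i := y))"] iG[of i] by
          (simp add: split_beta' del: fun_upd_apply)
    show "integrable ?P (\<lambda>X. entropy_of \<mu> (\<lambda>y. F (X(i := y))))"
    proof (rule PI.integrable_bounded)
      show "(\<lambda>X. entropy_of \<mu> (\<lambda>y. F (X(i := y)))) \<in> borel_measurable ?P"
        unfolding entropy_of_def using m1[OF Fl] m1[OF insert.prems(1)] by measurable
      show "\<bar>entropy_of \<mu> (\<lambda>y. F (X(i := y)))\<bar> \<le> 2 * (C * (\<bar>ln c\<bar> + \<bar>ln C\<bar>))" if "X \<in> space ?P" for X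
      proof (rule mu.entropy_bounded(1))
        show "(\<lambda>y. F (X(i := y))) \<in> borel_measurable \<mu>"
          using measurable_Pair2[OF FX'] that by simp
      qed (use insert.prems(2,3) sp that c in auto)
    qed
    fix X assume X: "X \<in> space ?P"
    obtain y0 where y0: "y0 \<in> space \<mu>" using mu.not_empty by auto
    have "entropy_of \<mu> (\<lambda>y. F ((X(i := y0))(i := y))) \<le> (\<integral>y. G i ((X(i := y0))(i := y)) \<partial>\<mu>)"
      by (rule insert.prems(6)[OF insertI1 sp[OF y0 X]])
    then show "entropy_of \<mu> (\<lambda>y. F (X(i := y))) \<le> (\<integral>y. G i (X(i := y)) \<partial>\<mu>)" by (simp only: fun_upd_upd)
  qed
  also have "\<dots> = (\<integral>x. G i x \<partial>?Q)"
    using integral_snd[of "\<lambda>y X. G i (X(i := y))"] iG[of i] by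
        (simp add: int_Q split_beta' del: fun_upd_apply)
  finally have A: "(\<integral>X. entropy_of \<mu> (\<lambda>y. F (X(i := y))) \<partial>?P) \<le> (\<integral>x. G i x \<partial>?Q)" .
  have "(\<integral>y. entropy_of ?P (\<lambda>X. F (X(i := y))) \<partial>\<mu>) \<le> (\<integral>y. (\<Sum>j\<in>I. (\<integral>X. G j (X(i := y)) \<partial>?P)) \<partial>\<mu>)"
  proof (rule integral_mono)
    have ij: "integrable \<mu> (\<lambda>y. (\<integral>X. G j (X(i := y)) \<partial>?P))" if "j \<in> I" for j
      using integrable_fst[of "\<lambda>y X. G j (X(i := y))"] iG[of j] that by
          (simp add: split_beta' del: fun_upd_apply)
    then show "integrable \<mu> (\<lambda>y. (\<Sum>j\<in>I. (\<integral>X. G j (X(i := y)) \<partial>?P)))" by auto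
    show "integrable \<mu> (\<lambda>y. entropy_of ?P (\<lambda>X. F (X(i := y))))"
    proof (rule mu.integrable_bounded)
      show "(\<lambda>y. entropy_of ?P (\<lambda>X. F (X(i := y)))) \<in> borel_measurable \<mu>"
        unfolding entropy_of_def using m2[OF Fl] m2[OF insert.prems(1)] by measurable
      show "\<bar>entropy_of ?P (\<lambda>X. F (X(i := y)))\<bar> \<le> 2 * (C * (\<bar>ln c\<bar> + \<bar>ln C\<bar>))" if "y \<in> space \<mu>" for y
      proof (rule PI.entropy_bounded(1))
        show "(\<lambda>X. F (X(i := y))) \<in> borel_measurable ?P"
          using measurable_Pair2[OF FX] that by simp
      qed (use insert.prems(2,3) sp that c in auto)
    qed
    fix y assume y: "y \<in> space \<mu>"
    show "entropy_of ?P (\<lambda>X. F (X(i := y))) \<le> (\<Sum>j\<in>I. (\<integral>X. G j (X(i := y)) \<partial>?P))"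
    proof (rule insert.IH)
      show "(\<lambda>X. F (X(i := y))) \<in> borel_measurable ?P"
        using measurable_Pair2[OF FX] y by simp
      show "c \<le> F (X(i := y))" "F (X(i := y)) \<le> C" if "X \<in> space ?P" for X
        using insert.prems(2,3) sp[OF y that] by auto
      fix j assume j: "j \<in> I"
      have "(\<lambda>z. G j ((snd z)(i := fst z))) \<in> borel_measurable (\<mu> \<Otimes>\<^sub>M ?P)"
        using measurable_compose[OF u, of "G j"] insert.prems(4)[of j] j by
            (simp add: split_beta' del: fun_upd_apply)
      from measurable_Pair2[OF this y] show "(\<lambda>X. G j (X(i := y))) \<in> borel_measurable ?P" by simp
      fix X assume X: "X \<in> space ?P"
      show "\<bar>G j (X(i := y))\<bar> \<le> C" by (rule insert.prems(5)[OF _ sp[OF y X]]) (use j in auto)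
      have "i \<noteq> j" using insert j by auto
      then have tw: "X(j := z, i := y) = X(i := y, j := z)" for z by (rule fun_upd_twist[symmetric])
      show "entropy_of \<mu> (\<lambda>z. F (X(j := z, i := y))) \<le> (\<integral>z. G j (X(j := z, i := y)) \<partial>\<mu>)"
        unfolding tw by (rule insert.prems(6)[OF _ sp[OF y X]]) (use j in auto)
    qed
  qed
  also have "\<dots> = (\<Sum>j\<in>I. (\<integral>y. (\<integral>X. G j (X(i := y)) \<partial>?P) \<partial>\<mu>))"
  proof (rule Bochner_Integration.integral_sum)
    show "integrable \<mu> (\<lambda>y. (\<integral>X. G j (X(i := y)) \<partial>?P))" if "j \<in> I" for j
      using integrable_fst[of "\<lambda>y X. G j (X(i := y))"] iG[of j] that by
          (simp add: split_beta' del: fun_upd_apply)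
  qed
  also have "\<dots> = (\<Sum>j\<in>I. (\<integral>x. G j x \<partial>?Q))"
  proof (rule sum.cong[OF refl])
    fix j assume "j \<in> I"
    then show "(\<integral>y. (\<integral>X. G j (X(i := y)) \<partial>?P) \<partial>\<mu>) = (\<integral>x. G j x \<partial>?Q)"
      using integral_fst[of "\<lambda>y X. G j (X(i := y))"] iG[of j] by
          (simp add: int_Q split_beta' del: fun_upd_apply)
  qed
  finally show ?case using E A insert by simp
qed

section \<open>Logistic kernels\<close>

text \<open>
  The derivative \<open>\<sigma> (1 - \<sigma>)\<close> of the logistic function \<open>\<sigma>\<close> is a probability density all of whose
  derivatives are polynomials in \<open>\<sigma>\<close> times the density itself.  This makes it a convenient kernel: every
  estimate for derivatives of a convolution reduces to the total mass of the kernel.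
\<close>

definition logistic :: "real \<Rightarrow> real" where "logistic u = 1 / (1 + exp (- u))"

lemma logistic_bounds: "0 < logistic u" "logistic u < 1"
  by (auto simp: logistic_def add_pos_pos)

lemma logistic_prod: "logistic u * (1 - logistic u) = 1 / (2 + exp u + exp (- u))"
proof -
  have "1 - logistic u = exp (- u) / (1 + exp (- u))"
    by (simp add: logistic_def field_simps add_pos_pos add_nonneg_eq_0_iff)
  then have "logistic u * (1 - logistic u) = exp (- u) / (1 + exp (- u))\<^sup>2"
    by (simp add: logistic_def power2_eq_square)
  also have "\<dots> = 1 / (2 + exp u + exp (- u))"
  proof -
    have "(1 + exp (- u))\<^sup>2 = exp (- u) * (2 + exp u + exp (- u))"
      by (simp add: power2_eq_square algebra_simps exp_add[symmetric])
    then show ?thesis by simp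
  qed
  finally show ?thesis .
qed

lemma DERIV_logistic: "(logistic has_real_derivative logistic u * (1 - logistic u)) (at u)"
proof -
  have "1 + exp (- u) \<noteq> 0" by (smt (verit) exp_gt_zero)
  then have "((\<lambda>u. 1 / (1 + exp (- u))) has_real_derivative exp (- u) / (1 + exp (- u))\<^sup>2) (at u)"
    by (auto intro!: derivative_eq_intros simp: power2_eq_square)
  moreover have "exp (- u) / (1 + exp (- u))\<^sup>2 = logistic u * (1 - logistic u)"
    using \<open>1 + exp (- u) \<noteq> 0\<close> by (simp add: logistic_def field_simps power2_eq_square)
  ultimately show ?thesis unfolding logistic_def[abs_def] by simp
qed

primrec kernel_poly :: "real \<Rightarrow> nat \<Rightarrow> real poly" where
  "kernel_poly a 0 = [:a:]"
| "kernel_poly a (Suc k) = smult (- a) ([:1, -2:] * kernel_poly a k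
    + [:0, 1, -1:] * pderiv (kernel_poly a k))"

text \<open>
  The \<open>k\<close>-th derivative of the density \<open>a \<sigma>(a s) (1 - \<sigma>(a s))\<close>, with the sign \<open>(-1) ^ k\<close>; the sign is
  the one that differentiation with respect to \<open>x\<close> produces in \<open>lkernel a k (z - x)\<close>.
\<close>

definition lkernel :: "real \<Rightarrow> nat \<Rightarrow> real \<Rightarrow> real" where
  "lkernel a k s = logistic (a * s) * (1 - logistic (a * s)) * poly (kernel_poly a k) (logistic (a *
      s))"

lemma DERIV_kernel: "(lkernel a k has_real_derivative - lkernel a (Suc k) s) (at s)"
proof -
  let ?l = "logistic (a * s)"
  have 1: "((\<lambda>s. logistic (a * s)) has_real_derivative ?l * (1 - ?l) * a) (at s)"
    by (rule DERIV_chain2[OF DERIV_logistic]) (auto intro!: derivative_eq_intros)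
  show ?thesis unfolding lkernel_def[abs_def]
    by (rule derivative_eq_intros 1 DERIV_chain2[OF poly_DERIV 1] refl)+ (simp add: algebra_simps)
qed

lemma kernel_0: "lkernel a 0 s = a / (2 + exp (a * s) + exp (- (a * s)))"
  unfolding lkernel_def logistic_prod by simp

lemma kernel_0_pos: "a > 0 \<Longrightarrow> 0 < lkernel a 0 s"
  unfolding kernel_0 by (auto intro!: divide_pos_pos add_pos_pos)

lemma kernel_le:
  assumes "a > 0"
  obtains C where "C > 0" "\<And>s. \<bar>lkernel a k s\<bar> \<le> C * lkernel a 0 s"
proof -
  have "bounded (poly (kernel_poly a k) ` {0..1})"
    by (intro compact_imp_bounded compact_continuous_image continuous_intros) auto
  then obtain c where c: "\<And>u. u \<in> {0..1} \<Longrightarrow> \<bar>poly (kernel_poly a k) u\<bar> \<le> c" unfolding bounded_iff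
      by (metis imageI real_norm_def)
  have c0: "0 \<le> c" using c[of 0] by auto
  show thesis
  proof (rule that[of "(c + 1) / a"])
    show "(c + 1) / a > 0" using assms c0 by auto
    fix s
    let ?l = "logistic (a * s)"
    have l: "0 < ?l" "?l < 1" by (rule logistic_bounds)+
    have "\<bar>lkernel a k s\<bar> = ?l * (1 - ?l) * \<bar>poly (kernel_poly a k) ?l\<bar>"
      unfolding lkernel_def using l by (simp add: abs_mult)
    also have "\<dots> \<le> ?l * (1 - ?l) * (c + 1)" using l c[of ?l] by (intro mult_left_mono) auto
    also have "\<dots> = (c + 1) / a * lkernel a 0 s" using assms by (simp add: lkernel_def)
    finally show "\<bar>lkernel a k s\<bar> \<le> (c + 1) / a * lkernel a 0 s" .
  qed
qed

lemma continuous_kernel: "continuous_on UNIV (lkernel a k)"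
  using DERIV_kernel by (auto intro!: continuous_at_imp_continuous_on DERIV_isCont)

lemma kernel_measurable[measurable]: "lkernel a k \<in> borel_measurable borel"
  by (rule borel_measurable_continuous_onI[OF continuous_kernel])

text \<open>
  Shifting the argument changes \<open>exp (a * s)\<close> and \<open>exp (- (a * s))\<close> by a factor of at most
  \<open>exp (a * \<bar>u\<bar>)\<close>; so the kernel controls its own translates.
\<close>

lemma kernel_shift:
  assumes "a > 0"
  shows "lkernel a 0 (s + u) \<le> exp (a * \<bar>u\<bar>) * lkernel a 0 s"
proof -
  define e where "e = exp (- (a * \<bar>u\<bar>))"
  have e: "0 < e" "e \<le> 1" using assms by (auto simp: e_def)
  have "e * (2 + exp (a * s) + exp (- (a * s))) \<le> 2 + exp (a * (s + u)) + exp (- (a * (s + u)))"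
  proof -
    have "e * exp (a * s) \<le> exp (a * (s + u))" "e * exp (- (a * s)) \<le> exp (- (a * (s + u)))"
      using assms abs_ge_self[of "a * u"] abs_ge_minus_self[of "a * u"]
      by (auto simp: e_def exp_add[symmetric] algebra_simps abs_mult)
    moreover have "e * 2 \<le> 2" using e by simp
    ultimately show ?thesis by (simp only: distrib_left)
  qed
  then have "a / (2 + exp (a * (s + u)) + exp (- (a * (s + u))))
      \<le> a / (e * (2 + exp (a * s) + exp (- (a * s))))"
    using assms e by (intro divide_left_mono) (auto intro!: mult_pos_pos add_pos_pos)
  also have "\<dots> = (1 / e) * lkernel a 0 s" by (simp add: kernel_0)
  also have "1 / e = exp (a * \<bar>u\<bar>)" by (simp add: e_def exp_minus inverse_eq_divide)
  finally show ?thesis unfolding kernel_0 .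
qed

lemma kernel_integral:
  assumes a: "a > 0"
  shows "integrable lborel (lkernel a 0)" "(\<integral>s. lkernel a 0 s \<partial>lborel) = 1"
proof -
  have lim1: "((\<lambda>s. logistic (a * s)) \<longlongrightarrow> 1) at_top"
  proof -
    have "((\<lambda>s. exp (- (a * s))) \<longlongrightarrow> 0) at_top"
      using a by (intro filterlim_compose[OF exp_at_bot] filterlim_uminus_at_bot_at_top[THEN
          filterlim_compose] filterlim_tendsto_pos_mult_at_top[OF tendsto_const])
          (auto intro: filterlim_ident)
    then have "((\<lambda>s. 1 / (1 + exp (- (a * s)))) \<longlongrightarrow> 1 / (1 + 0)) at_top"
      by (intro tendsto_intros) auto
    then show ?thesis by (simp add: logistic_def)
  qed
  have refl: "logistic (- u) = 1 - logistic u" for u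
  proof -
    have "1 + exp u \<noteq> 0" "1 + exp (- u) \<noteq> 0" by (smt (verit) exp_gt_zero)+
    then show ?thesis unfolding logistic_def by (simp add: field_simps exp_add[symmetric])
  qed
  have lim0: "((\<lambda>s. logistic (a * s)) \<longlongrightarrow> 0) at_bot"
  proof -
    have "((\<lambda>s. 1 - logistic (a * s)) \<longlongrightarrow> 1 - 1) at_top" by (intro tendsto_intros lim1)
    then have "((\<lambda>s. logistic (a * (- s))) \<longlongrightarrow> 0) at_top" by (simp add: refl)
    then show ?thesis by (subst filterlim_at_bot_mirror)
  qed
  have F: "((\<lambda>s. logistic (a * s)) has_real_derivative lkernel a 0 s) (at s)" for s
    by (rule DERIV_chain2[OF DERIV_logistic, THEN DERIV_cong])
        (auto intro!: derivative_eq_intros simp: lkernel_def)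
  have cont: "isCont (lkernel a 0) s" for s by (rule DERIV_isCont[OF DERIV_kernel])
  note FTC = interval_integral_FTC_nonneg[of "-\<infinity>" "\<infinity>" "\<lambda>s. logistic (a * s)" "lkernel a 0" 0 1]
  have "set_integrable lborel (einterval (-\<infinity>) \<infinity>) (lkernel a 0)" "(LBINT x=-\<infinity>..\<infinity>. lkernel a 0 x) = 1 - 0"
    using F cont lim0 lim1 kernel_0_pos[OF a]
        by (intro FTC; auto simp: ereal_tendsto_simps less_imp_le)+
  then show "integrable lborel (lkernel a 0)" "(\<integral>s. lkernel a 0 s \<partial>lborel) = 1"
    by (auto simp: set_integrable_def interval_lebesgue_integral_def set_lebesgue_integral_def)
qed

lemma kernel_integrable:
  assumes a: "a > 0" shows "integrable lborel (lkernel a k)"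
proof -
  obtain C where "C > 0" "\<And>s. \<bar>lkernel a k s\<bar> \<le> C * lkernel a 0 s" using kernel_le[OF a] by blast
  then show ?thesis using kernel_integral(1)[OF a]
    by (intro Bochner_Integration.integrable_bound[of _ "\<lambda>s. C * lkernel a 0 s" "lkernel a k"])
      (auto intro!: AE_I2 order_trans[OF _ abs_ge_self])
qed

lemma kernel_scale: "a > 0 \<Longrightarrow> lkernel a 0 (s / a) = a * lkernel 1 0 s"
  by (simp add: kernel_0)

lemma kernel_first_moment:
  shows "integrable lborel (\<lambda>s. \<bar>s\<bar> * lkernel 1 0 s)"
    "a > 0 \<Longrightarrow> integrable lborel (\<lambda>s. \<bar>s\<bar> * lkernel a 0 s)"
    "a > 0 \<Longrightarrow> (\<integral>s. \<bar>s\<bar> * lkernel a 0 s \<partial>lborel) = (\<integral>s. \<bar>s\<bar> * lkernel 1 0 s \<partial>lborel) / a"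
proof -
  have le: "\<bar>s\<bar> * lkernel 1 0 s \<le> 27 * inverse (1 + s\<^sup>2)" for s :: real
  proof -
    define t where "t = \<bar>s\<bar>"
    have t: "t \<ge> 0" by (simp add: t_def)
    have "27 * (1 + t / 3) ^ 3 = 27 + 27 * t + 9 * t\<^sup>2 + t ^ 3"
      by (simp add: power3_eq_cube power2_eq_square field_simps)
    moreover have "t * (1 + t\<^sup>2) = t + t ^ 3" by
        (simp add: power3_eq_cube power2_eq_square algebra_simps)
    ultimately have "t * (1 + t\<^sup>2) \<le> 27 * (1 + t / 3) ^ 3" using t zero_le_power2[of t] by linarith
    also have "(1 + t / 3) ^ 3 \<le> exp (t / 3) ^ 3" using t by (intro power_mono exp_ge_add_one_self) auto
    also have "exp (t / 3) ^ 3 = exp t" by (simp add: exp_of_nat_mult[symmetric])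
    finally have "t * (1 + t\<^sup>2) \<le> 27 * exp t" by simp
    also have "exp t \<le> 2 + exp s + exp (- s)" unfolding t_def by
        (auto simp: abs_if intro: add_nonneg_nonneg)
    finally have "t * (1 + t\<^sup>2) \<le> 27 * (2 + exp s + exp (- s))" by simp
    moreover have "0 < 1 + t\<^sup>2" by (simp add: add_pos_nonneg)
    moreover have "0 < 2 + exp s + exp (- s)" by (intro add_pos_pos) auto
    ultimately have "t / (2 + exp s + exp (- s)) \<le> 27 / (1 + t\<^sup>2)" by (simp add: field_simps)
    then show ?thesis by (simp add: kernel_0 t_def inverse_eq_divide)
  qed
  have "integrable lborel (\<lambda>s::real. 27 * inverse (1 + s\<^sup>2))"
    using integrable_inverse_1_plus_square by (simp add: set_integrable_def)
  then show i: "integrable lborel (\<lambda>s. \<bar>s\<bar> * lkernel 1 0 s)"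
    by (rule Bochner_Integration.integrable_bound)
      (use le in \<open>auto intro!: AE_I2 simp: abs_mult abs_of_pos[OF kernel_0_pos] intro: order_trans[OF _
          abs_ge_self]\<close>)
  have eq: "(\<lambda>x. \<bar>0 + 1/a * x\<bar> * lkernel a 0 (0 + 1/a * x)) = (\<lambda>x. \<bar>x\<bar> * lkernel 1 0 x)" if "a > 0"
    using that kernel_scale[OF that] by (auto simp: abs_mult)
  show "integrable lborel (\<lambda>s. \<bar>s\<bar> * lkernel a 0 s)" if "a > 0"
    using lborel_integrable_real_affine_iff[of "1/a" "\<lambda>s. \<bar>s\<bar> * lkernel a 0 s" 0] i that eq[OF that]
        by simp
  show "(\<integral>s. \<bar>s\<bar> * lkernel a 0 s \<partial>lborel) = (\<integral>s. \<bar>s\<bar> * lkernel 1 0 s \<partial>lborel) / a" if "a > 0"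
    using lborel_integral_real_affine[of "1/a" "\<lambda>s. \<bar>s\<bar> * lkernel a 0 s" 0] that unfolding eq[OF that]
        by simp
qed

lemma kernel_lipschitz:
  assumes a: "a > 0"
  obtains C where "C > 0" "\<And>s u. \<bar>u\<bar> \<le> 1 \<Longrightarrow> \<bar>lkernel a k (s - u) - lkernel a k s\<bar>
      \<le> C * \<bar>u\<bar> * lkernel a 0 s"
proof -
  obtain C where C: "C > 0" "\<And>s. \<bar>lkernel a (Suc k) s\<bar> \<le> C * lkernel a 0 s" using kernel_le[OF a]
      by blast
  show thesis
  proof (rule that[of "C * exp a"])
    show "C * exp a > 0" using C by simp
    fix s u :: real assume u: "\<bar>u\<bar> \<le> 1"
    have "norm (lkernel a k (s - u) - lkernel a k (s - 0)) \<le> (C * exp a * lkernel a 0 s) * norm (u - 0)"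
    proof (rule field_differentiable_bound[of "{-1..1}" "\<lambda>u. lkernel a k (s - u)"
        "\<lambda>u. lkernel a (Suc k) (s - u)"])
      fix v :: real assume v: "v \<in> {-1..1}"
      have "((\<lambda>u. lkernel a k (s - u)) has_real_derivative lkernel a (Suc k) (s - v)) (at v)"
        by (rule DERIV_chain2[OF DERIV_kernel, THEN DERIV_cong]) (auto intro!: derivative_eq_intros)
      then show "((\<lambda>u. lkernel a k (s - u)) has_real_derivative lkernel a (Suc k) (s
          - v)) (at v within {-1..1})"
        by (rule has_field_derivative_at_within)
      have "\<bar>lkernel a (Suc k) (s - v)\<bar> \<le> C * lkernel a 0 (s + - v)" using C(2)[of "s - v"] by simp
      also have "\<dots> \<le> C * (exp (a * \<bar>- v\<bar>) * lkernel a 0 s)"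
        using C a by (intro mult_left_mono kernel_shift) auto
      also have "\<dots> \<le> C * (exp a * lkernel a 0 s)"
        using C a v kernel_0_pos[OF a, of s] by (intro mult_left_mono mult_right_mono) auto
      finally show "norm (lkernel a (Suc k) (s - v)) \<le> C * exp a * lkernel a 0 s" by simp
    qed (use u in auto)
    then show "\<bar>lkernel a k (s - u) - lkernel a k s\<bar> \<le> C * exp a * \<bar>u\<bar> * lkernel a 0 s" by
        (simp add: mult_ac)
  qed
qed

text \<open>
  The remainder is bounded by the kernel itself, uniformly in \<open>s\<close>, and can therefore be integrated
  against bounded functions.
\<close>

lemma kernel_taylor:
  assumes a: "a > 0"
  obtains C where "C > 0" "\<And>s u. \<bar>u\<bar> \<le> 1 \<Longrightarrow>
      \<bar>lkernel a k (s - u) - lkernel a k s - u * lkernel a (Suc k) s\<bar> \<le> C * u\<^sup>2 * lkernel a 0 s"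
proof -
  obtain C where C: "C > 0" "\<And>s u. \<bar>u\<bar> \<le> 1 \<Longrightarrow> \<bar>lkernel a (Suc k) (s - u) - lkernel a (Suc k) s\<bar>
      \<le> C * \<bar>u\<bar> * lkernel a 0 s"
    using kernel_lipschitz[OF a] by blast
  show thesis
  proof (rule that[of C])
    show "C > 0" using C by simp
    fix s u :: real assume u: "\<bar>u\<bar> \<le> 1"
    let ?f = "\<lambda>v. lkernel a k (s - v) - v * lkernel a (Suc k) s"
    have "norm (?f u - ?f 0) \<le> (C * \<bar>u\<bar> * lkernel a 0 s) * norm (u - 0)"
    proof (rule field_differentiable_bound[of "{-\<bar>u\<bar>..\<bar>u\<bar>}" ?f
        "\<lambda>v. lkernel a (Suc k) (s - v) - lkernel a (Suc k) s"])
      fix v :: real assume v: "v \<in> {-\<bar>u\<bar>..\<bar>u\<bar>}"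
      have d: "((\<lambda>u. lkernel a k (s - u)) has_real_derivative lkernel a (Suc k) (s - v)) (at v)"
        by (rule DERIV_chain2[OF DERIV_kernel, THEN DERIV_cong]) (auto intro!: derivative_eq_intros)
      have "(?f has_real_derivative lkernel a (Suc k) (s - v) - lkernel a (Suc k) s) (at v)"
        by (rule derivative_eq_intros d refl)+ simp
      then show "(?f has_real_derivative lkernel a (Suc k) (s - v)
          - lkernel a (Suc k) s) (at v within {-\<bar>u\<bar>..\<bar>u\<bar>})"
        by (rule has_field_derivative_at_within)
      have "\<bar>lkernel a (Suc k) (s - v) - lkernel a (Suc k) s\<bar> \<le> C * \<bar>v\<bar> * lkernel a 0 s"
        using u v by (intro C) auto
      also have "\<dots> \<le> C * \<bar>u\<bar> * lkernel a 0 s"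
        using C v kernel_0_pos[OF a, of s] by (intro mult_left_mono mult_right_mono) auto
      finally show "norm (lkernel a (Suc k) (s - v) - lkernel a (Suc k) s) \<le> C * \<bar>u\<bar> * lkernel a 0 s"
          by simp
    qed auto
    then show "\<bar>lkernel a k (s - u) - lkernel a k s - u * lkernel a (Suc k) s\<bar> \<le> C * u\<^sup>2 * lkernel a 0 s"
      by (simp add: power2_eq_square mult_ac)
  qed
qed

section \<open>Smoothing bounded Lipschitz functions of finitely many variables\<close>

locale smoothing =
  fixes I :: "'k set" and f :: "('k \<Rightarrow> real) \<Rightarrow> real" and B L a :: real
  assumes fin: "finite I" and a: "a > 0" and L: "0 \<le> L"
    and f_meas[measurable]: "f \<in> borel_measurable (PiM I (\<lambda>_. lborel))"
    and f_bound: "\<And>z. z \<in> space (PiM I (\<lambda>_. lborel)) \<Longrightarrow> \<bar>f z\<bar> \<le> B"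
    and f_lip: "\<And>u v. u \<in> space (PiM I (\<lambda>_. lborel)) \<Longrightarrow> v \<in> space (PiM I (\<lambda>_. lborel)) \<Longrightarrow>
        \<bar>f u - f v\<bar> \<le> L * (\<Sum>i\<in>I. \<bar>u i - v i\<bar>)"
begin

abbreviation Leb :: "('k \<Rightarrow> real) measure" where "Leb \<equiv> PiM I (\<lambda>_. lborel)"

definition prod_kernel :: "('k \<Rightarrow> nat) \<Rightarrow> ('k \<Rightarrow> real) \<Rightarrow> ('k \<Rightarrow> real) \<Rightarrow> real" where
  "prod_kernel k x z = (\<Prod>i\<in>I. lkernel a (k i) (z i - x i))"

text \<open>
  The mixed partial derivative of order \<open>k\<close> of the convolution of \<open>f\<close> with the product kernel.  The
  variable \<open>x\<close> sits in the kernel, which is smooth, so derivatives need no regularity of \<open>f\<close>.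
\<close>

definition conv :: "('k \<Rightarrow> nat) \<Rightarrow> ('k \<Rightarrow> real) \<Rightarrow> real" where
  "conv k x = (\<integral>z. f z * prod_kernel k x z \<partial>Leb)"

abbreviation "kern0 \<equiv> prod_kernel (\<lambda>_. 0)"
abbreviation "conv0 \<equiv> conv (\<lambda>_. 0)"
abbreviation "dconv j \<equiv> conv ((\<lambda>_. 0)(j := 1))"

interpretation product_sigma_finite "\<lambda>_::'k. lborel :: real measure"
  by standard

lemma B_nonneg: "0 \<le> B"
proof -
  have "(\<lambda>i\<in>I. 0) \<in> space Leb" by (simp add: space_PiM)
  from f_bound[OF this] show ?thesis by simp
qed

lemma prod_kernel_measurable[measurable]: "prod_kernel k x \<in> borel_measurable Leb"
  unfolding prod_kernel_def by measurable

lemma integrable_prod_kernel: "integrable Leb (prod_kernel k x)"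
  unfolding prod_kernel_def
proof (rule product_integrable_prod[OF fin])
  fix i
  show "integrable lborel (\<lambda>s. lkernel a (k i) (s - x i))"
    using lborel_integrable_real_affine[OF kernel_integrable[OF a], of 1 "k i" "- x i"] by
        (simp add: add.commute)
qed

lemma prod_kernel_0_pos: "0 < kern0 x z"
  unfolding prod_kernel_def using kernel_0_pos[OF a] by (intro prod_pos) auto

lemma integral_prod_kernel_0: "(\<integral>z. kern0 x z \<partial>Leb) = 1"
proof -
  have "integrable lborel (\<lambda>s. lkernel a 0 (s - x i))" for i
    using lborel_integrable_real_affine[OF kernel_integrable[OF a], of 1 0 "- x i"] by
        (simp add: add.commute)
  moreover have "(\<integral>s. lkernel a 0 (s - x i) \<partial>lborel) = 1" for i
    using lborel_integral_real_affine[of 1 "lkernel a 0" "- x i"] kernel_integral(2)[OF a] by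
        (simp add: add.commute)
  ultimately show ?thesis unfolding prod_kernel_def
    using product_integral_prod[OF fin, of "\<lambda>i s. lkernel a 0 (s - x i)"] by simp
qed

lemma prod_kernel_le:
  obtains C where "C > 0" "\<And>x z. \<bar>prod_kernel k x z\<bar> \<le> C * kern0 x z"
proof -
  have "\<forall>i. \<exists>C>0. \<forall>s. \<bar>lkernel a (k i) s\<bar> \<le> C * lkernel a 0 s" using kernel_le[OF a] by metis
  then obtain C where C: "\<And>i. C i > 0" "\<And>i s. \<bar>lkernel a (k i) s\<bar> \<le> C i * lkernel a 0 s" by metis
  show thesis
  proof (rule that[of "\<Prod>i\<in>I. C i"])
    show "(\<Prod>i\<in>I. C i) > 0" using C by (intro prod_pos) auto
    show "\<bar>prod_kernel k x z\<bar> \<le> (\<Prod>i\<in>I. C i) * kern0 x z" for x z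
      unfolding prod_kernel_def abs_prod prod.distrib[symmetric] using C by (intro prod_mono) auto
  qed
qed

lemma integrable_mult_prod_kernel:
  assumes [measurable]: "h \<in> borel_measurable Leb" and "\<And>z. z \<in> space Leb \<Longrightarrow> \<bar>h z\<bar> \<le> c"
  shows "integrable Leb (\<lambda>z. h z * prod_kernel k x z)"
proof (rule Bochner_Integration.integrable_bound)
  show "integrable Leb (\<lambda>z. c * prod_kernel k x z)" using integrable_prod_kernel by simp
  show "AE z in Leb. norm (h z * prod_kernel k x z) \<le> norm (c * prod_kernel k x z)"
  proof (rule AE_I2)
    fix z assume "z \<in> space Leb"
    then have "\<bar>h z\<bar> \<le> \<bar>c\<bar>" using assms(2)[of z] by auto
    then show "norm (h z * prod_kernel k x z) \<le> norm (c * prod_kernel k x z)"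
      by (auto simp: abs_mult intro!: mult_right_mono)
  qed
qed auto

lemmas integrable_f_prod_kernel = integrable_mult_prod_kernel[OF f_meas f_bound]

lemma abs_integral_prod_kernel_le:
  assumes [measurable]: "h \<in> borel_measurable Leb" and h: "\<And>z. z \<in> space Leb \<Longrightarrow> \<bar>h z\<bar> \<le> c * kern0 x z"
  shows "\<bar>\<integral>z. h z \<partial>Leb\<bar> \<le> c"
proof -
  have i: "integrable Leb (\<lambda>z. c * kern0 x z)" using integrable_prod_kernel by simp
  have "\<bar>\<integral>z. h z \<partial>Leb\<bar> \<le> (\<integral>z. \<bar>h z\<bar> \<partial>Leb)" by (rule integral_abs_bound)
  also have "\<dots> \<le> (\<integral>z. c * kern0 x z \<partial>Leb)"
    by (intro integral_mono i Bochner_Integration.integrable_bound[OF i]) (use h in \<open>auto intro!: AE_I2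
        order_trans[OF h abs_ge_self]\<close>)
  also have "\<dots> = c" by (simp add: integral_prod_kernel_0)
  finally show ?thesis .
qed

lemma conv_0_bounded: "\<bar>conv0 x\<bar> \<le> B"
  unfolding conv_def
proof (rule abs_integral_prod_kernel_le[of _ _ x])
  fix z assume z: "z \<in> space Leb"
  show "\<bar>f z * kern0 x z\<bar> \<le> B * kern0 x z"
    unfolding abs_mult using f_bound[OF z] prod_kernel_0_pos[of x z] by (intro mult_mono) auto
qed auto

text \<open>
  Only the factor with index \<open>j\<close> of the product kernel depends on \<open>h\<close>.
\<close>

lemma conv_taylor:
  assumes j: "j \<in> I"
  obtains C where "C > 0"
    "\<And>x h. \<bar>h\<bar> \<le> 1 \<Longrightarrow> \<bar>conv k (x(j := x j + h)) - conv k x - h * conv (k(j := Suc (k j))) x\<bar> \<le> C * h\<^sup>2"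
proof -
  obtain C where C: "C > 0" "\<And>x z. \<bar>prod_kernel (k(j := 0)) x z\<bar> \<le> C * kern0 x z"
      using prod_kernel_le[of "k(j := 0)"] by blast
  obtain D where D: "D > 0" "\<And>s u. \<bar>u\<bar> \<le> 1 \<Longrightarrow>
      \<bar>lkernel a (k j) (s - u) - lkernel a (k j) s - u * lkernel a (Suc (k j)) s\<bar>
      \<le> D * u\<^sup>2 * lkernel a 0 s"
    using kernel_taylor[OF a] by blast
  show thesis
  proof (rule that[of "(B + 1) * (C * D)"])
    show "(B + 1) * (C * D) > 0" using C D B_nonneg by simp
    fix x :: "'k \<Rightarrow> real" and h :: real assume h: "\<bar>h\<bar> \<le> 1"
    have split: "prod_kernel k' x' z = lkernel a (k' j) (z j - x' j) * (\<Prod>i\<in>I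
        - {j}. lkernel a (k' i) (z i - x' i))" for k' x' z
      unfolding prod_kernel_def by (rule prod.remove[OF fin j])
    have est: "\<bar>prod_kernel k (x(j := x j + h)) z - prod_kernel k x z
        - h * prod_kernel (k(j := Suc (k j))) x z\<bar> \<le> C * D * h\<^sup>2 * kern0 x z" for z
    proof -
      define R where "R = (\<Prod>i\<in>I - {j}. lkernel a (k i) (z i - x i))"
      have "prod_kernel k (x(j := x j + h)) z - prod_kernel k x z
          - h * prod_kernel (k(j := Suc (k j))) x z
         = (lkernel a (k j) (z j - x j - h) - lkernel a (k j) (z j - x j)
             - h * lkernel a (Suc (k j)) (z j - x j)) * R"
        unfolding split R_def by (simp add: algebra_simps cong: prod.cong_simp)
      also have "\<bar>\<dots>\<bar> \<le> (D * h\<^sup>2 * lkernel a 0 (z j - x j)) * \<bar>R\<bar>"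
        unfolding abs_mult by (intro mult_right_mono D h) auto
      also have "\<dots> = D * h\<^sup>2 * \<bar>prod_kernel (k(j := 0)) x z\<bar>"
        unfolding split R_def using kernel_0_pos[OF a] by
            (simp add: abs_mult less_imp_le cong: prod.cong_simp)
      also have "\<dots> \<le> D * h\<^sup>2 * (C * kern0 x z)" using D by (intro mult_left_mono C) auto
      finally show ?thesis by (simp add: mult_ac)
    qed
    have "conv k (x(j := x j + h)) - conv k x - h * conv (k(j := Suc (k j))) x
      = (\<integral>z. f z * (prod_kernel k (x(j := x j + h)) z - prod_kernel k x z
          - h * prod_kernel (k(j := Suc (k j))) x z) \<partial>Leb)"
      unfolding conv_def right_diff_distrib mult.left_commute[of _ h]
      using integrable_f_prod_kernel by simp
    also have "\<bar>\<dots>\<bar> \<le> (B + 1) * (C * D) * h\<^sup>2"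
    proof (rule abs_integral_prod_kernel_le[of _ _ x])
      fix z assume z: "z \<in> space Leb"
      have "\<bar>f z\<bar> \<le> B + 1" using f_bound[OF z] by simp
      then show "\<bar>f z * (prod_kernel k (x(j := x j + h)) z - prod_kernel k x z
          - h * prod_kernel (k(j := Suc (k j))) x z)\<bar>
         \<le> (B + 1) * (C * D) * h\<^sup>2 * kern0 x z"
        using mult_mono[OF \<open>\<bar>f z\<bar> \<le> B + 1\<close> est[of z]] B_nonneg by (simp add: abs_mult mult.assoc)
    qed auto
    finally show "\<bar>conv k (x(j := x j + h)) - conv k x - h * conv (k(j := Suc (k j))) x\<bar>
        \<le> (B + 1) * (C * D) * h\<^sup>2" .
  qed
qed

lemma DERIV_conv:
  assumes j: "j \<in> I"
  shows "((\<lambda>s. conv k (x(j := s))) has_real_derivative conv (k(j := Suc (k j))) (x(j := s))) (at s)"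
proof -
  obtain C where C: "C > 0"
    "\<And>x h. \<bar>h\<bar> \<le> 1 \<Longrightarrow> \<bar>conv k (x(j := x j + h)) - conv k x - h * conv (k(j := Suc (k j))) x\<bar> \<le> C * h\<^sup>2"
    using conv_taylor[OF j] by blast
  let ?d = "conv (k(j := Suc (k j))) (x(j := s))"
  have "((\<lambda>h. (conv k (x(j := s + h)) - conv k (x(j := s))) / h - ?d) \<longlongrightarrow> 0) (at 0)"
  proof (rule Lim_null_comparison)
    show "((\<lambda>h. C * \<bar>h\<bar>) \<longlongrightarrow> 0) (at 0)" by (auto intro!: tendsto_eq_intros)
    have "\<forall>\<^sub>F h in at (0::real). h \<noteq> 0 \<and> \<bar>h\<bar> \<le> 1"
      unfolding eventually_at by (rule exI[of _ 1]) auto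
    then show "\<forall>\<^sub>F h in at 0. norm ((conv k (x(j := s + h)) - conv k (x(j := s))) / h - ?d) \<le> C * \<bar>h\<bar>"
    proof eventually_elim
      case (elim h)
      have "(conv k (x(j := s + h)) - conv k (x(j := s))) / h - ?d
          = (conv k (x(j := s + h)) - conv k (x(j := s)) - h * ?d) / h"
        using elim by (simp add: field_simps)
      also have "\<bar>\<dots>\<bar> \<le> C * h\<^sup>2 / \<bar>h\<bar>"
        unfolding abs_divide using C(2)[of h "x(j := s)"] elim by (intro divide_right_mono) auto
      also have "\<dots> = C * \<bar>h\<bar>" using elim by (cases "h \<ge> 0") (auto simp: power2_eq_square)
      finally show ?case by simp
    qed
  qed
  then show ?thesis unfolding DERIV_def by (rule LIM_zero_cancel)
qed

lemma translate_Leb: "distr Leb Leb (\<lambda>z. \<lambda>i\<in>I. z i + x i) = Leb"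
proof (rule PiM_eqI[OF fin])
  show "sets (distr Leb Leb (\<lambda>z. \<lambda>i\<in>I. z i + x i)) = sets Leb" by simp
  fix A :: "'k \<Rightarrow> real set" assume A: "\<And>i. i \<in> I \<Longrightarrow> A i \<in> sets lborel"
  have m: "(\<lambda>z. \<lambda>i\<in>I. z i + x i) \<in> measurable Leb Leb" by measurable
  have P: "PiE I A \<in> sets Leb" using A by (intro sets_PiM_I_finite fin) auto
  have A': "(\<lambda>s. s + x i) -` A i \<in> sets lborel" if "i \<in> I" for i
    using measurable_sets[of "\<lambda>s. s + x i" borel borel "A i"] A[OF that] by simp
  have "emeasure (distr Leb Leb (\<lambda>z. \<lambda>i\<in>I. z i + x i)) (PiE I A)
      = emeasure Leb ((\<lambda>z. \<lambda>i\<in>I. z i + x i) -` PiE I A \<inter> space Leb)"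
    by (rule emeasure_distr[OF m P])
  also have "(\<lambda>z. \<lambda>i\<in>I. z i + x i) -` PiE I A \<inter> space Leb = PiE I (\<lambda>i. (\<lambda>s. s + x i) -` A i)"
    by (auto simp: space_PiM PiE_iff)
  also have "emeasure Leb \<dots> = (\<Prod>i\<in>I. emeasure lborel ((\<lambda>s. s + x i) -` A i))"
    by (rule emeasure_PiM[OF fin A'])
  also have "\<dots> = (\<Prod>i\<in>I. emeasure lborel (A i))"
  proof (rule prod.cong[OF refl])
    fix i assume i: "i \<in> I"
    have "emeasure lborel (A i) = emeasure (distr lborel borel (\<lambda>s. x i + s)) (A i)"
        by (subst lborel_distr_plus) simp
    also have "\<dots> = emeasure lborel ((\<lambda>s. x i + s) -` A i)" using A[OF i] by (subst emeasure_distr) auto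
    finally show "emeasure lborel ((\<lambda>s. s + x i) -` A i) = emeasure lborel (A i)" by
        (simp add: add.commute)
  qed
  finally show "emeasure (distr Leb Leb (\<lambda>z. \<lambda>i\<in>I. z i + x i)) (PiE I A)
      = (\<Prod>i\<in>I. emeasure lborel (A i))" .
qed

text \<open>
  With \<open>x\<close> in the argument of \<open>f\<close> the Lipschitz conditions pass to the convolution.
\<close>

lemma conv_translated: "conv k x = (\<integral>z. f (\<lambda>i\<in>I. z i + x i) * prod_kernel k (\<lambda>_. 0) z \<partial>Leb)"
proof -
  have "conv k x = (\<integral>z. f z * prod_kernel k x z \<partial>distr Leb Leb (\<lambda>z. \<lambda>i\<in>I. z i + x i))"
    unfolding translate_Leb conv_def ..
  also have "\<dots> = (\<integral>z. f (\<lambda>i\<in>I. z i + x i) * prod_kernel k x (\<lambda>i\<in>I. z i + x i) \<partial>Leb)"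
    by (rule integral_distr) measurable
  also have "\<dots> = (\<integral>z. f (\<lambda>i\<in>I. z i + x i) * prod_kernel k (\<lambda>_. 0) z \<partial>Leb)"
    unfolding prod_kernel_def by (simp cong: prod.cong)
  finally show ?thesis .
qed

lemma translate_in_space: "(\<lambda>i\<in>I. g i) \<in> space Leb"
  by (simp add: space_PiM)

lemma integrable_translated: "integrable Leb (\<lambda>z. f (\<lambda>i\<in>I. z i + x i) * prod_kernel k (\<lambda>_. 0) z)"
  by (rule integrable_mult_prod_kernel[of _ B]) (use f_bound translate_in_space in auto)

lemma conv_diff: "conv k x - conv k y
    = (\<integral>z. (f (\<lambda>i\<in>I. z i + x i) - f (\<lambda>i\<in>I. z i + y i)) * prod_kernel k (\<lambda>_. 0) z \<partial>Leb)"
  unfolding conv_translated left_diff_distrib using integrable_translated by simp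

lemma conv_0_diff_le:
  assumes N: "\<And>z. z \<in> space Leb \<Longrightarrow> \<bar>f (\<lambda>i\<in>I. z i + x i) - f (\<lambda>i\<in>I. z i + y i)\<bar> \<le> N"
  shows "\<bar>conv0 x - conv0 y\<bar> \<le> N"
  unfolding conv_diff
proof (rule abs_integral_prod_kernel_le)
  fix z assume z: "z \<in> space Leb"
  show "\<bar>(f (\<lambda>i\<in>I. z i + x i) - f (\<lambda>i\<in>I. z i + y i)) * kern0 (\<lambda>_. 0) z\<bar> \<le> N * kern0 (\<lambda>_. 0) z"
    unfolding abs_mult using N[OF z] prod_kernel_0_pos[of "\<lambda>_. 0" z] by (auto intro!: mult_mono)
qed measurable

lemma conv_lipschitz:
  obtains C where "C \<ge> 0" "\<And>x y. \<bar>conv k x - conv k y\<bar> \<le> C * (\<Sum>i\<in>I. \<bar>x i - y i\<bar>)"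
proof -
  obtain C where C: "C > 0" "\<And>x z. \<bar>prod_kernel k x z\<bar> \<le> C * kern0 x z" using prod_kernel_le[of k]
      by blast
  show thesis
  proof (rule that[of "L * C"])
    show "L * C \<ge> 0" using L C by simp
    fix x y :: "'k \<Rightarrow> real"
    show "\<bar>conv k x - conv k y\<bar> \<le> L * C * (\<Sum>i\<in>I. \<bar>x i - y i\<bar>)"
      unfolding conv_diff
    proof (rule abs_integral_prod_kernel_le)
      fix z assume z: "z \<in> space Leb"
      have "\<bar>f (\<lambda>i\<in>I. z i + x i) - f (\<lambda>i\<in>I. z i + y i)\<bar> \<le> L * (\<Sum>i\<in>I. \<bar>x i - y i\<bar>)"
        using f_lip[OF translate_in_space translate_in_space, of "\<lambda>i. z i + x i" "\<lambda>i. z i + y i"]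
            by simp
      from mult_mono[OF this C(2)[of "\<lambda>_. 0" z]]
      show "\<bar>(f (\<lambda>i\<in>I. z i + x i) - f (\<lambda>i\<in>I. z i + y i)) * prod_kernel k (\<lambda>_. 0) z\<bar>
         \<le> L * C * (\<Sum>i\<in>I. \<bar>x i - y i\<bar>) * kern0 (\<lambda>_. 0) z"
        using L by (simp add: abs_mult sum_nonneg mult_ac)
    qed measurable
  qed
qed

text \<open>
  The kernel with parameter \<open>a\<close> has first absolute moment of order \<open>1 / a\<close>.
\<close>

lemma conv_0_close:
  assumes x: "x \<in> space Leb"
  shows "\<bar>conv0 x - f x\<bar> \<le> L * (card I * ((\<integral>s. \<bar>s\<bar> * lkernel 1 0 s \<partial>lborel) / a))"
proof -
  let ?p = "kern0 (\<lambda>_. 0)"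
  define c where "c = (\<integral>s. \<bar>s\<bar> * lkernel 1 0 s \<partial>lborel) / a"
  have one: "integrable Leb (\<lambda>z. \<bar>z i\<bar> * ?p z)" "(\<integral>z. \<bar>z i\<bar> * ?p z \<partial>Leb) = c" if i: "i \<in> I" for i
  proof -
    define g where "g j s = (if j = i then \<bar>s\<bar> * lkernel a 0 s else lkernel a 0 s)" for j :: 'k and s
    have eq: "(\<lambda>z. \<bar>z i\<bar> * ?p z) = (\<lambda>z. \<Prod>j\<in>I. g j (z j))"
      unfolding prod_kernel_def prod.remove[OF fin i] g_def by (simp add: fun_eq_iff mult.assoc)
    have ig: "integrable lborel (g j)" for j
      using kernel_first_moment(2)[OF a] kernel_integrable[OF a, of 0] unfolding g_def
          by (cases "j = i") auto
    have "integral\<^sup>L lborel (g j) = (if j = i then c else 1)" for j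
      using kernel_first_moment(3)[OF a] kernel_integral(2)[OF a] unfolding g_def c_def
          by (cases "j = i") auto
    then have "(\<Prod>j\<in>I. integral\<^sup>L lborel (g j)) = c" using i fin by (simp add: prod.delta)
    then show "integrable Leb (\<lambda>z. \<bar>z i\<bar> * ?p z)" "(\<integral>z. \<bar>z i\<bar> * ?p z \<partial>Leb) = c"
      unfolding eq using product_integrable_prod[OF fin ig] product_integral_prod[OF fin ig] by auto
  qed
  have ip: "integrable Leb (\<lambda>z. f x * ?p z)" using integrable_prod_kernel by simp
  have iS: "integrable Leb (\<lambda>z. L * (\<Sum>i\<in>I. \<bar>z i\<bar> * ?p z))" using one by auto
  define d where "d z = f (\<lambda>i\<in>I. z i + x i) * ?p z - f x * ?p z" for z
  have id: "integrable Leb d"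
    unfolding d_def by (rule Bochner_Integration.integrable_diff[OF integrable_translated ip])
  have "conv0 x - f x = (\<integral>z. d z \<partial>Leb)"
    using integrable_translated[of x "\<lambda>_. 0"] ip unfolding conv_translated d_def by
        (simp add: integral_prod_kernel_0)
  also have "\<bar>\<dots>\<bar> \<le> (\<integral>z. \<bar>d z\<bar> \<partial>Leb)" by (rule integral_abs_bound)
  also have "\<dots> \<le> (\<integral>z. L * (\<Sum>i\<in>I. \<bar>z i\<bar> * ?p z) \<partial>Leb)"
  proof (rule integral_mono[OF integrable_abs[OF id] iS])
    fix z assume z: "z \<in> space Leb"
    have p: "0 \<le> ?p z" by (rule less_imp_le[OF prod_kernel_0_pos])
    have "\<bar>f (\<lambda>i\<in>I. z i + x i) - f x\<bar> \<le> L * (\<Sum>i\<in>I. \<bar>z i\<bar>)"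
      using f_lip[OF translate_in_space x, of "\<lambda>i. z i + x i"] by simp
    then have "\<bar>f (\<lambda>i\<in>I. z i + x i) - f x\<bar> * \<bar>?p z\<bar> \<le> L * (\<Sum>i\<in>I. \<bar>z i\<bar>) * ?p z"
      unfolding abs_of_nonneg[OF p] using p by (rule mult_right_mono)
    then show "\<bar>d z\<bar> \<le> L * (\<Sum>i\<in>I. \<bar>z i\<bar> * ?p z)"
      unfolding d_def left_diff_distrib[symmetric] abs_mult sum_distrib_right[symmetric] mult.assoc .
  qed
  also have "\<dots> = L * (card I * c)" using one by simp
  finally show ?thesis unfolding c_def .
qed

text \<open>
  Differentiability in the direction \<open>v\<close>, moving one coordinate at a time: each move is governed by
  \<open>conv_taylor\<close> at the point reached so far, and the partial derivatives are Lipschitz, so they may be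
  evaluated at \<open>x\<close> instead.
\<close>

lemma conv_directional:
  assumes J: "J \<subseteq> I"
  shows "\<exists>C\<ge>0. \<exists>\<delta>>0. \<forall>h. \<bar>h\<bar> \<le> \<delta> \<longrightarrow>
    \<bar>conv0 (\<lambda>i. if i \<in> J then x i + h * v i else x i) - conv0 x
       - h * (\<Sum>j\<in>J. v j * dconv j x)\<bar> \<le> C * h\<^sup>2"
  using finite_subset[OF J fin] J
proof (induction J rule: finite_induct)
  case empty
  then show ?case by (intro exI[of _ 0] exI[of _ 1] conjI) (auto intro: exI[of _ 1])
next
  case (insert j J)
  have "J \<subseteq> I" using insert.prems by simp
  from insert.IH[OF this] obtain C \<delta> where C: "C \<ge> 0" "\<delta> > 0" "\<And>h. \<bar>h\<bar> \<le> \<delta> \<Longrightarrow>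
    \<bar>conv0 (\<lambda>i. if i \<in> J then x i + h * v i else x i) - conv0 x
       - h * (\<Sum>j\<in>J. v j * dconv j x)\<bar> \<le> C * h\<^sup>2" by blast
  have j: "j \<in> I" using insert by auto
  obtain D where D: "D > 0"
    "\<And>x h. \<bar>h\<bar> \<le> 1 \<Longrightarrow> \<bar>conv0 (x(j := x j + h)) - conv0 x - h * conv ((\<lambda>_. 0)(j := Suc 0)) x\<bar> \<le> D * h\<^sup>2"
    using conv_taylor[OF j, of "\<lambda>_. 0"] by auto
  obtain E where E: "E \<ge> 0" "\<And>x y. \<bar>dconv j x - dconv j y\<bar> \<le> E * (\<Sum>i\<in>I. \<bar>x i - y i\<bar>)"
    using conv_lipschitz by blast
  define V where "V = (\<Sum>i\<in>I. \<bar>v i\<bar>)"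
  have V: "0 \<le> V" by (simp add: V_def sum_nonneg)
  let ?C = "C + D * (v j)\<^sup>2 + \<bar>v j\<bar> * (E * V)"
  let ?\<delta> = "min \<delta> (1 / (1 + \<bar>v j\<bar>))"
  have main: "\<bar>conv0 (\<lambda>i. if i \<in> insert j J then x i + h * v i else x i) - conv0 x
       - h * (\<Sum>j\<in>insert j J. v j * dconv j x)\<bar> \<le> ?C * h\<^sup>2" if h: "\<bar>h\<bar> \<le> ?\<delta>" for h
  proof -
    define y where "y i = (if i \<in> J then x i + h * v i else x i)" for i
    have eq: "(\<lambda>i. if i \<in> insert j J then x i + h * v i else x i) = y(j := y j + h * v j)"
      using insert by (auto simp: y_def)
    have "\<bar>h\<bar> * \<bar>v j\<bar> \<le> 1 / (1 + \<bar>v j\<bar>) * \<bar>v j\<bar>" using h by (intro mult_right_mono) auto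
    also have "\<dots> \<le> 1" by (simp add: field_simps)
    finally have "\<bar>h * v j\<bar> \<le> 1" by (simp add: abs_mult)
    from D(2)[OF this, of y]
    have 1: "\<bar>conv0 (y(j := y j + h * v j)) - conv0 y - h * v j * dconv j y\<bar> \<le> D * (v j)\<^sup>2 * h\<^sup>2"
      by (simp add: power_mult_distrib mult_ac)
    have hh: "h\<^sup>2 = \<bar>h\<bar> * \<bar>h\<bar>" by (simp add: power2_eq_square)
    have 2: "\<bar>conv0 y - conv0 x - h * (\<Sum>j\<in>J. v j * dconv j x)\<bar> \<le> C * h\<^sup>2"
      using C(3)[of h] h unfolding y_def by simp
    have "(\<Sum>i\<in>I. \<bar>y i - x i\<bar>) \<le> (\<Sum>i\<in>I. \<bar>h\<bar> * \<bar>v i\<bar>)"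
      by (intro sum_mono) (auto simp: y_def abs_mult)
    also have "\<dots> = \<bar>h\<bar> * V" by (simp add: V_def sum_distrib_left)
    finally have "E * (\<Sum>i\<in>I. \<bar>y i - x i\<bar>) \<le> E * (\<bar>h\<bar> * V)" using E(1) by (rule mult_left_mono)
    then have "\<bar>dconv j y - dconv j x\<bar> \<le> E * (\<bar>h\<bar> * V)" using E(2)[of y x] by linarith
    then have "\<bar>h * v j\<bar> * \<bar>dconv j y - dconv j x\<bar> \<le> \<bar>h * v j\<bar> * (E * (\<bar>h\<bar> * V))"
      by (rule mult_left_mono) auto
    also have "\<bar>h * v j\<bar> * (E * (\<bar>h\<bar> * V)) = \<bar>v j\<bar> * (E * V) * h\<^sup>2" unfolding hh abs_mult by
        (simp only: mult_ac)
    finally have 3: "\<bar>h * v j * dconv j y - h * v j * dconv j x\<bar> \<le> \<bar>v j\<bar> * (E * V) * h\<^sup>2"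
      by (simp add: abs_mult[symmetric] right_diff_distrib)
    have "h * (\<Sum>j\<in>insert j J. v j * dconv j x) = h * v j * dconv j x + h * (\<Sum>j\<in>J. v j * dconv j x)"
      using insert by (simp add: algebra_simps)
    then show ?thesis unfolding eq distrib_right using 1 2 3 by linarith
  qed
  show ?case
  proof (intro exI conjI allI impI)
    show "?C \<ge> 0" using C D E V by auto
    show "?\<delta> > 0" using C by (auto intro: divide_pos_pos add_pos_nonneg)
  qed (rule main)
qed

text \<open>
  The form in which Lipschitz conditions enter: a bound on the increments in the direction \<open>v\<close> bounds
  the pairing of the gradient with \<open>v\<close>.
\<close>

lemma conv_gradient_le:
  assumes N: "\<And>h. h > 0 \<Longrightarrow> conv0 (\<lambda>i. x i + h * v i) - conv0 x \<le> h * N"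
  shows "(\<Sum>j\<in>I. v j * dconv j x) \<le> N"
proof -
  define S where "S = (\<Sum>j\<in>I. v j * dconv j x)"
  obtain C \<delta> where C: "C \<ge> 0" "\<delta> > 0" "\<And>h. \<bar>h\<bar> \<le> \<delta> \<Longrightarrow>
    \<bar>conv0 (\<lambda>i. if i \<in> I then x i + h * v i else x i) - conv0 x - h * S\<bar> \<le> C * h\<^sup>2"
    using conv_directional[of I x v] unfolding S_def by auto
  have restr: "conv0 (\<lambda>i. if i \<in> I then x i + h * v i else x i) = conv0 (\<lambda>i. x i + h * v i)" for h
    unfolding conv_def prod_kernel_def by (simp cong: prod.cong)
  have le: "S \<le> N + C * h" if "0 < h" "h \<le> \<delta>" for h
  proof -
    have "h * S \<le> h * N + C * h\<^sup>2" using C(3)[of h] N[of h] that unfolding restr by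
        (simp add: abs_le_iff)
    then have "h * S \<le> h * (N + C * h)" by (simp add: power2_eq_square algebra_simps)
    then show ?thesis using that by simp
  qed
  have "S \<le> N"
  proof (rule field_le_epsilon)
    fix e :: real assume e: "e > 0"
    define h where "h = min \<delta> (e / (C + 1))"
    have h: "0 < h" "h \<le> \<delta>" "h \<le> e / (C + 1)" using C e by (auto simp: h_def)
    have "C * h \<le> (C + 1) * (e / (C + 1))" using h C by (intro mult_mono) auto
    also have "\<dots> = e" using C by simp
    finally show "S \<le> N + e" using le[OF h(1,2)] by linarith
  qed
  then show ?thesis unfolding S_def .
qed

end

section \<open>Herbst's argument and the passage to unbounded functions\<close>

lemma exp_second_order_bound:
  assumes "\<bar>u\<bar> \<le> (1::real)"
  shows "\<bar>exp u - 1 - u\<bar> \<le> u\<^sup>2"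
proof -
  have "exp u \<le> 1 + u + u\<^sup>2"
  proof (cases "u \<ge> 0")
    case True
    then show ?thesis using exp_bound[of u] assms by auto
  next
    case False
    define v where "v = - u"
    have v: "0 \<le> v" "v \<le> 1" using False assms by (auto simp: v_def)
    have "(1 - v + v\<^sup>2) * (1 + v + v\<^sup>2 / 2) = 1 + (v\<^sup>2 + v ^ 3 + v ^ 4) / 2"
      by (simp add: field_simps power2_eq_square power3_eq_cube power4_eq_xxxx)
    then have "1 \<le> (1 - v + v\<^sup>2) * (1 + v + v\<^sup>2 / 2)" using v by simp
    also have "\<dots> \<le> (1 - v + v\<^sup>2) * exp v"
      using v exp_lower_Taylor_quadratic[of v] by (intro mult_left_mono) auto
    finally have "exp (- v) \<le> 1 - v + v\<^sup>2" by (simp add: exp_minus divide_simps inverse_eq_divide)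
    then show ?thesis by (simp add: v_def)
  qed
  then show ?thesis using exp_ge_add_one_self[of u] zero_le_power2[of u] unfolding abs_le_iff
      by linarith
qed

lemma (in prob_space) DERIV_mgf:
  fixes f :: "'a \<Rightarrow> real"
  assumes [measurable]: "f \<in> borel_measurable M" and f: "\<And>x. x \<in> space M \<Longrightarrow> \<bar>f x\<bar> \<le> B"
  shows "((\<lambda>l. \<integral>x. exp (l * f x) \<partial>M) has_real_derivative (\<integral>x. f x * exp (l * f x) \<partial>M)) (at l)"
proof -
  have B: "0 \<le> B" using f not_empty by fastforce
  define c where "c = exp (\<bar>l\<bar> * B) * B\<^sup>2"
  have bd: "exp (s * f x) \<le> exp (\<bar>s\<bar> * B)" if "x \<in> space M" for s x
    using f[OF that] abs_ge_self[of "s * f x"] mult_left_mono[OF f[OF that], of "\<bar>s\<bar>"] by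
        (simp add: abs_mult)
  have i1: "integrable M (\<lambda>x. exp (s * f x))" for s
    by (rule integrable_bounded[of _ "exp (\<bar>s\<bar> * B)"]) (use bd in auto)
  have i2: "integrable M (\<lambda>x. f x * exp (s * f x))" for s
  proof (rule integrable_bounded[of _ "B * exp (\<bar>s\<bar> * B)"])
    show "\<bar>f x * exp (s * f x)\<bar> \<le> B * exp (\<bar>s\<bar> * B)" if "x \<in> space M" for x
      using mult_mono[OF f[OF that] bd[OF that, of s]] B by (simp add: abs_mult)
  qed measurable
  let ?d = "\<integral>x. f x * exp (l * f x) \<partial>M"
  have est: "\<bar>(\<integral>x. exp ((l + h) * f x) \<partial>M) - (\<integral>x. exp (l * f x) \<partial>M) - h * ?d\<bar> \<le> c * h\<^sup>2" if h:
      "\<bar>h\<bar> * (B + 1) \<le> 1" for h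
  proof -
    define w where "w x = exp ((l + h) * f x) - exp (l * f x) - h * (f x * exp (l * f x))" for x
    have iw: "integrable M w"
      unfolding w_def by (rule Bochner_Integration.integrable_diff[OF
          Bochner_Integration.integrable_diff[OF i1 i1] integrable_mult_right[OF i2]])
    have "(\<integral>x. exp ((l + h) * f x) \<partial>M) - (\<integral>x. exp (l * f x) \<partial>M) - h * ?d = (\<integral>x. w x \<partial>M)"
      unfolding w_def using i1 i2 by simp
    also have "\<bar>\<dots>\<bar> \<le> (\<integral>x. \<bar>w x\<bar> \<partial>M)" by (rule integral_abs_bound)
    also have "\<dots> \<le> (\<integral>x. c * h\<^sup>2 \<partial>M)"
    proof (rule integral_mono[OF integrable_abs[OF iw]])
      fix x assume x: "x \<in> space M"
      have "\<bar>h * f x\<bar> \<le> \<bar>h\<bar> * (B + 1)" unfolding abs_mult using f[OF x] by (intro mult_left_mono) auto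
      then have 1: "\<bar>h * f x\<bar> \<le> 1" using h by linarith
      have "w x = exp (l * f x) * (exp (h * f x) - 1 - h * f x)"
        by (simp add: w_def exp_add algebra_simps)
      then have "\<bar>w x\<bar> = exp (l * f x) * \<bar>exp (h * f x) - 1 - h * f x\<bar>" by (simp add: abs_mult)
      also have "\<dots> \<le> exp (\<bar>l\<bar> * B) * (h * f x)\<^sup>2"
        using bd[OF x] exp_second_order_bound[OF 1] by (intro mult_mono) auto
      also have "\<dots> = exp (\<bar>l\<bar> * B) * (h\<^sup>2 * (f x)\<^sup>2)" by (simp add: power_mult_distrib)
      also have "\<dots> \<le> exp (\<bar>l\<bar> * B) * (h\<^sup>2 * B\<^sup>2)"
        using power_mono[OF f[OF x], of 2] by (intro mult_left_mono) auto
      finally show "\<bar>w x\<bar> \<le> c * h\<^sup>2"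
        by (simp add: c_def mult_ac)
    qed auto
    finally show ?thesis by (simp add: prob_space)
  qed
  have "((\<lambda>h. ((\<integral>x. exp ((l + h) * f x) \<partial>M) - (\<integral>x. exp (l * f x) \<partial>M)) / h - ?d) \<longlongrightarrow> 0) (at 0)"
  proof (rule Lim_null_comparison)
    show "((\<lambda>h. c * \<bar>h\<bar>) \<longlongrightarrow> 0) (at 0)" by (auto intro!: tendsto_eq_intros)
    have "\<forall>\<^sub>F h in at (0::real). h \<noteq> 0 \<and> \<bar>h\<bar> * (B + 1) \<le> 1"
      unfolding eventually_at using B by (intro exI[of _ "1 / (B + 1)"]) (auto simp: field_simps)
    then show "\<forall>\<^sub>F h in at 0. norm (((\<integral>x. exp ((l + h) * f x) \<partial>M) - (\<integral>x. exp (l * f x) \<partial>M)) / h - ?d)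
        \<le> c * \<bar>h\<bar>"
    proof eventually_elim
      case (elim h)
      have "((\<integral>x. exp ((l + h) * f x) \<partial>M) - (\<integral>x. exp (l * f x) \<partial>M)) / h - ?d
        = ((\<integral>x. exp ((l + h) * f x) \<partial>M) - (\<integral>x. exp (l * f x) \<partial>M) - h * ?d) / h"
        using elim by (simp add: field_simps)
      also have "\<bar>\<dots>\<bar> \<le> c * h\<^sup>2 / \<bar>h\<bar>"
        unfolding abs_divide using est[of h] elim by (intro divide_right_mono) auto
      also have "\<dots> = c * \<bar>h\<bar>" using elim by (cases "h \<ge> 0") (auto simp: power2_eq_square)
      finally show ?case by simp
    qed
  qed
  then show ?thesis unfolding DERIV_def by (rule LIM_zero_cancel)
qed

text \<open>
  The derivative of \<open>ln (\<integral> exp (l f)) / l\<close> is the entropy of \<open>exp (l f)\<close> divided by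
  \<open>l\<^sup>2 \<integral> exp (l f)\<close>, hence at most \<open>\<alpha> + \<beta> l powr (q - 2)\<close>.  Integrate from \<open>0\<close>, where the quotient
  tends to \<open>\<integral> f\<close>; as \<open>q - 1 \<ge> 1\<close>, the function \<open>u\<close> below is nonincreasing.
\<close>

lemma (in prob_space) herbst:
  fixes f :: "'a \<Rightarrow> real"
  assumes f_meas[measurable]: "f \<in> borel_measurable M" and f: "\<And>x. x \<in> space M \<Longrightarrow> \<bar>f x\<bar> \<le> B"
    and \<alpha>: "0 \<le> \<alpha>" and \<beta>: "0 \<le> \<beta>" and q: "2 \<le> q"
    and ent: "\<And>l. l > 0 \<Longrightarrow> entropy_of M (\<lambda>x. exp (l * f x))
        \<le> (\<alpha> * l\<^sup>2 + \<beta> * l powr q) * (\<integral>x. exp (l * f x) \<partial>M)"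
    and l: "l > 0"
  shows "(\<integral>x. exp (l * (f x - (\<integral>y. f y \<partial>M))) \<partial>M) \<le> exp (\<alpha> * l\<^sup>2 + \<beta> * l powr q)"
proof -
  define m where "m = (\<integral>y. f y \<partial>M)"
  define H where "H s = (\<integral>x. exp (s * f x) \<partial>M)" for s
  define H' where "H' s = (\<integral>x. f x * exp (s * f x) \<partial>M)" for s
  have dH: "(H has_real_derivative H' s) (at s)" for s
    unfolding H_def[abs_def] H'_def by (rule DERIV_mgf[OF f_meas f])
  have H0: "H 0 = 1" "H' 0 = m" by (simp_all add: H_def H'_def m_def prob_space)
  have Hpos: "H s > 0" for s
  proof -
    have "exp (- (\<bar>s\<bar> * B)) \<le> exp (s * f x)" "exp (s * f x) \<le> exp (\<bar>s\<bar> * B)" if "x \<in> space M" for x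
      using mult_left_mono[OF f[OF that], of "\<bar>s\<bar>"] abs_ge_self[of "s * f x"] abs_ge_minus_self[of
          "s * f x"] by (auto simp: abs_mult)
    then have "exp (- (\<bar>s\<bar> * B)) \<le> H s" unfolding H_def
      using expectation_bounds[of "\<lambda>x. exp (s * f x)" "exp (- (\<bar>s\<bar> * B))" "exp (\<bar>s\<bar> * B)"] by auto
    then show ?thesis by (rule less_le_trans[OF exp_gt_zero])
  qed
  have ent_eq: "entropy_of M (\<lambda>x. exp (s * f x)) = s * H' s - H s * ln (H s)" for s
  proof -
    have "(\<integral>x. exp (s * f x) * ln (exp (s * f x)) \<partial>M) = (\<integral>x. s * (f x * exp (s * f x)) \<partial>M)"
      by (intro Bochner_Integration.integral_cong) auto
    then show ?thesis unfolding entropy_of_def H'_def H_def by simp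
  qed
  define u where "u s = ln (H s) / s - \<alpha> * s - \<beta> * s powr (q - 1)" for s
  define u' where "u' s = (H' s / H s * s - ln (H s)) / (s * s) - \<alpha> - \<beta> * ((q - 1) * s powr (q
      - 2))" for s
  have du: "(u has_real_derivative u' s) (at s)" if "s > 0" for s
  proof -
    define K where "K s = ln (H s)" for s
    have "(K has_real_derivative H' s / H s) (at s)"
      unfolding K_def[abs_def] using DERIV_chain2[OF DERIV_ln_divide[OF Hpos] dH] by simp
    then show ?thesis unfolding u_def[abs_def] u'_def K_def[symmetric]
      using that by (auto intro!: derivative_eq_intros)
  qed
  have u'_le: "u' s \<le> 0" if s: "s > 0" for s
  proof -
    have "s * H' s - H s * ln (H s) \<le> (\<alpha> * s\<^sup>2 + \<beta> * s powr q) * H s"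
      using ent[OF s] unfolding ent_eq H_def by simp
    then have "(s * H' s - H s * ln (H s)) / H s \<le> \<alpha> * s\<^sup>2 + \<beta> * s powr q"
      using Hpos[of s] by (simp add: divide_le_eq)
    moreover have "(s * H' s - H s * ln (H s)) / H s = H' s / H s * s - ln (H s)"
      using Hpos[of s] by (simp add: field_simps)
    ultimately have "H' s / H s * s - ln (H s) \<le> \<alpha> * s\<^sup>2 + \<beta> * s powr q" by simp
    then have "(H' s / H s * s - ln (H s)) / (s * s) \<le> (\<alpha> * s\<^sup>2 + \<beta> * s powr q) / (s * s)"
      using s by (intro divide_right_mono) auto
    also have "\<dots> = \<alpha> + \<beta> * s powr (q - 2)"
    proof -
      have "s powr q = s powr (q - 2) * s powr 2" using s by
          (simp add: powr_add[symmetric] del: powr_numeral)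
      then have "s powr q = s powr (q - 2) * (s * s)" using s by (simp add: power2_eq_square)
      then show ?thesis using s by (simp add: field_simps power2_eq_square)
    qed
    finally have "u' s \<le> \<beta> * s powr (q - 2) - \<beta> * ((q - 1) * s powr (q - 2))" unfolding u'_def by simp
    also have "\<dots> = - (\<beta> * ((q - 2) * s powr (q - 2)))" by (simp add: algebra_simps)
    also have "\<dots> \<le> 0" using \<beta> q by simp
    finally show ?thesis .
  qed
  have mono: "u l \<le> u s" if "0 < s" "s \<le> l" for s
    by (rule DERIV_nonpos_imp_nonincreasing[OF that(2)]) (use du u'_le that in \<open>meson less_le_trans\<close>)
  have lnH0: "((\<lambda>s. ln (H s)) has_real_derivative m) (at 0)"
    using DERIV_chain2[OF DERIV_ln_divide[OF Hpos] dH, of 0] H0 by simp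
  have "((\<lambda>s. ln (H s) / s) \<longlongrightarrow> m) (at 0)"
    using lnH0 H0 unfolding DERIV_def by simp
  then have "((\<lambda>s. ln (H s) / s) \<longlongrightarrow> m) (at_right 0)" by (rule tendsto_within_subset) simp
  moreover have "((\<lambda>s::real. s powr (q - 1)) \<longlongrightarrow> 0) (at_right 0)"
  proof -
    have "((\<lambda>s::real. s powr (q - 1)) \<longlongrightarrow> 0 powr (q - 1)) (at_right 0)"
      using q by (intro tendsto_powr') (auto intro!: tendsto_eq_intros eventually_at_right_less simp:
          eventually_at_filter)
    then show ?thesis by simp
  qed
  moreover have "((\<lambda>s::real. s) \<longlongrightarrow> 0) (at_right 0)" by (rule tendsto_ident_at)
  ultimately have "(u \<longlongrightarrow> m - \<alpha> * 0 - \<beta> * 0) (at_right 0)"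
    unfolding u_def[abs_def] by (intro tendsto_intros)
  then have lim: "(u \<longlongrightarrow> m) (at_right 0)" by simp
  have "\<forall>\<^sub>F s in at_right 0. u l \<le> u s"
    unfolding eventually_at_right_field using l mono by (intro exI[of _ l]) auto
  then have "u l \<le> m" by (rule tendsto_lowerbound[OF lim]) simp
  then have "ln (H l) / l \<le> m + \<alpha> * l + \<beta> * l powr (q - 1)" unfolding u_def by simp
  then have "ln (H l) \<le> (m + \<alpha> * l + \<beta> * l powr (q - 1)) * l" using l by (simp add: divide_le_eq)
  also have "\<dots> = l * m + (\<alpha> * l\<^sup>2 + \<beta> * l powr q)"
  proof -
    have "l powr q = l powr (q - 1) * l powr 1" using l by (simp only: powr_add[symmetric]) simp
    then show ?thesis using l by (simp add: algebra_simps power2_eq_square)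
  qed
  finally have "H l \<le> exp (l * m + (\<alpha> * l\<^sup>2 + \<beta> * l powr q))" using Hpos[of l]
      by (metis exp_le_cancel_iff exp_ln)
  then have "H l \<le> exp (l * m) * exp (\<alpha> * l\<^sup>2 + \<beta> * l powr q)" by (simp add: exp_add)
  moreover have "(\<integral>x. exp (l * (f x - m)) \<partial>M) = H l / exp (l * m)"
    unfolding H_def right_diff_distrib exp_diff by simp
  ultimately show ?thesis unfolding m_def[symmetric] by (simp add: divide_le_eq mult.commute)
qed

lemma (in prob_space) fatou_bound:
  fixes g :: "nat \<Rightarrow> 'a \<Rightarrow> real"
  assumes lim: "\<And>x. x \<in> space M \<Longrightarrow> (\<lambda>m. g m x) \<longlonglongrightarrow> h x" and g: "\<And>m. integrable M (g m)"
    "\<And>m x. x \<in> space M \<Longrightarrow> 0 \<le> g m x" "\<And>m. (\<integral>x. g m x \<partial>M) \<le> R" and [measurable]: "h \<in> borel_measurable M"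
  shows "integrable M h \<and> (\<integral>x. h x \<partial>M) \<le> R"
proof -
  have h0: "0 \<le> h x" if "x \<in> space M" for x
    using lim[OF that] g(2)[OF that] by (intro LIMSEQ_le_const) auto
  have "0 \<le> (\<integral>x. g 0 x \<partial>M)" by (rule Bochner_Integration.integral_nonneg) (rule g(2))
  then have R: "0 \<le> R" using g(3)[of 0] by linarith
  have [measurable]: "g m \<in> borel_measurable M" for m using g(1) by auto
  have "(\<integral>\<^sup>+x. ennreal (h x) \<partial>M) = (\<integral>\<^sup>+x. liminf (\<lambda>m. ennreal (g m x)) \<partial>M)"
    using lim by (intro nn_integral_cong) (auto intro!: lim_imp_Liminf[symmetric] tendsto_ennrealI)
  also have "\<dots> \<le> liminf (\<lambda>m. \<integral>\<^sup>+x. ennreal (g m x) \<partial>M)" by (rule nn_integral_liminf) auto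
  also have "\<dots> \<le> ennreal R"
  proof -
    have "(\<integral>\<^sup>+x. ennreal (g m x) \<partial>M) \<le> ennreal R" for m
      using g(1)[of m] g(2,3) by (subst nn_integral_eq_integral) (auto intro!: ennreal_leI)
    then show ?thesis by (intro Liminf_le) auto
  qed
  finally have le: "(\<integral>\<^sup>+x. ennreal (h x) \<partial>M) \<le> ennreal R" .
  have i: "integrable M h"
    by (rule integrableI_nonneg) (use h0 le in \<open>auto intro: le_less_trans\<close>)
  have "ennreal (\<integral>x. h x \<partial>M) \<le> ennreal R"
    using le nn_integral_eq_integral[OF i] h0 by simp
  then show ?thesis using i R by simp
qed

definition truncate :: "nat \<Rightarrow> real \<Rightarrow> real" where
  "truncate m s = max (- real m) (min (real m) s)"

lemma truncate_bounds: "\<bar>truncate m s\<bar> \<le> real m" "\<bar>truncate m s\<bar> \<le> \<bar>s\<bar>"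
  and truncate_lipschitz: "\<bar>truncate m s - truncate m t\<bar> \<le> \<bar>s - t\<bar>"
  by (auto simp: truncate_def max_def min_def abs_if)

lemma truncate_tendsto: "(\<lambda>m. truncate m s) \<longlonglongrightarrow> s"
proof (rule tendsto_eventually)
  show "\<forall>\<^sub>F m in sequentially. truncate m s = s"
    using eventually_ge_at_top[of "nat \<lceil>\<bar>s\<bar>\<rceil>"]
    by eventually_elim (auto simp: truncate_def max_def min_def; linarith)
qed

text \<open>
  The means of the truncations are bounded: on the set \<open>\<bar>f\<bar> \<le> k\<close>, which has probability above one half
  for some \<open>k\<close>, a large mean would make one of the transforms at \<open>s = 1\<close> and \<open>s = -1\<close> exceed its bound.
  Fatou's lemma then gives the integrability of \<open>f\<close>, and after that the bound itself.
\<close>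

lemma (in prob_space) mgf_bound_of_truncations:
  fixes f :: "'a \<Rightarrow> real" and R :: "real \<Rightarrow> real"
  assumes f[measurable]: "f \<in> borel_measurable M"
    and R: "\<And>m s. (\<integral>x. exp (s * (truncate m (f x) - (\<integral>y. truncate m (f y) \<partial>M))) \<partial>M) \<le> R s"
  shows "integrable M f" "integrable M (\<lambda>x. exp (s * (f x - (\<integral>y. f y \<partial>M))))"
    "(\<integral>x. exp (s * (f x - (\<integral>y. f y \<partial>M))) \<partial>M) \<le> R s"
proof -
  have [measurable]: "(\<lambda>x. truncate m (f x)) \<in> borel_measurable M" for m unfolding truncate_def
      by measurable
  define c where "c m = (\<integral>y. truncate m (f y) \<partial>M)" for m
  have it: "integrable M (\<lambda>x. truncate m (f x))" for m
    by (rule integrable_bounded[of _ "real m"]) (auto intro: truncate_bounds)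
  have ie: "integrable M (\<lambda>x. exp (s * (truncate m (f x) - t)))" for m s t
  proof (rule integrable_bounded[of _ "exp (\<bar>s\<bar> * (real m + \<bar>t\<bar>))"])
    fix x
    have "\<bar>truncate m (f x) - t\<bar> \<le> real m + \<bar>t\<bar>" using truncate_bounds(1)[of m "f x"] by linarith
    from mult_left_mono[OF this, of "\<bar>s\<bar>"] have "\<bar>s * (truncate m (f x) - t)\<bar> \<le> \<bar>s\<bar> * (real m + \<bar>t\<bar>)" by
        (simp add: abs_mult)
    then show "\<bar>exp (s * (truncate m (f x) - t))\<bar> \<le> exp (\<bar>s\<bar> * (real m + \<bar>t\<bar>))" by simp
  qed auto
  have R': "(\<integral>x. exp (s * (truncate m (f x) - c m)) \<partial>M) \<le> R s" for m s using R unfolding c_def .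
  have "(\<lambda>k. measure M {x \<in> space M. \<bar>f x\<bar> \<le> real k}) \<longlonglongrightarrow> measure M (\<Union>k. {x \<in> space M. \<bar>f x\<bar> \<le> real k})"
    by (rule finite_Lim_measure_incseq) (auto simp: incseq_def)
  also have "(\<Union>k. {x \<in> space M. \<bar>f x\<bar> \<le> real k}) = space M" by (auto intro: real_arch_simple)
  finally have "\<forall>\<^sub>F k in sequentially. measure M {x \<in> space M. \<bar>f x\<bar> \<le> real k} > 1/2"
    unfolding prob_space by (rule order_tendstoD) simp
  then obtain k where k: "measure M {x \<in> space M. \<bar>f x\<bar> \<le> real k} > 1/2"
    by (meson eventually_happens trivial_limit_sequentially)
  let ?A = "{x \<in> space M. \<bar>f x\<bar> \<le> real k}"
  have A[measurable]: "?A \<in> sets M" by measurable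
  have half: "exp t / 2 \<le> R s" if t: "\<And>x. x \<in> ?A \<Longrightarrow>
      t \<le> s * (truncate m (f x) - c m)" for s t and m :: nat
  proof -
    have "exp t * (1 / 2) \<le> exp t * measure M ?A" using k by (intro mult_left_mono) auto
    also have "\<dots> = (\<integral>x. exp t * indicator ?A x \<partial>M)" by simp
    also have "\<dots> \<le> (\<integral>x. exp (s * (truncate m (f x) - c m)) \<partial>M)"
    proof (rule integral_mono[OF _ ie])
      show "integrable M (\<lambda>x. exp t * indicator ?A x)"
        by (intro integrable_mult_right integrable_real_indicator A) (simp add: emeasure_eq_measure)
      show "exp t * indicator ?A x \<le> exp (s * (truncate m (f x) - c m))" for x
        using t[of x] by (auto simp: indicator_def)
    qed
    finally show ?thesis using R'[of s m] by simp
  qed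
  have trA: "\<bar>truncate m (f x)\<bar> \<le> real k" if "x \<in> ?A" for x m
    using truncate_bounds(2)[of m "f x"] that by auto
  have c_le: "exp (c m - real k) / 2 \<le> R (-1)" "exp (- c m - real k) / 2 \<le> R 1" for m
  proof -
    have "c m - real k \<le> (-1) * (truncate m (f x) - c m)" "- c m - real k
        \<le> 1 * (truncate m (f x) - c m)" if "x \<in> ?A" for x
      using trA[OF that, of m] by (auto simp: abs_le_iff)
    then show "exp (c m - real k) / 2 \<le> R (-1)" "exp (- c m - real k) / 2 \<le> R 1"
      by (blast intro: half)+
  qed
  define e where "e = 2 * exp (real k) * (R 1 + R (-1))"
  have Rpos: "0 \<le> R s" for s
  proof -
    have "0 \<le> (\<integral>x. exp (s * (truncate 0 (f x) - c 0)) \<partial>M)"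
        by (rule Bochner_Integration.integral_nonneg) simp
    then show ?thesis using R'[of s 0] by linarith
  qed
  have ec: "exp (c m) \<le> e" "exp (- c m) \<le> e" for m
  proof -
    have "exp (c m) \<le> 2 * exp (real k) * R (-1)" "exp (- c m) \<le> 2 * exp (real k) * R 1"
      using c_le[of m] by (auto simp: exp_diff field_simps)
    then show "exp (c m) \<le> e" "exp (- c m) \<le> e"
      using Rpos[of 1] Rpos[of "-1"] by (auto simp: e_def distrib_left intro: order_trans)
  qed
  have int_f: "integrable M (\<lambda>x. \<bar>f x\<bar>) \<and> (\<integral>x. \<bar>f x\<bar> \<partial>M) \<le> e * R 1 + e * R (-1)"
  proof (rule fatou_bound[of "\<lambda>m x. \<bar>truncate m (f x)\<bar>"])
    show "(\<lambda>m. \<bar>truncate m (f x)\<bar>) \<longlonglongrightarrow> \<bar>f x\<bar>" for x by (intro tendsto_rabs truncate_tendsto)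
    fix m
    show "integrable M (\<lambda>x. \<bar>truncate m (f x)\<bar>)" by (rule integrable_abs[OF it])
    have "(\<integral>x. \<bar>truncate m (f x)\<bar> \<partial>M) \<le> (\<integral>x. exp (c m) * exp (1 * (truncate m (f x) - c m))
        + exp (- c m) * exp ((-1) * (truncate m (f x) - c m)) \<partial>M)"
    proof (rule integral_mono[OF integrable_abs[OF it]])
      show "integrable M (\<lambda>x. exp (c m) * exp (1 * (truncate m (f x) - c m))
          + exp (- c m) * exp ((-1) * (truncate m (f x) - c m)))"
        by (intro Bochner_Integration.integrable_add integrable_mult_right ie)
      fix x
      have "\<bar>v\<bar> \<le> exp v + exp (- v)" for v :: real
        using exp_ge_add_one_self[of v] exp_ge_add_one_self[of "- v"] exp_gt_zero[of v] exp_gt_zero[of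
            "- v"] by linarith
      then show "\<bar>truncate m (f x)\<bar> \<le> exp (c m) * exp (1 * (truncate m (f x) - c m))
          + exp (- c m) * exp ((-1) * (truncate m (f x) - c m))"
        by (simp add: exp_add[symmetric])
    qed
    also have "\<dots> = exp (c m) * (\<integral>x. exp (1 * (truncate m (f x) - c m)) \<partial>M)
        + exp (- c m) * (\<integral>x. exp ((-1) * (truncate m (f x) - c m)) \<partial>M)"
      by (subst Bochner_Integration.integral_add) (intro integrable_mult_right ie, intro
          integrable_mult_right ie, simp)
    also have "\<dots> \<le> e * R 1 + e * R (-1)"
      by (intro add_mono mult_mono ec R' order_trans[OF _ ec(1)])
          (auto intro!: Bochner_Integration.integral_nonneg)
    finally show "(\<integral>x. \<bar>truncate m (f x)\<bar> \<partial>M) \<le> e * R 1 + e * R (-1)" .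
  qed auto
  then show int: "integrable M f" by (simp add: integrable_abs_iff)
  have c_lim: "c \<longlonglongrightarrow> (\<integral>y. f y \<partial>M)"
    unfolding c_def[abs_def]
    by (rule integral_dominated_convergence[where w="\<lambda>x. \<bar>f x\<bar>"])
      (use int_f truncate_bounds(2) truncate_tendsto in auto)
  have "integrable M (\<lambda>x. exp (s * (f x - (\<integral>y. f y \<partial>M)))) \<and> (\<integral>x. exp (s * (f x - (\<integral>y. f y \<partial>M))) \<partial>M)
      \<le> R s"
  proof (rule fatou_bound[of "\<lambda>m x. exp (s * (truncate m (f x) - c m))"])
    show "(\<lambda>m. exp (s * (truncate m (f x) - c m))) \<longlonglongrightarrow> exp (s * (f x - (\<integral>y. f y \<partial>M)))" for x
      by (intro tendsto_intros truncate_tendsto c_lim)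
  qed (use ie R' in auto)
  then show "integrable M (\<lambda>x. exp (s * (f x - (\<integral>y. f y \<partial>M))))"
    "(\<integral>x. exp (s * (f x - (\<integral>y. f y \<partial>M))) \<partial>M) \<le> R s" by auto
qed

section \<open>Bounded Lipschitz functions of independent blocks\<close>

lemma lipschitz_l1_imp_continuous_on:
  fixes h :: "('k \<Rightarrow> real) \<Rightarrow> real"
  assumes "\<And>u v. u \<in> S \<Longrightarrow> v \<in> S \<Longrightarrow> \<bar>h u - h v\<bar> \<le> L * (\<Sum>i\<in>I. \<bar>u i - v i\<bar>)"
  shows "continuous_on S h"
  unfolding continuous_on_def
proof
  fix x assume x: "x \<in> S"
  have co: "((\<lambda>y. y i) \<longlongrightarrow> x i) (at x within S)" for i
    using continuous_on_subset[OF continuous_on_product_coordinates[of i] subset_UNIV, of S] x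
    unfolding continuous_on_def by blast
  have "((\<lambda>y. h y - h x) \<longlongrightarrow> 0) (at x within S)"
  proof (rule Lim_null_comparison)
    have "\<forall>\<^sub>F y in at x within S. y \<in> S" by (simp add: eventually_at_filter)
    then show "\<forall>\<^sub>F y in at x within S. norm (h y - h x) \<le> L * (\<Sum>i\<in>I. \<bar>y i - x i\<bar>)"
      by eventually_elim (use assms x in auto)
    have "((\<lambda>y. L * (\<Sum>i\<in>I. \<bar>y i - x i\<bar>)) \<longlongrightarrow> L * (\<Sum>i\<in>I. \<bar>x i - x i\<bar>)) (at x within S)"
      by (intro tendsto_intros co)
    then show "((\<lambda>y. L * (\<Sum>i\<in>I. \<bar>y i - x i\<bar>)) \<longlongrightarrow> 0) (at x within S)" by simp
  qed
  then show "(h \<longlongrightarrow> h x) (at x within S)" by (rule LIM_zero_cancel)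
qed

locale product_lipschitz =
  fixes d n :: nat and \<mu> :: "(nat \<Rightarrow> real) measure" and r K0 L2 Lr B :: real
    and f :: "(nat \<Rightarrow> nat \<Rightarrow> real) \<Rightarrow> real"
  assumes r: "1 < r" "r < 2" and prob: "prob_space \<mu>" and sets_mu: "sets \<mu> = sets (Rdim d)"
    and LO: "latala_oleszkiewicz d \<mu> r K0" and L2: "0 \<le> L2" and Lr: "0 \<le> Lr"
    and f_bound: "\<And>x. x \<in> space (power_measure n (Rdim d)) \<Longrightarrow> \<bar>f x\<bar> \<le> B"
    and f_L2: "\<And>x y. x \<in> space (power_measure n (Rdim d)) \<Longrightarrow> y \<in> space (power_measure n (Rdim d)) \<Longrightarrow>
       \<bar>f x - f y\<bar> \<le> L2 * euclid_norm d n (\<lambda>i j. x i j - y i j)"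
    and f_Lr: "\<And>x y. x \<in> space (power_measure n (Rdim d)) \<Longrightarrow> y \<in> space (power_measure n (Rdim d)) \<Longrightarrow>
       \<bar>f x - f y\<bar> \<le> Lr * mixed_norm d n r (\<lambda>i j. x i j - y i j)"
begin

definition I :: "(nat \<times> nat) set" where "I = {..<n} \<times> {..<d}"

text \<open>
  The smoothing acts on the \<open>n * d\<close> real coordinates of a point, so blocks are unfolded to functions on
  pairs of indices.
\<close>

definition flat :: "(nat \<Rightarrow> nat \<Rightarrow> real) \<Rightarrow> nat \<times> nat \<Rightarrow> real" where
  "flat x = (\<lambda>p\<in>I. x (fst p) (snd p))"

definition unflat :: "(nat \<times> nat \<Rightarrow> real) \<Rightarrow> nat \<Rightarrow> nat \<Rightarrow> real" where
  "unflat u = (\<lambda>i\<in>{..<n}. \<lambda>j\<in>{..<d}. u (i, j))"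

definition b :: real where "b = 2 * (1 - 1 / r)"
definition q :: real where "q = r / (r - 1)"

lemma b_bounds: "0 < b" "b < 1"
  and q_eq: "q = 2 / b" "(q - 1) * r = q"
  and q_bounds: "q > 2" "2 \<le> q"
proof -
  show "0 < b" using r by (simp add: b_def field_simps)
  have "1 / 2 < 1 / r" using r by (intro divide_strict_left_mono) auto
  then show "b < 1" by (simp add: b_def)
  show "q = 2 / b" using r by (simp add: b_def q_def field_simps)
  show "q > 2" "2 \<le> q" using r by (simp_all add: q_def field_simps)
  show "(q - 1) * r = q" using r by (simp add: q_def field_simps)
qed

lemma space_mu: "space \<mu> = space (Rdim d)"
  by (rule sets_eq_imp_space_eq[OF sets_mu])

lemma power_measure_mu: "space (power_measure n \<mu>) = space (power_measure n (Rdim d))"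
  "sets (power_measure n \<mu>) = sets (power_measure n (Rdim d))"
  unfolding power_measure_def by (auto simp: space_PiM space_mu intro!: sets_PiM_cong sets_mu)

lemma finite_I: "finite I" by (simp add: I_def)

lemma unflat_in_space: "unflat u \<in> space (power_measure n (Rdim d))"
  by (auto simp: unflat_def power_measure_def Rdim_def space_PiM)

lemma unflat_flat: "x \<in> space (power_measure n (Rdim d)) \<Longrightarrow> unflat (flat x) = x"
  by (auto simp: unflat_def flat_def power_measure_def Rdim_def space_PiM PiE_iff extensional_def I_def
      fun_eq_iff)

lemma flat_in_space: "flat x \<in> space (PiM I (\<lambda>_. lborel :: real measure))"
  by (simp add: flat_def space_PiM)

definition fI :: "(nat \<times> nat \<Rightarrow> real) \<Rightarrow> real" where "fI u = f (unflat u)"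

lemma fI_L2: "\<bar>fI u - fI v\<bar> \<le> L2 * L2_set (\<lambda>p. u p - v p) I"
proof -
  have "L2_set (\<lambda>(i, j). unflat u i j - unflat v i j) I = L2_set (\<lambda>p. u p - v p) I"
    by (rule L2_set_cong) (auto simp: unflat_def I_def)
  then show ?thesis using f_L2[OF unflat_in_space unflat_in_space, of u v]
    by (simp add: fI_def euclid_norm_def I_def)
qed

lemma fI_Lr: "\<bar>fI u - fI v\<bar> \<le> Lr * (\<Sum>i<n. L2_set (\<lambda>j. u (i, j) - v (i, j)) {..<d} powr r) powr (1 / r)"
proof -
  have "(\<Sum>i<n. L2_set (\<lambda>j. unflat u i j - unflat v i j) {..<d} powr r)
      = (\<Sum>i<n. L2_set (\<lambda>j. u (i, j) - v (i, j)) {..<d} powr r)"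
    by (intro sum.cong arg_cong2[where f="(powr)"] refl L2_set_cong) (auto simp: unflat_def)
  then show ?thesis using f_Lr[OF unflat_in_space unflat_in_space, of u v]
    by (simp add: fI_def mixed_norm_def)
qed

lemma fI_l1: "\<bar>fI u - fI v\<bar> \<le> L2 * (\<Sum>p\<in>I. \<bar>u p - v p\<bar>)"
proof -
  have "L2_set (\<lambda>p. u p - v p) I \<le> (\<Sum>p\<in>I. \<bar>u p - v p\<bar>)" by (rule L2_set_le_sum_abs)
  then show ?thesis using fI_L2[of u v] L2 by (meson mult_left_mono order_trans)
qed

lemma fI_measurable: "fI \<in> borel_measurable (PiM I (\<lambda>_. borel :: real measure))"
  by (rule continuous_on_imp_measurable_PiM, rule lipschitz_l1_imp_continuous_on[of _ _ L2 I]) (rule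
      fI_l1)

lemma flat_measurable[measurable]: "flat \<in> measurable (power_measure n \<mu>) (PiM I (\<lambda>_. borel :: real
    measure))"
  unfolding flat_def
proof (rule measurable_restrict)
  fix p assume p: "p \<in> I"
  have 1: "(\<lambda>x. x (fst p)) \<in> measurable (power_measure n \<mu>) \<mu>"
    unfolding power_measure_def using p by (intro measurable_component_singleton) (auto simp: I_def)
  have "(\<lambda>y. y (snd p)) \<in> borel_measurable (Rdim d)"
    unfolding Rdim_def using p by (intro measurable_component_singleton) (auto simp: I_def)
  then have 2: "(\<lambda>y. y (snd p)) \<in> borel_measurable \<mu>" using measurable_cong_sets[OF sets_mu refl]
      by blast
  show "(\<lambda>x. x (fst p) (snd p)) \<in> borel_measurable (power_measure n \<mu>)"
    using measurable_compose[OF 1 2] .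
qed

lemma f_measurable: "f \<in> borel_measurable (power_measure n \<mu>)"
proof -
  have "(\<lambda>x. fI (flat x)) \<in> borel_measurable (power_measure n \<mu>)"
    by (rule measurable_compose[OF flat_measurable fI_measurable])
  moreover have "fI (flat x) = f x" if "x \<in> space (power_measure n \<mu>)" for x
    using unflat_flat that by (simp add: fI_def power_measure_mu)
  ultimately show ?thesis by (simp cong: measurable_cong)
qed

lemma prob_power: "prob_space (power_measure n \<mu>)"
  unfolding power_measure_def by (intro prob_space_PiM prob)

lemma flat_update:
  assumes "i < n" "j < d"
  shows "flat (x(i := y(j := s))) = (flat (x(i := y)))((i, j) := s)"
  using assms by (auto simp: flat_def I_def fun_eq_iff)

end

locale product_smoothing = product_lipschitz +
  fixes a :: real
  assumes a_pos: "0 < a"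

sublocale product_smoothing \<subseteq> S: smoothing I fI B L2 a
proof
  show "finite I" by (rule finite_I)
  show "a > 0" "0 \<le> L2" by (rule a_pos L2)+
  show "fI \<in> borel_measurable (PiM I (\<lambda>_. lborel))"
    using fI_measurable by (subst measurable_cong_sets[OF sets_PiM_cong refl]) auto
  show "\<bar>fI z\<bar> \<le> B" for z unfolding fI_def by (rule f_bound[OF unflat_in_space])
  show "\<bar>fI u - fI v\<bar> \<le> L2 * (\<Sum>i\<in>I. \<bar>u i - v i\<bar>)" for u v by (rule fI_l1)
qed

context product_smoothing
begin

abbreviation P :: "(nat \<Rightarrow> nat \<Rightarrow> real) measure" where "P \<equiv> power_measure n \<mu>"

definition F :: "(nat \<Rightarrow> nat \<Rightarrow> real) \<Rightarrow> real" where "F x = S.conv0 (flat x)"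
definition PD :: "nat \<Rightarrow> nat \<Rightarrow> (nat \<Rightarrow> nat \<Rightarrow> real) \<Rightarrow> real" where
  "PD i j x = S.dconv (i, j) (flat x)"

lemma conv_flat_measurable: "(\<lambda>x. S.conv k (flat x)) \<in> borel_measurable P"
proof -
  obtain C where "\<And>x y. \<bar>S.conv k x - S.conv k y\<bar> \<le> C * (\<Sum>i\<in>I. \<bar>x i - y i\<bar>)"
    using S.conv_lipschitz[of k] by blast
  then have "S.conv k \<in> borel_measurable (PiM I (\<lambda>_. borel))"
    by (intro continuous_on_imp_measurable_PiM lipschitz_l1_imp_continuous_on)
  from measurable_compose[OF flat_measurable this] show ?thesis .
qed

text \<open>
  Partial derivatives within a block only raise the order of the kernel; the function stays of the same
  form.
\<close>

lemma partial_deriv_block: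
  assumes i: "i < n" and j: "j < d"
  shows "partial_deriv j (\<lambda>y. S.conv k (flat (x(i := y))))
      = (\<lambda>y. S.conv (k((i, j) := Suc (k (i, j)))) (flat (x(i := y))))"
    and "(\<lambda>s. S.conv k (flat (x(i := y(j := s))))) field_differentiable at (y j)"
proof -
  have ij: "(i, j) \<in> I" using i j by (auto simp: I_def)
  have D: "((\<lambda>s. S.conv k (flat (x(i := y(j := s))))) has_real_derivative S.conv (k((i, j) := Suc (k (i,
      j)))) (flat (x(i := y)))) (at (y j))" for y
  proof -
    have "(flat (x(i := y)))((i, j) := y j) = flat (x(i := y))"
      using flat_update[OF i j, of x y "y j"] by simp
    then show ?thesis
      using S.DERIV_conv[OF ij, of k "flat (x(i := y))" "y j"] unfolding flat_update[OF i j] by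
          (simp only:)
  qed
  show "partial_deriv j (\<lambda>y. S.conv k (flat (x(i := y))))
      = (\<lambda>y. S.conv (k((i, j) := Suc (k (i, j)))) (flat (x(i := y))))"
    unfolding partial_deriv_def by (rule ext) (rule DERIV_imp_deriv[OF D])
  show "(\<lambda>s. S.conv k (flat (x(i := y(j := s))))) field_differentiable at (y j)"
    using D unfolding field_differentiable_def by blast
qed

lemma smooth_block:
  assumes i: "i < n"
  shows "smooth d (\<lambda>y. S.conv k (flat (x(i := y))))"
  unfolding smooth_def
proof (intro allI impI)
  fix js assume js: "set js \<subseteq> {..<d}"
  have "\<exists>k'. foldr partial_deriv js (\<lambda>y. S.conv k (flat (x(i := y))))
      = (\<lambda>y. S.conv k' (flat (x(i := y))))"
    using js
  proof (induction js)
    case (Cons j js)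
    from Cons.prems have "set js \<subseteq> {..<d}" by simp
    from Cons.IH[OF this] obtain k' where ih: "foldr partial_deriv js (\<lambda>y. S.conv k (flat (x(i := y))))
        = (\<lambda>y. S.conv k' (flat (x(i := y))))" by blast
    have "j < d" using Cons.prems by simp
    have "foldr partial_deriv (j # js) (\<lambda>y. S.conv k (flat (x(i := y))))
        = partial_deriv j (\<lambda>y. S.conv k' (flat (x(i := y))))"
      by (simp only: foldr.simps o_apply ih)
    also note partial_deriv_block(1)[OF i \<open>j < d\<close>]
    finally show ?case by (rule exI[of _ "k'((i, j) := Suc (k' (i, j)))"])
  qed auto
  then obtain k' where k': "foldr partial_deriv js (\<lambda>y. S.conv k (flat (x(i := y))))
      = (\<lambda>y. S.conv k' (flat (x(i := y))))" by blast
  obtain C where C: "C \<ge> 0" "\<And>x y. \<bar>S.conv k' x - S.conv k' y\<bar> \<le> C * (\<Sum>i\<in>I. \<bar>x i - y i\<bar>)"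
    using S.conv_lipschitz[of k'] by blast
  have "continuous_on (space (Rdim d)) (\<lambda>y. S.conv k' (flat (x(i := y))))"
  proof (rule lipschitz_l1_imp_continuous_on)
    fix u v :: "nat \<Rightarrow> real"
    have "(\<Sum>p\<in>I. \<bar>flat (x(i := u)) p - flat (x(i := v)) p\<bar>)
        = (\<Sum>p\<in>{i} \<times> {..<d}. \<bar>flat (x(i := u)) p - flat (x(i := v)) p\<bar>)"
      using i by (intro sum.mono_neutral_right finite_I) (auto simp: I_def flat_def)
    also have "\<dots> = (\<Sum>j<d. \<bar>flat (x(i := u)) (i, j) - flat (x(i := v)) (i, j)\<bar>)"
      by (rule sum.reindex_bij_witness[of _ "Pair i" snd]) auto
    also have "\<dots> = (\<Sum>j<d. \<bar>u j - v j\<bar>)" using i by (intro sum.cong) (auto simp: flat_def I_def)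
    finally show "\<bar>S.conv k' (flat (x(i := u))) - S.conv k' (flat (x(i := v)))\<bar>
        \<le> C * (\<Sum>j<d. \<bar>u j - v j\<bar>)"
      using C(2)[of "flat (x(i := u))" "flat (x(i := v))"] by simp
  qed
  then show "continuous_on (space (Rdim d)) (foldr partial_deriv js (\<lambda>y. S.conv k (flat (x(i := y))))) \<and>
    (\<forall>j<d. \<forall>y\<in>space (Rdim d). (\<lambda>s. foldr partial_deriv js (\<lambda>y. S.conv k (flat (x(i := y)))) (y(j := s)))
        field_differentiable at (y j))"
    unfolding k' using partial_deriv_block(2)[OF i] by auto
qed

text \<open>
  \<open>N\<close> stands for the norm of \<open>v\<close> in which \<open>f\<close> is Lipschitz, times the Lipschitz constant.
\<close>

lemma gradient_pairing_le:
  assumes N: "\<And>u w h. 0 < h \<Longrightarrow> (\<And>p. p \<in> I \<Longrightarrow> u p - w p = h * v p) \<Longrightarrow> \<bar>fI u - fI w\<bar> \<le> h * N"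
  shows "(\<Sum>i<n. \<Sum>j<d. v (i, j) * PD i j x) \<le> N"
proof -
  have "(\<Sum>p\<in>I. v p * S.dconv p (flat x)) \<le> N"
  proof (rule S.conv_gradient_le)
    fix h :: real assume h: "h > 0"
    have "\<bar>S.conv0 (\<lambda>p. flat x p + h * v p) - S.conv0 (flat x)\<bar> \<le> h * N"
      by (intro S.conv_0_diff_le N h) simp
    then show "S.conv0 (\<lambda>p. flat x p + h * v p) - S.conv0 (flat x) \<le> h * N" by simp
  qed
  then show ?thesis by (simp add: I_def PD_def sum.cartesian_product split_beta')
qed

definition grad2 :: "nat \<Rightarrow> (nat \<Rightarrow> nat \<Rightarrow> real) \<Rightarrow> real" where
  "grad2 i x = (\<Sum>j<d. (PD i j x)\<^sup>2)"

lemma grad2_nonneg: "0 \<le> grad2 i x" by (simp add: grad2_def sum_nonneg)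

text \<open>
  Duality with the gradient itself as direction.
\<close>

lemma sum_grad2_le: "(\<Sum>i<n. grad2 i x) \<le> L2\<^sup>2"
proof -
  define T where "T = (\<Sum>i<n. grad2 i x)"
  have T: "0 \<le> T" by (simp add: T_def sum_nonneg grad2_nonneg)
  define v where "v p = PD (fst p) (snd p) x" for p
  have sT: "L2_set v I = sqrt T"
    by (simp add: L2_set_def I_def T_def grad2_def v_def sum.cartesian_product split_beta')
  have "(\<Sum>i<n. \<Sum>j<d. v (i, j) * PD i j x) \<le> L2 * sqrt T"
  proof (rule gradient_pairing_le)
    fix u w :: "nat \<times> nat \<Rightarrow> real" and h :: real assume h: "0 < h" "\<And>p. p \<in> I \<Longrightarrow> u p - w p = h * v p"
    have "L2_set (\<lambda>p. u p - w p) I = L2_set (\<lambda>p. h * v p) I" by (rule L2_set_cong) (use h in auto)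
    also have "\<dots> = h * L2_set v I" using h by (simp add: L2_set_right_distrib)
    finally show "\<bar>fI u - fI w\<bar> \<le> h * (L2 * sqrt T)" using fI_L2[of u w] by (simp add: sT mult_ac)
  qed
  then have "T \<le> L2 * sqrt T" by (simp add: T_def grad2_def v_def power2_eq_square)
  then have "sqrt T * sqrt T \<le> L2 * sqrt T" using T by simp
  then have "sqrt T \<le> L2" if "T \<noteq> 0" using T that
      by (intro mult_right_le_imp_le[of "sqrt T" "sqrt T" L2]) auto
  then have "sqrt T \<le> L2" using L2 by (cases "T = 0") auto
  then have "(sqrt T)\<^sup>2 \<le> L2\<^sup>2" using T by (intro power_mono) auto
  then show ?thesis using T by (simp add: T_def)
qed

text \<open>
  Duality between the exponents \<open>r\<close> and \<open>q\<close>.  The direction with blocks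
  \<open>|\<nabla>\<^sub>i| powr (q - 2) * \<nabla>\<^sub>i\<close> is extremal: its pairing with the gradient is the sum \<open>T\<close> of all
  \<open>|\<nabla>\<^sub>i| powr q\<close>, and its mixed norm is \<open>T powr (1 / r)\<close>.
\<close>

lemma sum_grad_powr_le: "(\<Sum>i<n. sqrt (grad2 i x) powr q) \<le> Lr powr q"
proof -
  define s where "s i = sqrt (grad2 i x)" for i
  have s: "0 \<le> s i" for i by (simp add: s_def grad2_nonneg)
  define T where "T = (\<Sum>i<n. s i powr q)"
  have T: "0 \<le> T" by (simp add: T_def sum_nonneg)
  define v where "v p = s (fst p) powr (q - 2) * PD (fst p) (snd p) x" for p
  have sq: "s i powr (q - 2) * (s i)\<^sup>2 = s i powr q" "s i powr (q - 2) * s i = s i powr (q - 1)" for i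
  proof -
    have "s i powr (q - 2) * s i powr 2 = s i powr q" "s i powr (q - 2) * s i powr 1 = s i powr (q - 1)"
      by (simp_all only: powr_add[symmetric]) simp_all
    then show "s i powr (q - 2) * (s i)\<^sup>2 = s i powr q" "s i powr (q - 2) * s i = s i powr (q - 1)"
      using s[of i] by (simp_all only: powr_numeral powr_one)
  qed
  have L2v: "L2_set (\<lambda>j. v (i, j)) {..<d} = s i powr (q - 1)" for i
  proof -
    have "L2_set (\<lambda>j. v (i, j)) {..<d} = s i powr (q - 2) * L2_set (\<lambda>j. PD i j x) {..<d}"
      unfolding v_def fst_conv snd_conv by (rule L2_set_right_distrib[symmetric]) simp
    also have "L2_set (\<lambda>j. PD i j x) {..<d} = s i" by (simp add: L2_set_def s_def grad2_def)
    finally show ?thesis by (simp add: sq)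
  qed
  have "(\<Sum>i<n. \<Sum>j<d. v (i, j) * PD i j x) \<le> Lr * T powr (1 / r)"
  proof (rule gradient_pairing_le)
    fix u w :: "nat \<times> nat \<Rightarrow> real" and h :: real assume h: "0 < h" "\<And>p. p \<in> I \<Longrightarrow> u p - w p = h * v p"
    have "L2_set (\<lambda>j. u (i, j) - w (i, j)) {..<d} powr r = h powr r * s i powr q" if "i < n" for i
    proof -
      have "L2_set (\<lambda>j. u (i, j) - w (i, j)) {..<d} = L2_set (\<lambda>j. h * v (i, j)) {..<d}"
        by (rule L2_set_cong) (use h that in \<open>auto simp: I_def\<close>)
      also have "\<dots> = h * s i powr (q - 1)" using h by (simp add: L2_set_right_distrib[symmetric] L2v)
      finally show ?thesis using h q_eq by (simp add: powr_mult powr_powr)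
    qed
    then have "(\<Sum>i<n. L2_set (\<lambda>j. u (i, j) - w (i, j)) {..<d} powr r) = h powr r * T"
      by (simp add: T_def sum_distrib_left)
    then have "(\<Sum>i<n. L2_set (\<lambda>j. u (i, j) - w (i, j)) {..<d} powr r) powr (1 / r) = h * T powr (1 / r)"
      using h T r by (simp add: powr_mult powr_powr)
    then show "\<bar>fI u - fI w\<bar> \<le> h * (Lr * T powr (1 / r))" using fI_Lr[of u w] by (simp add: mult_ac)
  qed
  also have "(\<Sum>i<n. \<Sum>j<d. v (i, j) * PD i j x) = T"
  proof -
    have "(\<Sum>j<d. v (i, j) * PD i j x) = s i powr q" for i
    proof -
      have "(\<Sum>j<d. v (i, j) * PD i j x) = s i powr (q - 2) * grad2 i x"
        by (simp add: v_def grad2_def sum_distrib_left power2_eq_square mult.assoc)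
      also have "grad2 i x = (s i)\<^sup>2" using grad2_nonneg by (simp add: s_def)
      finally show ?thesis by (simp add: sq)
    qed
    then show ?thesis by (simp add: T_def)
  qed
  finally have le: "T \<le> Lr * T powr (1 / r)" .
  have "T \<le> Lr powr q"
  proof (cases "T = 0")
    case False
    then have Tp: "T > 0" using T by simp
    have "T = T powr (1 / q) * T powr (1 / r)"
    proof -
      have "1 / q + 1 / r = 1" using r by (simp add: q_def field_simps)
      then show ?thesis using Tp by (simp add: powr_add[symmetric])
    qed
    then have "T powr (1 / q) * T powr (1 / r) \<le> Lr * T powr (1 / r)" using le by simp
    then have "T powr (1 / q) \<le> Lr" using Tp by simp
    then have "(T powr (1 / q)) powr q \<le> Lr powr q" using q_bounds by (intro powr_mono2) auto
    then show ?thesis using Tp q_bounds by (simp add: powr_powr)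
  qed simp
  then show ?thesis by (simp add: T_def s_def)
qed

lemma grad2_le: "i < n \<Longrightarrow> grad2 i x \<le> L2\<^sup>2"
  using member_le_sum[of i "{..<n}" "\<lambda>i. grad2 i x"] sum_grad2_le[of x] grad2_nonneg by fastforce

lemma F_bound: "\<bar>F x\<bar> \<le> B"
  unfolding F_def by (rule S.conv_0_bounded)

lemma F_close:
  assumes "x \<in> space P"
  shows "\<bar>F x - f x\<bar> \<le> L2 * (card I * ((\<integral>s. \<bar>s\<bar> * lkernel 1 0 s \<partial>lborel) / a))"
  using S.conv_0_close[OF flat_in_space, of x] assms
  by (simp add: F_def fI_def unflat_flat power_measure_mu)

lemma F_measurable[measurable]: "F \<in> borel_measurable P"
  unfolding F_def[abs_def] by (rule conv_flat_measurable)

lemma grad2_measurable[measurable]: "grad2 i \<in> borel_measurable P"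
  unfolding grad2_def[abs_def] PD_def by (intro borel_measurable_sum borel_measurable_power
      conv_flat_measurable)

lemma block_measurable:
  assumes i: "i < n"
  shows "(\<lambda>y. S.conv k (flat (x(i := y)))) \<in> borel_measurable \<mu>"
  using grad_norm_measurable(1)[OF smooth_block[OF i]] measurable_cong_sets[OF sets_mu refl] by blast

lemma grad_norm_block:
  assumes i: "i < n" and y: "y \<in> space (Rdim d)"
  shows "(grad_norm d (\<lambda>y. l * F (x(i := y))) y)\<^sup>2 = l\<^sup>2 * grad2 i (x(i := y))"
proof -
  have "(grad_norm d (\<lambda>y. l * F (x(i := y))) y)\<^sup>2 = l\<^sup>2 * (grad_norm d (\<lambda>y. F (x(i := y))) y)\<^sup>2"
    by (rule grad_norm_chain_rule[where P="\<lambda>s. l * s" and P'="\<lambda>_. l", OF _ y])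
      (auto simp: F_def intro!: smooth_block i derivative_eq_intros)
  also have "(grad_norm d (\<lambda>y. F (x(i := y))) y)\<^sup>2 = grad2 i (x(i := y))"
    unfolding grad_norm_sq grad2_def
  proof (rule sum.cong[OF refl])
    fix j assume "j \<in> {..<d}"
    then show "(partial_deriv j (\<lambda>y. F (x(i := y))) y)\<^sup>2 = (PD i j (x(i := y)))\<^sup>2"
      unfolding F_def using partial_deriv_block(1)[OF i, of j "\<lambda>_. 0" x] by (simp add: PD_def)
  qed
  finally show ?thesis .
qed

definition A :: real where "A = mls_const b (max 1 K0)"

definition G :: "real \<Rightarrow> nat \<Rightarrow> (nat \<Rightarrow> nat \<Rightarrow> real) \<Rightarrow> real" where
  "G l i x = A * (exp (l * F x) * (l\<^sup>2 * grad2 i x + (l\<^sup>2 * grad2 i x) powr (1 / b)))"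

text \<open>
  The modified logarithmic Sobolev inequality in the block \<open>i\<close>, the other blocks being fixed.
\<close>

lemma block_entropy:
  assumes i: "i < n" and l: "l > 0"
  shows "entropy_of \<mu> (\<lambda>y. exp (l * F (x(i := y)))) \<le> (\<integral>y. G l i (x(i := y)) \<partial>\<mu>)"
proof -
  let ?g = "\<lambda>y. l * F (x(i := y))" and ?D = "\<lambda>y. l\<^sup>2 * grad2 i (x(i := y))"
  have sm: "smooth d ?g" unfolding F_def by (intro smooth_mult smooth_const smooth_block i)
  have Fm: "(\<lambda>y. F (x(i := y))) \<in> borel_measurable \<mu>" unfolding F_def by (rule block_measurable[OF i])
  have B: "0 \<le> B" using F_bound[of undefined] by linarith
  have bb: "l * B \<le> l * B + l\<^sup>2 * L2\<^sup>2" "l\<^sup>2 * L2\<^sup>2 \<le> l * B + l\<^sup>2 * L2\<^sup>2" using l B by auto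
  have gb: "\<bar>?g y\<bar> \<le> l * B + l\<^sup>2 * L2\<^sup>2" for y
  proof -
    have "\<bar>?g y\<bar> = l * \<bar>F (x(i := y))\<bar>" using l by (simp add: abs_mult)
    also have "\<dots> \<le> l * B" using l F_bound by (intro mult_left_mono) auto
    finally show ?thesis using bb(1) by linarith
  qed
  have Db: "?D y \<le> l * B + l\<^sup>2 * L2\<^sup>2" for y
    using mult_left_mono[OF grad2_le[OF i], of "l\<^sup>2" "x(i := y)"] bb(2) by (auto intro: order_trans)
  have gn: "(grad_norm d ?g y)\<^sup>2 = ?D y" if "y \<in> space \<mu>" for y
    using grad_norm_block[OF i] that by (simp add: space_mu)
  interpret C: LO_chain \<mu> ?g ?D "l * B + l\<^sup>2 * L2\<^sup>2" b "max 1 K0"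
  proof (intro LO_chain.intro LO_chain_axioms.intro)
    show "prob_space \<mu>" by (rule prob)
    show "?g \<in> borel_measurable \<mu>" using Fm by measurable
    show "?D \<in> borel_measurable \<mu>" unfolding grad2_def PD_def
      by (intro borel_measurable_times borel_measurable_const borel_measurable_sum
          borel_measurable_power block_measurable i)
    show "0 \<le> max 1 K0" "0 < b" "b < 1" using b_bounds by auto
    show "0 \<le> ?D y" for y using grad2_nonneg by simp
    show "\<bar>?g y\<bar> \<le> l * B + l\<^sup>2 * L2\<^sup>2" "?D y \<le> l * B + l\<^sup>2 * L2\<^sup>2" for y by (rule gb Db)+
    fix \<phi> \<phi>' :: "real \<Rightarrow> real" and \<theta> :: real
    assume *: "\<And>s. (\<phi> has_real_derivative \<phi>' s) (at s)" "continuous_on UNIV \<phi>'" "1 < \<theta>" "\<theta> < 2"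
    have "(\<integral>y. (\<phi> (?g y))\<^sup>2 \<partial>\<mu>) - (\<integral>y. \<bar>\<phi> (?g y)\<bar> powr \<theta> \<partial>\<mu>) powr (2 / \<theta>)
      \<le> max 1 K0 * (2 - \<theta>) powr (2 * (1 - 1 / r)) * (\<integral>y. (\<phi>' (?g y))\<^sup>2 * (grad_norm d ?g y)\<^sup>2 \<partial>\<mu>)"
      by (rule LO_smooth_composition[OF prob sets_mu LO sm gb _ *]) (use gn Db in auto)
    also have "(\<integral>y. (\<phi>' (?g y))\<^sup>2 * (grad_norm d ?g y)\<^sup>2 \<partial>\<mu>) = (\<integral>y. (\<phi>' (?g y))\<^sup>2 * ?D y \<partial>\<mu>)"
      by (intro Bochner_Integration.integral_cong refl) (simp only: gn)
    finally show "(\<integral>y. (\<phi> (?g y))\<^sup>2 \<partial>\<mu>) - (\<integral>y. \<bar>\<phi> (?g y)\<bar> powr \<theta> \<partial>\<mu>) powr (2 / \<theta>)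
      \<le> max 1 K0 * (2 - \<theta>) powr b * (\<integral>y. (\<phi>' (?g y))\<^sup>2 * ?D y \<partial>\<mu>)" by (simp only: b_def)
  qed
  show ?thesis using C.modified_log_sobolev unfolding G_def A_def by simp
qed

lemma A_nonneg: "0 \<le> A"
  using b_bounds unfolding A_def mls_const_def absorb_const_def by
      (auto intro!: add_nonneg_nonneg mult_nonneg_nonneg)

lemma entropy_le:
  assumes l: "l > 0"
  shows "entropy_of P (\<lambda>x. exp (l * F x))
      \<le> (A * L2\<^sup>2 * l\<^sup>2 + A * Lr powr q * l powr q) * (\<integral>x. exp (l * F x) \<partial>P)"
proof -
  interpret P: prob_space P by (rule prob_power)
  have B: "0 \<le> B" using F_bound[of undefined] by linarith
  have lF: "\<bar>l * F x\<bar> \<le> l * B" for x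
    using mult_left_mono[OF F_bound, of l x] l by (auto simp: abs_mult)
  define C where "C = A * (exp (l * B) * (l\<^sup>2 * L2\<^sup>2 + (l\<^sup>2 * L2\<^sup>2) powr (1 / b)))"
  have G0: "0 \<le> G l i x" for i x unfolding G_def using A_nonneg grad2_nonneg by auto
  have GC: "G l i x \<le> C" if "i < n" for i x
    unfolding G_def C_def
    by (intro mult_left_mono[OF mult_mono[OF _ add_mono]] mult_left_mono powr_mono2 grad2_le A_nonneg
        that add_nonneg_nonneg mult_nonneg_nonneg grad2_nonneg)
      (use lF[of x] b_bounds grad2_nonneg in auto)
  have Gm: "G l i \<in> borel_measurable P" for i unfolding G_def[abs_def] by measurable
  have iG: "integrable P (G l i)" if "i < n" for i
    by (rule P.integrable_bounded[OF Gm, of _ C]) (use G0 GC[OF that] in auto)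
  have ieF: "integrable P (\<lambda>x. exp (l * F x))"
    by (rule P.integrable_bounded[of _ "exp (l * B)"]) (use lF in \<open>auto simp: abs_le_iff\<close>)
  have "entropy_of P (\<lambda>x. exp (l * F x)) \<le> (\<Sum>i<n. \<integral>x. G l i x \<partial>P)"
    unfolding power_measure_def
  proof (rule entropy_PiM_le[where c="exp (- (l * B))" and C="max C (exp (l * B))", OF prob, folded
      power_measure_def])
    show "exp (- (l * B)) \<le> exp (l * F x)" "exp (l * F x) \<le> max C (exp (l * B))" for x
      using lF[of x] by (auto simp: abs_le_iff le_max_iff_disj)
    show "\<bar>G l i x\<bar> \<le> max C (exp (l * B))" if "i \<in> {..<n}" for i x
      using G0[of i x] GC[of i x] that by auto
    show "entropy_of \<mu> (\<lambda>y. exp (l * F (x(i := y)))) \<le> (\<integral>y. G l i (x(i := y)) \<partial>\<mu>)" if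
        "i \<in> {..<n}" for i x
      using block_entropy l that by simp
  qed (use Gm in \<open>auto simp: power_measure_def[symmetric]\<close>)
  also have "\<dots> = (\<integral>x. (\<Sum>i<n. G l i x) \<partial>P)"
    using iG by (intro Bochner_Integration.integral_sum[symmetric]) auto
  also have "\<dots> \<le> (\<integral>x. (A * L2\<^sup>2 * l\<^sup>2 + A * Lr powr q * l powr q) * exp (l * F x) \<partial>P)"
  proof (rule integral_mono)
    show "integrable P (\<lambda>x. \<Sum>i<n. G l i x)" using iG by (intro Bochner_Integration.integrable_sum) auto
    show "integrable P (\<lambda>x. (A * L2\<^sup>2 * l\<^sup>2 + A * Lr powr q * l powr q) * exp (l * F x))"
      by (rule integrable_mult_right[OF ieF])
    fix x
    have pw: "(l\<^sup>2 * grad2 i x) powr (1 / b) = l powr q * sqrt (grad2 i x) powr q" for i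
    proof -
      have "l\<^sup>2 * grad2 i x = (l * sqrt (grad2 i x)) powr 2"
        using l grad2_nonneg[of i x] by (simp add: power_mult_distrib)
      then have "(l\<^sup>2 * grad2 i x) powr (1 / b) = ((l * sqrt (grad2 i x)) powr 2) powr (1 / b)" by
          (simp only:)
      also have "\<dots> = (l * sqrt (grad2 i x)) powr q" unfolding powr_powr q_eq(1) by simp
      also have "\<dots> = l powr q * sqrt (grad2 i x) powr q" using l grad2_nonneg[of i x]
          by (intro powr_mult)
      finally show ?thesis .
    qed
    have "(\<Sum>i<n. G l i x) = A * exp (l * F x) * (l\<^sup>2 * (\<Sum>i<n. grad2 i x)
        + l powr q * (\<Sum>i<n. sqrt (grad2 i x) powr q))"
      unfolding G_def pw by (simp only: sum_distrib_left[symmetric] sum.distrib mult.assoc)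
    also have "\<dots> \<le> A * exp (l * F x) * (l\<^sup>2 * L2\<^sup>2 + l powr q * Lr powr q)"
      by (intro mult_left_mono add_mono sum_grad2_le sum_grad_powr_le) (use A_nonneg in auto)
    finally show "(\<Sum>i<n. G l i x) \<le> (A * L2\<^sup>2 * l\<^sup>2 + A * Lr powr q * l powr q) * exp (l * F x)"
      by (simp add: algebra_simps)
  qed
  also have "\<dots> = (A * L2\<^sup>2 * l\<^sup>2 + A * Lr powr q * l powr q) * (\<integral>x. exp (l * F x) \<partial>P)" by simp
  finally show ?thesis .
qed

lemma mgf_smoothed_le:
  assumes l: "l > 0"
  shows "(\<integral>x. exp (l * (F x - (\<integral>y. F y \<partial>P))) \<partial>P) \<le> exp (A * L2\<^sup>2 * l\<^sup>2 + A * Lr powr q * l powr q)"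
  by (rule prob_space.herbst[OF prob_power F_measurable F_bound _ _ q_bounds(2) entropy_le l]) (use
      A_nonneg in auto)

end

context product_lipschitz
begin

text \<open>
  The smoothed functions converge uniformly to \<open>f\<close> as the parameter \<open>a\<close> of the kernel grows.
\<close>

lemma mgf_le:
  assumes l: "l > 0"
  defines "A \<equiv> mls_const b (max 1 K0)"
  shows "(\<integral>x. exp (l * (f x - (\<integral>y. f y \<partial>power_measure n \<mu>))) \<partial>power_measure n \<mu>)
      \<le> exp (A * L2\<^sup>2 * l\<^sup>2 + A * Lr powr q * l powr q)"
proof -
  let ?P = "power_measure n \<mu>"
  interpret P: prob_space ?P by (rule prob_power)
  define c where "c = L2 * (card I * (\<integral>s. \<bar>s\<bar> * lkernel 1 0 s \<partial>lborel))"
  define F where "F m = product_smoothing.F d n f (real (Suc m))" for m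
  have sm: "product_smoothing d n \<mu> r K0 L2 Lr B f (real (Suc m))" for m
    by (intro product_smoothing.intro product_smoothing_axioms.intro product_lipschitz_axioms) simp
  have Fm[measurable]: "F m \<in> borel_measurable ?P" for m
    unfolding F_def by (rule product_smoothing.F_measurable[OF sm])
  have FB: "\<bar>F m x\<bar> \<le> B" for m x
    unfolding F_def by (rule product_smoothing.F_bound[OF sm])
  have Fc: "\<bar>F m x - f x\<bar> \<le> c * inverse (real (Suc m))" if "x \<in> space ?P" for m x
    using product_smoothing.F_close[OF sm that, of m] unfolding F_def c_def by
        (simp add: divide_inverse mult.assoc)
  have lim: "(\<lambda>m. F m x) \<longlonglongrightarrow> f x" if "x \<in> space ?P" for x
  proof (rule LIM_zero_cancel, rule Lim_null_comparison)
    show "\<forall>\<^sub>F m in sequentially. norm (F m x - f x) \<le> c * inverse (real (Suc m))" using Fc[OF that]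
        by auto
    show "(\<lambda>m. c * inverse (real (Suc m))) \<longlonglongrightarrow> 0"
      using tendsto_mult[OF tendsto_const LIMSEQ_inverse_real_of_nat, of c] by simp
  qed
  have limI: "(\<lambda>m. \<integral>x. F m x \<partial>?P) \<longlonglongrightarrow> (\<integral>x. f x \<partial>?P)"
    by (rule integral_dominated_convergence[where w="\<lambda>_. B"]) (use lim FB f_measurable in auto)
  have "integrable ?P (\<lambda>x. exp (l * (f x - (\<integral>y. f y \<partial>?P)))) \<and> (\<integral>x. exp (l * (f x - (\<integral>y. f y \<partial>?P))) \<partial>?P)
      \<le> exp (A * L2\<^sup>2 * l\<^sup>2 + A * Lr powr q * l powr q)"
  proof (rule P.fatou_bound[of "\<lambda>m x. exp (l * (F m x - (\<integral>y. F m y \<partial>?P)))"])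
    show "(\<lambda>m. exp (l * (F m x - (\<integral>y. F m y \<partial>?P)))) \<longlonglongrightarrow> exp (l * (f x - (\<integral>y. f y \<partial>?P)))" if
        "x \<in> space ?P" for x
      by (intro tendsto_intros lim[OF that] limI)
    fix m
    show "integrable ?P (\<lambda>x. exp (l * (F m x - (\<integral>y. F m y \<partial>?P))))"
    proof (rule P.integrable_bounded[of _ "exp (l * (B - (\<integral>y. F m y \<partial>?P)))"])
      show "\<bar>exp (l * (F m x - (\<integral>y. F m y \<partial>?P)))\<bar> \<le> exp (l * (B - (\<integral>y. F m y \<partial>?P)))" for x
        using FB[of m x] l by (simp add: abs_le_iff)
    qed measurable
    show "(\<integral>x. exp (l * (F m x - (\<integral>y. F m y \<partial>?P))) \<partial>?P) \<le> exp (A * L2\<^sup>2 * l\<^sup>2 + A * Lr powr q * l powr q)"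
      using product_smoothing.mgf_smoothed_le[OF sm l]
          unfolding F_def product_smoothing.A_def[OF sm] A_def .
  qed (use f_measurable in auto)
  then show ?thesis ..
qed

end

section \<open>Concentration\<close>

text \<open>
  The two candidates in the minimum defining \<open>l\<close> are the values for which the respective term of the
  exponent equals \<open>l * t / 4\<close>; together the terms use up at most half of \<open>l * t\<close>.  The factor 4 is the origin of
  \<open>C = 4 A\<close>.
\<close>

lemma chernoff_exponent:
  fixes r q A L2 Lr t :: real
  assumes r: "1 < r" and q: "q = r / (r - 1)" and A: "0 < A" and L: "0 < L2" "0 < Lr" and t: "0 < t"
  defines "m \<equiv> min (t\<^sup>2 / (4 * A * L2\<^sup>2)) (t powr r / ((4 * A) powr (r - 1) * Lr powr r))"
  obtains l where "l > 0" "- (l * t) + (A * L2\<^sup>2 * l\<^sup>2 + A * Lr powr q * l powr q) \<le> - (1 / 2) * m"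
proof
  define l1 where "l1 = t / (4 * A * L2\<^sup>2)"
  define w where "w = t / (4 * A * Lr powr q)"
  define l where "l = min l1 (w powr (r - 1))"
  have pos: "l1 > 0" "w > 0" using A L t by (auto simp: l1_def w_def)
  then show l: "l > 0" by (simp add: l_def)
  have "A * L2\<^sup>2 * l\<^sup>2 = l * (A * L2\<^sup>2 * l)" by (simp add: power2_eq_square)
  also have "\<dots> \<le> l * (A * L2\<^sup>2 * l1)" using l A L by (intro mult_left_mono) (auto simp: l_def)
  also have "A * L2\<^sup>2 * l1 = t / 4" using A L by (simp add: l1_def)
  finally have 1: "A * L2\<^sup>2 * l\<^sup>2 \<le> l * t / 4" by simp
  have q1: "(r - 1) * (q - 1) = 1" "q > 1" "q * (r - 1) = r" using r by (auto simp: q field_simps)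
  have "l powr q = l powr 1 * l powr (q - 1)" by (simp only: powr_add[symmetric]) simp
  then have lq: "l powr q = l * l powr (q - 1)" using l by simp
  have "l powr (q - 1) \<le> (w powr (r - 1)) powr (q - 1)" using l q1 by (intro powr_mono2)
      (auto simp: l_def)
  also have "\<dots> = w" using pos q1 by (simp add: powr_powr)
  finally have "A * Lr powr q * l powr q \<le> A * Lr powr q * (l * w)"
    unfolding lq using l A by (intro mult_left_mono) auto
  also have "\<dots> = l * (A * Lr powr q * w)" by simp
  also have "A * Lr powr q * w = t / 4" using A L by (simp add: w_def)
  finally have 2: "A * Lr powr q * l powr q \<le> l * t / 4" by simp
  have "t * w powr (r - 1) = t powr r / ((4 * A) powr (r - 1) * Lr powr r)"
  proof -
    have "w powr (r - 1) = t powr (r - 1) / ((4 * A) powr (r - 1) * Lr powr r)"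
      unfolding w_def using A L t q1 by (simp add: powr_divide powr_mult powr_powr)
    moreover have "t * t powr (r - 1) = t powr r"
    proof -
      have "t powr 1 * t powr (r - 1) = t powr r" by (simp only: powr_add[symmetric]) simp
      then show ?thesis using t by simp
    qed
    ultimately show ?thesis by simp
  qed
  moreover have "t * l1 = t\<^sup>2 / (4 * A * L2\<^sup>2)" by (simp add: l1_def power2_eq_square)
  ultimately have lt: "t * w powr (r - 1) = t powr r / ((4 * A) powr (r - 1) * Lr powr r)" "t * l1
      = t\<^sup>2 / (4 * A * L2\<^sup>2)" by auto
  have "l * t = min (t * l1) (t * w powr (r - 1))" using t by
      (auto simp: l_def min_def mult.commute mult_le_cancel_left)
  then have "l * t = m" unfolding m_def lt .
  then show "- (l * t) + (A * L2\<^sup>2 * l\<^sup>2 + A * Lr powr q * l powr q) \<le> - (1 / 2) * m" using 1 2 by simp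
qed

lemma (in prob_space) chernoff_two_sided:
  fixes f :: "'a \<Rightarrow> real"
  assumes f[measurable]: "f \<in> borel_measurable M" and l: "l > 0"
    and i: "\<And>s. integrable M (\<lambda>x. exp (s * (f x - c)))"
    and le: "(\<integral>x. exp (l * (f x - c)) \<partial>M) \<le> exp R" "(\<integral>x. exp (- l * (f x - c)) \<partial>M) \<le> exp R"
  shows "measure M {x \<in> space M. \<bar>f x - c\<bar> \<ge> t} \<le> 2 * exp (- (l * t) + R)"
proof -
  have one: "measure M {x \<in> space M. exp (s * (f x - c)) \<ge> exp (l * t)} \<le> exp (- (l * t) + R)"
    if "(\<integral>x. exp (s * (f x - c)) \<partial>M) \<le> exp R" for s
  proof -
    have "measure M {x \<in> space M. exp (s * (f x - c)) \<ge> exp (l * t)}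
        \<le> (\<integral>x. exp (s * (f x - c)) \<partial>M) / exp (l * t)"
      by (rule integral_Markov_inequality_measure[OF i, where A="{}"]) auto
    also have "\<dots> \<le> exp R / exp (l * t)" using that by (intro divide_right_mono) auto
    also have "\<dots> = exp (- (l * t) + R)" by (simp add: exp_diff[symmetric])
    finally show ?thesis .
  qed
  have "measure M {x \<in> space M. \<bar>f x - c\<bar> \<ge> t} \<le>
    measure M ({x \<in> space M. exp (l * (f x - c)) \<ge> exp (l * t)} \<union> {x \<in> space M. exp (- l * (f x
        - c)) \<ge> exp (l * t)})"
  proof (rule finite_measure_mono)
    show "{x \<in> space M. \<bar>f x - c\<bar> \<ge> t} \<subseteq> {x \<in> space M. exp (l * (f x
        - c)) \<ge> exp (l * t)} \<union> {x \<in> space M. exp (- l * (f x - c)) \<ge> exp (l * t)}"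
    proof
      fix x assume x: "x \<in> {x \<in> space M. \<bar>f x - c\<bar> \<ge> t}"
      then have "t \<le> f x - c \<or> t \<le> - (f x - c)" by (auto simp: abs_if split: if_splits)
      then have "l * t \<le> l * (f x - c) \<or> l * t \<le> l * (- (f x - c))" using l
          by (meson mult_left_mono less_imp_le)
      then have "l * t \<le> l * (f x - c) \<or> l * t \<le> - l * (f x - c)" by (auto simp: algebra_simps)
      then show "x \<in> {x \<in> space M. exp (l * (f x - c)) \<ge> exp (l * t)} \<union> {x \<in> space M. exp (- l * (f x
          - c)) \<ge> exp (l * t)}"
        using x unfolding Un_iff mem_Collect_eq exp_le_cancel_iff by blast
    qed
  qed measurable
  also have "\<dots> \<le> measure M {x \<in> space M. exp (l * (f x - c)) \<ge> exp (l * t)}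
      + measure M {x \<in> space M. exp (- l * (f x - c)) \<ge> exp (l * t)}"
    by (rule measure_Un_le) measurable
  also have "\<dots> \<le> exp (- (l * t) + R) + exp (- (l * t) + R)" by (intro add_mono one le)
  finally show ?thesis by simp
qed

text \<open>
  Truncation does not increase increments of \<open>f\<close>.  Negative \<open>s\<close> are covered by applying the bound for
  positive parameters to the negated truncations.
\<close>

lemma mgf_bound_lipschitz:
  fixes f :: "(nat \<Rightarrow> nat \<Rightarrow> real) \<Rightarrow> real"
  assumes r: "1 < r" "r < 2" and prob: "prob_space \<mu>" and sets_mu: "sets \<mu> = sets (Rdim d)"
    and LO: "latala_oleszkiewicz d \<mu> r K0" and L2: "0 \<le> L2" and Lr: "0 \<le> Lr"
    and f_lip: "\<And>x y. x \<in> space (power_measure n (Rdim d)) \<Longrightarrow> y \<in> space (power_measure n (Rdim d)) \<Longrightarrow>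
       \<bar>f x - f y\<bar> \<le> L2 * euclid_norm d n (\<lambda>i j. x i j - y i j) \<and>
       \<bar>f x - f y\<bar> \<le> Lr * mixed_norm d n r (\<lambda>i j. x i j - y i j)"
    and A: "mls_const (2 * (1 - 1 / r)) (max 1 K0) \<le> A" and q: "q = r / (r - 1)"
  defines "P \<equiv> power_measure n \<mu>"
  shows "f \<in> borel_measurable P" "integrable P (\<lambda>x. exp (s * (f x - (\<integral>y. f y \<partial>P))))"
    "(\<integral>x. exp (s * (f x - (\<integral>y. f y \<partial>P))) \<partial>P) \<le> exp (A * L2\<^sup>2 * s\<^sup>2 + A * Lr powr q * \<bar>s\<bar> powr q)"
proof -
  have pl: "product_lipschitz d n \<mu> r K0 L2 Lr (real m) (\<lambda>x. e * truncate m (f x))" if e: "\<bar>e\<bar>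
      = 1" for e m
  proof (rule product_lipschitz.intro)
    show "1 < r" by fact
    show "r < 2" by fact
    show "prob_space \<mu>" by fact
    show "sets \<mu> = sets (Rdim d)" by fact
    show "latala_oleszkiewicz d \<mu> r K0" by fact
    show "0 \<le> L2" by fact
    show "0 \<le> Lr" by fact
    show "\<bar>e * truncate m (f x)\<bar> \<le> real m" for x using truncate_bounds(1)[of m "f x"] e by
        (simp add: abs_mult)
    fix x y assume xy: "x \<in> space (power_measure n (Rdim d))" "y \<in> space (power_measure n (Rdim d))"
    have "\<bar>e * truncate m (f x) - e * truncate m (f y)\<bar> = \<bar>truncate m (f x) - truncate m (f y)\<bar>"
      using e by (simp add: right_diff_distrib[symmetric] abs_mult)
    then have "\<bar>e * truncate m (f x) - e * truncate m (f y)\<bar> \<le> \<bar>f x - f y\<bar>"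
        using truncate_lipschitz[of m "f x" "f y"] by simp
    then show "\<bar>e * truncate m (f x) - e * truncate m (f y)\<bar>
        \<le> L2 * euclid_norm d n (\<lambda>i j. x i j - y i j)"
      "\<bar>e * truncate m (f x) - e * truncate m (f y)\<bar> \<le> Lr * mixed_norm d n r (\<lambda>i j. x i j - y i j)"
      using f_lip[OF xy] by auto
  qed
  interpret P: prob_space P unfolding P_def using product_lipschitz.prob_power[OF pl[of 1]] by simp
  have tm: "(\<lambda>x. truncate m (f x)) \<in> borel_measurable P" for m
    using product_lipschitz.f_measurable[OF pl[of 1 m]] by (simp add: P_def)
  show fm: "f \<in> borel_measurable P"
    by (rule borel_measurable_LIMSEQ_real[of _
        "\<lambda>m x. truncate m (f x)"]) (use tm truncate_tendsto in auto)
  let ?a = "mls_const (2 * (1 - 1 / r)) (max 1 K0)"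
  have mono: "exp (?a * L2\<^sup>2 * s\<^sup>2 + ?a * Lr powr q * \<bar>s\<bar> powr q)
      \<le> exp (A * L2\<^sup>2 * s\<^sup>2 + A * Lr powr q * \<bar>s\<bar> powr q)" for s
    using A by (auto intro!: add_mono mult_right_mono)
  have R: "(\<integral>x. exp (s * (truncate m (f x) - (\<integral>y. truncate m (f y) \<partial>P))) \<partial>P)
      \<le> exp (A * L2\<^sup>2 * s\<^sup>2 + A * Lr powr q * \<bar>s\<bar> powr q)" for m s
  proof -
    consider "s = 0" | "s > 0" | "s < 0" by linarith
    then show ?thesis
    proof cases
      case 1 then show ?thesis by (simp add: P.prob_space)
    next
      case 2
      from product_lipschitz.mgf_le[OF pl[of 1 m] 2] 2
      have "(\<integral>x. exp (s * (truncate m (f x) - (\<integral>y. truncate m (f y) \<partial>P))) \<partial>P)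
          \<le> exp (?a * L2\<^sup>2 * s\<^sup>2 + ?a * Lr powr q * \<bar>s\<bar> powr q)"
        by (simp add: product_lipschitz.b_def[OF pl[of 1 m]] product_lipschitz.q_def[OF pl[of 1 m]] q
            P_def)
      also note mono
      finally show ?thesis .
    next
      case 3
      then have s: "- s > 0" by simp
      have "(\<integral>x. exp (s * (truncate m (f x) - (\<integral>y. truncate m (f y) \<partial>P))) \<partial>P)
        = (\<integral>x. exp (- s * (-1 * truncate m (f x) - (\<integral>y. -1 * truncate m (f y) \<partial>P))) \<partial>P)"
        by (simp add: algebra_simps)
      also have "\<dots> \<le> exp (?a * L2\<^sup>2 * (- s)\<^sup>2 + ?a * Lr powr q * (- s) powr q)"
        using product_lipschitz.mgf_le[OF pl[of "-1" m] s]
        unfolding product_lipschitz.b_def[OF pl[of "-1" m, simplified]] product_lipschitz.q_def[OF pl[of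
            "-1" m, simplified]] q P_def by simp
      also have "\<dots> = exp (?a * L2\<^sup>2 * s\<^sup>2 + ?a * Lr powr q * \<bar>s\<bar> powr q)" using 3 by simp
      also note mono
      finally show ?thesis .
    qed
  qed
  show "integrable P (\<lambda>x. exp (s * (f x - (\<integral>y. f y \<partial>P))))"
    "(\<integral>x. exp (s * (f x - (\<integral>y. f y \<partial>P))) \<partial>P) \<le> exp (A * L2\<^sup>2 * s\<^sup>2 + A * Lr powr q * \<bar>s\<bar> powr q)"
    using P.mgf_bound_of_truncations(2,3)[OF fm R] by blast+
qed

theorem corollary2p3:
  fixes r C_LO :: real
  assumes "1 < r" and "r < 2"
  shows "\<exists>C>0. \<forall>d>0. \<forall>\<mu>.
    prob_space \<mu> \<longrightarrow> sets \<mu> = sets (Rdim d) \<longrightarrow> latala_oleszkiewicz d \<mu> r C_LO \<longrightarrow>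
    (\<forall>n>0. \<forall>L2>0. \<forall>Lr2>0. \<forall>f.
      (\<forall>x\<in>space (power_measure n (Rdim d)). \<forall>y\<in>space (power_measure n (Rdim d)).
         \<bar>f x - f y\<bar> \<le> L2 * euclid_norm d n (\<lambda>i j. x i j - y i j) \<and>
         \<bar>f x - f y\<bar> \<le> Lr2 * mixed_norm d n r (\<lambda>i j. x i j - y i j)) \<longrightarrow>
      (\<forall>t>0.
         measure (power_measure n \<mu>)
           {x \<in> space (power_measure n \<mu>). \<bar>f x - (\<integral>z. f z \<partial>power_measure n \<mu>)\<bar> \<ge> t}
         \<le> 2 * exp (- (1 / 2) *
               min (t\<^sup>2 / (C * L2\<^sup>2)) (t powr r / (C powr (r - 1) * Lr2 powr r)))))"
proof -
  define A where "A = max 1 (mls_const (2 * (1 - 1 / r)) (max 1 C_LO))"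
  have A: "A > 0" "mls_const (2 * (1 - 1 / r)) (max 1 C_LO) \<le> A" by (auto simp: A_def)
  define q where "q = r / (r - 1)"
  show ?thesis
  proof (rule exI[of _ "4 * A"], intro conjI allI impI)
    show "4 * A > 0" using A by simp
    fix d n :: nat and \<mu> :: "(nat \<Rightarrow> real) measure" and L2 Lr2 t :: real and f ::
        "(nat \<Rightarrow> nat \<Rightarrow> real) \<Rightarrow> real"
    assume mu: "prob_space \<mu>" "sets \<mu> = sets (Rdim d)" "latala_oleszkiewicz d \<mu> r C_LO"
      and L: "L2 > 0" "Lr2 > 0" and t: "t > 0"
      and lip: "\<forall>x\<in>space (power_measure n (Rdim d)). \<forall>y\<in>space (power_measure n (Rdim d)).
         \<bar>f x - f y\<bar> \<le> L2 * euclid_norm d n (\<lambda>i j. x i j - y i j) \<and>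
         \<bar>f x - f y\<bar> \<le> Lr2 * mixed_norm d n r (\<lambda>i j. x i j - y i j)"
    let ?P = "power_measure n \<mu>"
    interpret P: prob_space ?P unfolding power_measure_def by (intro prob_space_PiM mu)
    note mgf = mgf_bound_lipschitz[OF assms mu less_imp_le[OF L(1)] less_imp_le[OF L(2)]
        lip[rule_format] A(2) q_def]
    obtain l where l: "l > 0" "- (l * t) + (A * L2\<^sup>2 * l\<^sup>2 + A * Lr2 powr q * l powr q)
        \<le> - (1 / 2) * min (t\<^sup>2 / (4 * A * L2\<^sup>2)) (t powr r / ((4 * A) powr (r - 1) * Lr2 powr r))"
      using chernoff_exponent[OF assms(1) q_def A(1) L t] by blast
    have al: "\<bar>l\<bar> = l" "\<bar>- l\<bar> = l" using l(1) by auto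
    have "measure ?P {x \<in> space ?P. \<bar>f x - (\<integral>z. f z \<partial>?P)\<bar> \<ge> t}
        \<le> 2 * exp (- (l * t) + (A * L2\<^sup>2 * l\<^sup>2 + A * Lr2 powr q * l powr q))"
    proof (rule P.chernoff_two_sided[where f=f and l=l and c="\<integral>z. f z \<partial>?P" and t=t])
      show "f \<in> borel_measurable ?P" by (rule mgf(1))
      show "l > 0" by (rule l(1))
      show "integrable ?P (\<lambda>x. exp (s * (f x - (\<integral>z. f z \<partial>?P))))" for s by (rule mgf(2))
      show "(\<integral>x. exp (l * (f x - (\<integral>z. f z \<partial>?P))) \<partial>?P) \<le> exp (A * L2\<^sup>2 * l\<^sup>2 + A * Lr2 powr q * l powr q)"
        by (rule mgf(3)[where s=l, unfolded al])
      show "(\<integral>x. exp (- l * (f x - (\<integral>z. f z \<partial>?P))) \<partial>?P)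
          \<le> exp (A * L2\<^sup>2 * l\<^sup>2 + A * Lr2 powr q * l powr q)"
        by (rule mgf(3)[where s="- l", unfolded al power2_minus])
    qed
    also have "\<dots> \<le> 2 * exp (- (1 / 2) * min (t\<^sup>2 / (4 * A * L2\<^sup>2)) (t powr r / ((4 * A) powr (r
        - 1) * Lr2 powr r)))"
      using l(2) by simp
    finally show "measure ?P {x \<in> space ?P. \<bar>f x - (\<integral>z. f z \<partial>?P)\<bar> \<ge> t}
      \<le> 2 * exp (- (1 / 2) * min (t\<^sup>2 / (4 * A * L2\<^sup>2)) (t powr r / ((4 * A) powr (r
          - 1) * Lr2 powr r)))" .
  qed
qed

end
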